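(* Let $m,p\in\mathbb{N}_0$ and let the real parameters $A=((a_i,\alpha_i))_{1\le i\le p}$, $B=((b_j,\beta_j))_{1\le j\le m}$ satisfy the parameter assumptions (1)-(4) of the context. Let $\mathbb{H}\in(0,1)$, let $K=\prod_{j=1}^m\Gamma(b_j+\beta_j)\big/\prod_{i=1}^p\Gamma(a_i+\alpha_i)$, and let $X^{\mathbb{H},A,B}=\{X_t^{\mathbb{H},A,B},\,t\ge0\}$ be the generalized Fox-$H$ process on $(\mathcal{S}',\mathcal{C}_\sigma(\mathcal{S}'),\mu_\Psi)$ (see context). Then: 1. For $n\in\mathbb{N}$ and $0<t_1<\dots<t_n$, the characteristic function of the random vector $X:=(X^{\mathbb{H},A,B}_{t_1},\dots,X^{\mathbb{H},A,B}_{t_n})$ is $$\mathbb{E}\big[e^{\mathrm{i}(\lambda,X)}\big]=\frac1K\,{}_m\Psi_p\!\left(-\frac{(\lambda,\Sigma_{\mathbb{H},n}\lambda)}{2}\right),\qquad \lambda\in\mathbb{R}^n,$$ where $\Sigma_{\mathbb{H},n}=(\sigma_{l,k})_{l,k=1}^n$ with $\sigma_{l,k}=\frac12\big(|t_l|^{2\mathbb{H}}+|t_k|^{2\mathbb{H}}-|t_l-t_k|^{2\mathbb{H}}\big)$. 2. For $n\in\mathbb{N}$ and $0<t_1<\dots<t_n$, let $$\varrho_{B^{\mathbb{H}}}(x)=\frac{1}{(2\pi)^{n/2}\det(\Sigma_{\mathbb{H},n})^{1/2}}\exp\!\left(-\frac{(x,\Sigma_{\mathbb{H},n}^{-1}x)}{2}\right),\quad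 x\in\mathbb{R}^n,$$ be the joint density of fractional Brownian motion with Hurst parameter $\mathbb{H}$ at times $t_1,\dots,t_n$. Then the joint probability density function of $(X^{\mathbb{H},A,B}_{t_1},\dots,X^{\mathbb{H},A,B}_{t_n})$ is $$\varrho_{X^{\mathbb{H},A,B}}(x)=\frac1K\int_0^\infty\frac{1}{\tau^{n/2}}\,\varrho_{B^{\mathbb{H}}}\!\left(\frac{x}{\sqrt\tau}\right)H^{m,0}_{p,m}(\tau)\,\mathrm{d}\tau,\quad x\in\mathbb{R}^n.$$ 3. For each $t\ge0$ and $n\in\mathbb{N}_0$, $\mathbb{E}\big[(X_t^{\mathbb{H},A,B})^{2n+1}\big]=0$ and $$\mathbb{E}\big[(X_t^{\mathbb{H},A,B})^{2n}\big]=\frac1K\,\frac{\prod_{j=1}^m\Gamma(b_j+\beta_j(n+1))}{\prod_{i=1}^p\Gamma(a_i+\alpha_i(n+1))}\,\frac{(2n)!}{n!\,2^n}\,t^{2n\mathbb{H}}.$$ 4. For all $t,s\ge0$, $$\mathbb{E}\big[X_t^{\mathbb{H},A,B}X_s^{\mathbb{H},A,B}\big]=\frac{1}{2K}\,\frac{\prod_{j=1}^m\Gamma(b_j+2\beta_j)}{\prod_{i=1}^p\Gamma(a_i+2\alpha_i)}\big(t^{2\mathbb{H}}+s^{2\mathbb{H}}-|t-s|^{2\mathbb{H}}\big).$$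
   Context: **Parameter assumptions.** $m,p\in\mathbb{N}_0$ and: (1) $a_i\in\mathbb{R}$, $\alpha_i>0$, $a_i+\alpha_i>0$ for $i=1,\dots,p$; (2) $b_j\in\mathbb{R}$, $\beta_j>0$, $b_j+\beta_j>0$ for $j=1,\dots,m$; (3) with $a^*:=\sum_{j=1}^m\beta_j-\sum_{i=1}^p\alpha_i$ and $\mu:=\sum_{j=1}^m b_j-\sum_{i=1}^p a_i+(p-m)/2$, either $a^*>0$, or $a^*=0$ and $\mu<-1$; (4) the Fox-$H$ function $$H^{m,0}_{p,m}(\tau):=\frac{1}{2\pi \mathrm{i}}\int_{\gamma-\mathrm{i}\infty}^{\gamma+\mathrm{i}\infty}\frac{\prod_{j=1}^m\Gamma(b_j+\beta_js)}{\prod_{i=1}^p\Gamma(a_i+\alpha_is)}\,\tau^{-s}\,\mathrm{d}s,\quad \tau>0,$$ (with $\gamma>\max_j(-b_j/\beta_j)$, e.g. $\gamma=1$) is non-negative on $(0,\infty)$. Empty sums are $0$, empty products are $1$. Known fact: under these assumptions $\varrho_H:=\frac1K H^{m,0}_{p,m}$ is a probability density on $(0,\infty)$ with $\int_0^\infty\tau^l\varrho_H(\tau)\,\mathrm{d}\tau=\frac1K\prod_j\Gamma(b_j+\beta_j(l+1))/\prod_i\Gamma(a_i+\alpha_i(l+1))$, $l\in\mathbb{N}_0$, and Laplace transform $s\mapsto\frac1K\,{}_m\Psi_p(-s)$, $s\ge0$. **Generalized Wright function.** ${}_m\Psi_p(z):=\sum_{k\ge0}\frac{\prod_{j=1}^m\Gamma(b_j+\beta_j+\beta_jk)}{\prod_{i=1}^p\Gamma(a_i+\alpha_i+\alpha_ik)}\frac{z^k}{k!}$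 (entire if $a^*<1$). For $s>0$, in general, ${}_m\Psi_p(-s)$ is understood through its Fox-$H$ representation ${}_m\Psi_p(-s)=\frac{1}{2\pi \mathrm{i}}\int_{c-\mathrm{i}\infty}^{c+\mathrm{i}\infty}\Gamma(u)\frac{\prod_j\Gamma(b_j+\beta_j-\beta_ju)}{\prod_i\Gamma(a_i+\alpha_i-\alpha_iu)}s^{-u}\,\mathrm{d}u$ with $0<c<\min_j(b_j+\beta_j)/\beta_j$, and ${}_m\Psi_p(0)=K$. **The measure.** Let $\mathcal{S}=\mathcal{S}(\mathbb{R})$ be the real Schwartz space, $\mathcal{S}'$ its dual with pairing $\langle\cdot,\cdot\rangle$ extending the inner product of $L^2(\mathbb{R},\mathrm{d}x)$, and $\mathcal{C}_\sigma(\mathcal{S}')$ the cylinder $\sigma$-algebra. The generalized Fox-$H$ measure $\mu_\Psi$ is the unique probability measure on $(\mathcal{S}',\mathcal{C}_\sigma(\mathcal{S}'))$ with $\int_{\mathcal{S}'}e^{\mathrm{i}\langle\omega,\varphi\rangle}\,\mathrm{d}\mu_\Psi(\omega)=\frac1K\,{}_m\Psi_p\big(-\frac12\langle\varphi,\varphi\rangle\big)$, $\varphi\in\mathcal{S}$. One has $\|\langle\cdot,\varphi\rangle\|_{L^2(\mu_\Psi)}=c\,|\varphi|_{L^2(\mathbb{R})}$ for a constant $c$; hence $\langle\cdot,f\rangle\in L^2(\mu_\Psi)$ is defined for $f\in L^2(\mathbb{R})$ as the $L^2(\mu_\Psi)$-limit of $\langle\cdot,\varphi_n\rangle$, $\varphi_n\in\mathcal{S}$,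 $\varphi_n\to f$ in $L^2(\mathbb{R})$. $\mathbb{E}$ denotes expectation under $\mu_\Psi$. **Fractional operator.** $M_-^{\mathbb{H}}f=K_{\mathbb{H}}D_-^{1/2-\mathbb{H}}f$ if $\mathbb{H}<1/2$, $M_-^{1/2}f=f$, $M_-^{\mathbb{H}}f=K_{\mathbb{H}}I_-^{\mathbb{H}-1/2}f$ if $\mathbb{H}>1/2$, where for $\sigma\in(0,1)$ $(I_-^\sigma f)(x)=\frac{1}{\Gamma(\sigma)}\int_x^\infty f(t)(t-x)^{\sigma-1}\mathrm{d}t$, $(D_-^\sigma f)(x)=-\frac{1}{\Gamma(1-\sigma)}\frac{\mathrm{d}}{\mathrm{d}x}\int_x^\infty f(t)(t-x)^{-\sigma}\mathrm{d}t$, and $K_{\mathbb{H}}=\Gamma(\mathbb{H}+\tfrac12)\big(\int_0^\infty((1+s)^{\mathbb{H}-1/2}-s^{\mathbb{H}-1/2})^2\mathrm{d}s+\frac{1}{2\mathbb{H}}\big)^{-1/2}$. Known: $M_-^{\mathbb{H}}\mathbf{1}_{[0,t)}\in L^2(\mathbb{R})$ and $(M_-^{\mathbb{H}}\mathbf{1}_{[0,t)},M_-^{\mathbb{H}}\mathbf{1}_{[0,s)})_{L^2}=\frac12(t^{2\mathbb{H}}+s^{2\mathbb{H}}-|t-s|^{2\mathbb{H}})$. **Generalized Fox-$H$ process.** $X_t^{\mathbb{H},A,B}:=\langle\cdot,M_-^{\mathbb{H}}\mathbf{1}_{[0,t)}\rangle$, $t\ge0$. $(\cdot,\cdot)$ is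 the Euclidean inner product on $\mathbb{R}^n$. *)

theory Defs
  imports "HOL-Probability.Probability"
begin

section \<open>The Fox H-function and the generalized Wright function\<close>

text \<open>
  The parameter families \<open>A = ((a\<^sub>i, \<alpha>\<^sub>i))\<close>, \<open>1 \<le> i \<le> p\<close>, and \<open>B = ((b\<^sub>j, \<beta>\<^sub>j))\<close>, \<open>1 \<le> j \<le> m\<close>, are
  lists of pairs, so \<open>p = length A\<close> and \<open>m = length B\<close>; the empty list is allowed for either.
  All Gamma products of the theory are values of the quotient
  \<open>\<Prod>\<^sub>j \<Gamma>(b\<^sub>j + \<beta>\<^sub>j s) / \<Prod>\<^sub>i \<Gamma>(a\<^sub>i + \<alpha>\<^sub>i s)\<close>.
  Since \<open>Gamma\<close> is \<open>0\<close> at its poles and \<open>x / 0 = 0\<close>, a pole in the denominator gives the value \<open>0\<close>,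
  which is the value of the entire function \<open>1/\<Gamma>\<close> there.
\<close>

definition gamma_quot :: "(real \<times> real) list \<Rightarrow> (real \<times> real) list \<Rightarrow> 'a::Gamma \<Rightarrow> 'a" where
  "gamma_quot A B s =
     (\<Prod>(b, \<beta>)\<leftarrow>B. Gamma (of_real b + of_real \<beta> * s)) /
     (\<Prod>(a, \<alpha>)\<leftarrow>A. Gamma (of_real a + of_real \<alpha> * s))"

definition K_const :: "(real \<times> real) list \<Rightarrow> (real \<times> real) list \<Rightarrow> real" where
  "K_const A B = (\<Prod>(b, \<beta>)\<leftarrow>B. Gamma (b + \<beta>)) / (\<Prod>(a, \<alpha>)\<leftarrow>A. Gamma (a + \<alpha>))"

definition a_star :: "(real \<times> real) list \<Rightarrow> (real \<times> real) list \<Rightarrow> real" where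
  "a_star A B = (\<Sum>(b, \<beta>)\<leftarrow>B. \<beta>) - (\<Sum>(a, \<alpha>)\<leftarrow>A. \<alpha>)"

definition mu_exponent :: "(real \<times> real) list \<Rightarrow> (real \<times> real) list \<Rightarrow> real" where
  "mu_exponent A B =
     (\<Sum>(b, \<beta>)\<leftarrow>B. b) - (\<Sum>(a, \<alpha>)\<leftarrow>A. a) + (real (length A) - real (length B)) / 2"

text \<open>
  \<open>\<integral> f(s) ds\<close> over the upward vertical line \<open>Re s = \<gamma>\<close>, parametrised by \<open>s = \<gamma> + \<i>y\<close>. Under the
  parameter assumptions the integrals below converge absolutely, so the Lebesgue integral is the
  right notion.
\<close>

definition vline_integral :: "real \<Rightarrow> (complex \<Rightarrow> complex) \<Rightarrow> complex" where
  "vline_integral \<gamma> f = (CLINT y|lborel. f (Complex \<gamma> y) * \<i>)"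

definition foxH :: "(real \<times> real) list \<Rightarrow> (real \<times> real) list \<Rightarrow> real \<Rightarrow> real \<Rightarrow> complex" where
  "foxH A B \<gamma> \<tau> =
     1 / (2 * of_real pi * \<i>) *
     vline_integral \<gamma> (\<lambda>s. gamma_quot A B s * of_real \<tau> powr (- s))"

text \<open>
  The generalized Wright function \<open>\<^sub>m\<Psi>\<^sub>p\<close> on the real line. The power series need not converge for
  \<open>a_star A B \<ge> 1\<close>; at a negative argument \<open>z = -s\<close> the function is therefore given by its Fox H
  representation, where \<open>c\<close> is the abscissa of the contour and
  \<open>b\<^sub>j + \<beta>\<^sub>j - \<beta>\<^sub>j u = b\<^sub>j + \<beta>\<^sub>j (1 - u)\<close>. At \<open>z = 0\<close> the series reduces to its term \<open>k = 0\<close>, that is \<open>K\<close>.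
\<close>

definition gen_wright :: "(real \<times> real) list \<Rightarrow> (real \<times> real) list \<Rightarrow> real \<Rightarrow> real \<Rightarrow> complex" where
  "gen_wright A B c z =
     (if z < 0
      then 1 / (2 * of_real pi * \<i>) *
           vline_integral c (\<lambda>u. Gamma u * gamma_quot A B (1 - u) * of_real (- z) powr (- u))
      else of_real (\<Sum>k. gamma_quot A B (1 + real k) * z ^ k / fact k))"

lemma gen_wright_0: "gen_wright A B c 0 = of_real (K_const A B)"
proof -
  have "(\<Sum>k. gamma_quot A B (1 + real k) * 0 ^ k / fact k) = gamma_quot A B (1::real)"
    using powser_zero[of "\<lambda>k. gamma_quot A B (1 + real k) / fact k"] by simp
  then show ?thesis
    by (simp add: gen_wright_def gamma_quot_def K_const_def)
qed

definition foxH_contour :: "(real \<times> real) list \<Rightarrow> real \<Rightarrow> bool" where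
  "foxH_contour B \<gamma> \<longleftrightarrow> (\<forall>(b, \<beta>)\<in>set B. \<gamma> > - b / \<beta>)"

definition wright_contour :: "(real \<times> real) list \<Rightarrow> real \<Rightarrow> bool" where
  "wright_contour B c \<longleftrightarrow> 0 < c \<and> (\<forall>(b, \<beta>)\<in>set B. c < (b + \<beta>) / \<beta>)"

definition foxH_parameters :: "(real \<times> real) list \<Rightarrow> (real \<times> real) list \<Rightarrow> real \<Rightarrow> bool" where
  "foxH_parameters A B \<gamma> \<longleftrightarrow>
     (\<forall>(a, \<alpha>)\<in>set A. \<alpha> > 0 \<and> a + \<alpha> > 0) \<and>
     (\<forall>(b, \<beta>)\<in>set B. \<beta> > 0 \<and> b + \<beta> > 0) \<and>
     (a_star A B > 0 \<or> a_star A B = 0 \<and> mu_exponent A B < -1) \<and>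
     (\<forall>\<tau>>0. foxH A B \<gamma> \<tau> \<in> \<real>\<^sub>\<ge>\<^sub>0)"


section \<open>Schwartz functions and tempered distributions\<close>

definition schwartz :: "(real \<Rightarrow> real) set" where
  "schwartz = {\<phi>. (\<forall>n x. (deriv ^^ n) \<phi> differentiable (at x)) \<and>
                  (\<forall>k n. bounded (range (\<lambda>x. x ^ k * (deriv ^^ n) \<phi> x)))}"

definition schwartz_seminorm :: "nat \<Rightarrow> nat \<Rightarrow> (real \<Rightarrow> real) \<Rightarrow> real" where
  "schwartz_seminorm k n \<phi> = (SUP x. \<bar>x ^ k * (deriv ^^ n) \<phi> x\<bar>)"

definition schwartz_topology :: "(real \<Rightarrow> real) topology" where
  "schwartz_topology = topology_generated_by
     {{\<psi> \<in> schwartz. schwartz_seminorm k n (\<lambda>x. \<psi> x - \<phi> x) < \<epsilon>} |\<phi> k n \<epsilon>. \<phi> \<in> schwartz \<and> 0 < \<epsilon>}"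

lemma topspace_schwartz_topology: "topspace schwartz_topology = schwartz"
proof
  show "topspace schwartz_topology \<subseteq> schwartz"
    unfolding schwartz_topology_def topology_generated_by_topspace by blast
  show "schwartz \<subseteq> topspace schwartz_topology"
  proof
    fix \<phi> assume \<phi>: "\<phi> \<in> schwartz"
    then have "\<phi> \<in> {\<psi> \<in> schwartz. schwartz_seminorm 0 0 (\<lambda>x. \<psi> x - \<phi> x) < 1}"
      by (simp add: schwartz_seminorm_def)
    moreover have "(0::real) < 1" by simp
    ultimately show "\<phi> \<in> topspace schwartz_topology"
      unfolding schwartz_topology_def topology_generated_by_topspace using \<phi> by blast
  qed
qed

text \<open>
  A tempered distribution is a functional on \<open>schwartz\<close>; being \<open>extensional\<close> makes it a unique
  HOL function. The pairing \<open>\<langle>\<omega>, \<phi>\<rangle>\<close> is the application \<open>\<omega> \<phi>\<close>; a function \<open>f\<close> in \<open>L\<^sup>2\<close>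
  is identified with \<open>\<phi> \<mapsto> \<integral> f \<phi> dx\<close>.
\<close>

definition tempered :: "((real \<Rightarrow> real) \<Rightarrow> real) set" where
  "tempered = {\<omega> \<in> extensional schwartz.
     (\<forall>\<phi>\<in>schwartz. \<forall>\<psi>\<in>schwartz. \<forall>r s. \<omega> (\<lambda>x. r * \<phi> x + s * \<psi> x) = r * \<omega> \<phi> + s * \<omega> \<psi>) \<and>
     continuous_map schwartz_topology euclideanreal \<omega>}"

definition cylinder_algebra :: "((real \<Rightarrow> real) \<Rightarrow> real) measure" where
  "cylinder_algebra = sigma tempered
     {{\<omega> \<in> tempered. restrict \<omega> J \<in> S} |J S.
        finite J \<and> J \<subseteq> schwartz \<and> S \<in> sets (Pi\<^sub>M J (\<lambda>_. borel :: real measure))}"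

definition is_foxH_measure ::
    "(real \<times> real) list \<Rightarrow> (real \<times> real) list \<Rightarrow> real \<Rightarrow> ((real \<Rightarrow> real) \<Rightarrow> real) measure \<Rightarrow> bool" where
  "is_foxH_measure A B c \<mu> \<longleftrightarrow>
     prob_space \<mu> \<and> sets \<mu> = sets cylinder_algebra \<and>
     (\<forall>\<phi>\<in>schwartz. (CLINT \<omega>|\<mu>. exp (\<i> * of_real (\<omega> \<phi>))) =
        1 / of_real (K_const A B) * gen_wright A B c (- (1 / 2) * (LBINT x. \<phi> x * \<phi> x)))"


section \<open>Extension of the pairing to square integrable functions\<close>

definition square_integrable :: "'a measure \<Rightarrow> ('a \<Rightarrow> real) \<Rightarrow> bool" where
  "square_integrable M f \<longleftrightarrow> f \<in> borel_measurable M \<and> integrable M (\<lambda>x. (f x)\<^sup>2)"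

definition L2_tendsto :: "'a measure \<Rightarrow> (nat \<Rightarrow> 'a \<Rightarrow> real) \<Rightarrow> ('a \<Rightarrow> real) \<Rightarrow> bool" where
  "L2_tendsto M F f \<longleftrightarrow>
     (\<forall>n. square_integrable M (F n)) \<and> square_integrable M f \<and>
     (\<lambda>n. LINT x|M. (F n x - f x)\<^sup>2) \<longlonglongrightarrow> 0"

text \<open>
  \<open>is_pairing \<mu> f Y\<close>: the random variable \<open>Y\<close> is a version of \<open>\<langle>\<cdot>, f\<rangle>\<close>, an element of \<open>L\<^sup>2(\<mu>)\<close> and hence
  determined only up to \<open>\<mu>\<close>-null sets. For \<open>is_foxH_measure A B c \<mu>\<close> the limit does not depend on
  the approximating sequence.
\<close>

definition is_pairing ::
    "((real \<Rightarrow> real) \<Rightarrow> real) measure \<Rightarrow> (real \<Rightarrow> real) \<Rightarrow> (((real \<Rightarrow> real) \<Rightarrow> real) \<Rightarrow> real) \<Rightarrow> bool" where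
  "is_pairing \<mu> f Y \<longleftrightarrow>
     (\<exists>\<phi>. (\<forall>n. \<phi> n \<in> schwartz) \<and> L2_tendsto lborel \<phi> f \<and> L2_tendsto \<mu> (\<lambda>n \<omega>. \<omega> (\<phi> n)) Y)"


section \<open>Fractional operators and the process\<close>

definition frac_integral :: "real \<Rightarrow> (real \<Rightarrow> real) \<Rightarrow> real \<Rightarrow> real" where
  "frac_integral \<sigma> f x = 1 / Gamma \<sigma> * (LBINT t:{x<..}. f t * (t - x) powr (\<sigma> - 1))"

text \<open>
  For \<open>f = indicator {0..<t}\<close> the derivative below fails to exist at no more than two points,
  where \<open>deriv\<close> takes unspecified values; this does not matter in \<open>L\<^sup>2\<close>.
\<close>

definition frac_deriv :: "real \<Rightarrow> (real \<Rightarrow> real) \<Rightarrow> real \<Rightarrow> real" where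
  "frac_deriv \<sigma> f x =
     - 1 / Gamma (1 - \<sigma>) * deriv (\<lambda>y. LBINT t:{y<..}. f t * (t - y) powr (- \<sigma>)) x"

definition K_hurst :: "real \<Rightarrow> real" where
  "K_hurst H = Gamma (H + 1 / 2) *
     ((LBINT s:{0<..}. ((1 + s) powr (H - 1 / 2) - s powr (H - 1 / 2))\<^sup>2) + 1 / (2 * H)) powr (- 1 / 2)"

definition M_minus :: "real \<Rightarrow> (real \<Rightarrow> real) \<Rightarrow> real \<Rightarrow> real" where
  "M_minus H f =
     (if H < 1 / 2 then (\<lambda>x. K_hurst H * frac_deriv (1 / 2 - H) f x)
      else if H = 1 / 2 then f
      else (\<lambda>x. K_hurst H * frac_integral (H - 1 / 2) f x))"

definition is_foxH_process ::
    "((real \<Rightarrow> real) \<Rightarrow> real) measure \<Rightarrow> real \<Rightarrow> (real \<Rightarrow> ((real \<Rightarrow> real) \<Rightarrow> real) \<Rightarrow> real) \<Rightarrow> bool" where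
  "is_foxH_process \<mu> H X \<longleftrightarrow> (\<forall>t\<ge>0. is_pairing \<mu> (M_minus H (indicator {0..<t})) (X t))"


section \<open>Covariance matrix and density of fractional Brownian motion\<close>

text \<open>Time points \<open>t\<^sub>1 < \<dots> < t\<^sub>n\<close> are a strictly monotone function on a finite linearly ordered type
  \<open>'n\<close> with \<open>n = CARD('n)\<close>.\<close>

definition fbm_cov :: "real \<Rightarrow> ('n::finite \<Rightarrow> real) \<Rightarrow> real^'n^'n" where
  "fbm_cov H t = (\<chi> l k. 1 / 2 *
     (\<bar>t l\<bar> powr (2 * H) + \<bar>t k\<bar> powr (2 * H) - \<bar>t l - t k\<bar> powr (2 * H)))"

definition fbm_density :: "real \<Rightarrow> ('n::finite \<Rightarrow> real) \<Rightarrow> real^'n \<Rightarrow> real" where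
  "fbm_density H t x =
     1 / ((2 * pi) powr (real CARD('n) / 2) * det (fbm_cov H t) powr (1 / 2)) *
     exp (- (x \<bullet> (matrix_inv (fbm_cov H t) *v x)) / 2)"

text \<open>
  An integral of a non-negative function with values in \<open>[0, \<infinity>]\<close>: it is finite for \<open>x \<noteq> 0\<close> but
  may diverge at \<open>x = 0\<close>. Under \<open>foxH_parameters\<close> the Fox H-function is real and non-negative.
\<close>

definition foxH_process_density ::
    "(real \<times> real) list \<Rightarrow> (real \<times> real) list \<Rightarrow> real \<Rightarrow> real \<Rightarrow> ('n::finite \<Rightarrow> real) \<Rightarrow> real^'n \<Rightarrow> ennreal" where
  "foxH_process_density A B \<gamma> H t x =
     ennreal (1 / K_const A B) *
     (\<integral>\<^sup>+\<tau>\<in>{0<..}. ennreal (1 / \<tau> powr (real CARD('n) / 2) *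
        fbm_density H t (x /\<^sub>R sqrt \<tau>) * Re (foxH A B \<gamma> \<tau>)) \<partial>lborel)"

end

theory Submission
  imports Defs "HOL-Complex_Analysis.Complex_Analysis" "HOL-Real_Asymp.Real_Asymp"
begin

text \<open>
  Under \<open>\<mu>\<close> the pairing \<open>\<langle>\<cdot>, f\<rangle>\<close> is distributed like \<open>\<surd>\<tau> \<parallel>f\<parallel> Z\<close>, where \<open>Z\<close> is standard normal and
  \<open>\<tau>\<close> is independent of \<open>Z\<close> with density \<open>H/K\<close>: this is what the Laplace transform
  \<open>\<integral> exp (-s\<tau>) H(\<tau>) d\<tau> = \<Psi>(-s)\<close> says about characteristic functions. The Laplace transform is
  Fubini's theorem once the contour of \<open>H\<close> has been moved to the abscissa \<open>1 - c\<close>; moving it needs the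
  decay of Gamma quotients on vertical strips, which comes from two-sided Stirling bounds for
  \<open>\<bar>\<Gamma>(x + \<i>y)\<bar>\<close>. The moments \<open>\<integral> \<tau>\<^sup>n H(\<tau>) d\<tau>\<close> follow from Cauchy's integral formula. Finally
  \<open>M\<^sub>- 1\<^bsub>[0,t)\<^esub>\<close> is the Mandelbrot--van Ness kernel, whose Gram matrix is the covariance of fractional
  Brownian motion by translation invariance and scaling, and which is linearly independent for distinct
  times, so that the covariance matrix is positive definite.
\<close>

section \<open>Stirling bounds for the Gamma function\<close>

text \<open>If \<open>a_star A B = 0\<close>, the Gamma quotient has no exponential decay on
  vertical lines, only the power \<open>mu_exponent A B < -1\<close> of the height. Exponentials and
  powers therefore have to cancel exactly between numerator and denominator, which forces upper and
  lower bounds for Gamma with the same exponents, differing in the constant only. The Mellin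
  integral of exp (-s \<tau>) against \<tau> powr (-\<sigma>) converges only for \<sigma> < 1, and
  that of \<tau>^n for no \<sigma> at all. The first fact dictates the contour of the Laplace
  transform, the second the splitting of the moment integral at \<tau> = 1. The measure is known
  only through its characteristic function on Schwartz functions. Moments are obtained by
  identifying the law of a pairing with the mixture and integrating there, so that integrability
  comes with the value and no characteristic function is differentiated. Joint laws reduce to single
  pairings because pairings are closed under linear combinations.\<close>

lemma norm_Ln_minus_Pade_le:
  fixes w :: complex
  assumes "0 \<le> Re w"
  shows "norm (Ln (1 + w) - 2 * w / (2 + w)) \<le> norm w ^ 3 / 4"
proof -
  define S where "S = {v::complex. 0 \<le> Re v} \<inter> cball 0 (norm w)"
  \<comment> \<open>\<open>2 * v / (2 + v)\<close> is the (1,1) Pade approximant of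
    \<open>Ln (1 + v)\<close>. The derivative of the error is v^2 / ((1 + v) (2 + v)^2), of second
    order at 0, and in the right half-plane both denominators stay away from 0.\<close>
  define u where "u = (\<lambda>v::complex. Ln (1 + v) - 2 * v / (2 + v))"
  have ge: "1 \<le> norm (1 + v)" "2 \<le> norm (2 + v)" if "0 \<le> Re v" for v
    using that complex_Re_le_cmod[of "1 + v"] complex_Re_le_cmod[of "2 + v"] by auto
  have "convex S"
    unfolding S_def by (intro convex_Int convex_halfspace_Re_ge convex_cball)
  moreover have "(u has_field_derivative v\<^sup>2 / ((1 + v) * (2 + v)\<^sup>2)) (at v within S)" if "v \<in> S" for v
  proof -
    have "0 \<le> Re v" using that by (simp add: S_def)
    note g = ge[OF this]
    have ne: "1 + v \<noteq> 0" "2 + v \<noteq> 0" "1 + v \<notin> \<real>\<^sub>\<le>\<^sub>0"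
      using g \<open>0 \<le> Re v\<close> by (auto simp: complex_nonpos_Reals_iff)
    have "(u has_field_derivative (1 / (1 + v) - (2 * (2 + v) - 2 * v) / (2 + v)\<^sup>2)) (at v within S)"
      unfolding u_def using ne
      by (auto intro!: derivative_eq_intros simp: power2_eq_square inverse_eq_divide)
    moreover have "1 / (1 + v) - (2 * (2 + v) - 2 * v) / (2 + v)\<^sup>2 = v\<^sup>2 / ((1 + v) * (2 + v)\<^sup>2)"
      using ne by (simp add: divide_simps) (simp add: algebra_simps power2_eq_square)
    ultimately show ?thesis by simp
  qed
  moreover have "norm (v\<^sup>2 / ((1 + v) * (2 + v)\<^sup>2)) \<le> norm w ^ 2 / 4" if "v \<in> S" for v
  proof -
    have "0 \<le> Re v" "norm v \<le> norm w" using that by (simp_all add: S_def)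
    note g = ge[OF this(1)]
    have "1 * 2^2 \<le> norm (1 + v) * norm (2 + v) ^ 2"
      by (intro mult_mono power_mono g) auto
    moreover have "norm v ^ 2 \<le> norm w ^ 2"
      using \<open>norm v \<le> norm w\<close> by (simp add: power_mono)
    ultimately show ?thesis
      unfolding norm_divide norm_mult norm_power by (intro frac_le) auto
  qed
  ultimately have "norm (u w - u 0) \<le> norm w ^ 2 / 4 * norm (w - 0)"
    by (rule field_differentiable_bound) (auto simp: S_def assms)
  also have "\<dots> = norm w ^ 3 / 4"
    by (simp add: eval_nat_numeral)
  finally show ?thesis by (simp add: u_def)
qed

text \<open>
  Shifting \<open>\<Gamma>(z) e\<^sup>z z\<^bsup>1/2 - z\<^esup>\<close> by one multiplies it by \<open>exp (O(1/\<bar>z\<bar>\<^sup>2))\<close>, so summing the errors bounds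
  it above and below once its limit along \<open>z + n\<close> has been compared with that along the integers.
\<close>

definition stirling_quot :: "complex \<Rightarrow> complex" where
  "stirling_quot z = Gamma z * exp (z - (z - 1 / 2) * Ln z)"

definition stirling_step :: "complex \<Rightarrow> complex" where
  "stirling_step z = 1 - (z + 1 / 2) * (Ln (z + 1) - Ln z)"

text \<open>Both arguments lie strictly between -pi/2 and pi/2, so their difference stays on the
  principal branch.\<close>

lemma Ln_diff_Ln:
  assumes "0 < Re z" "0 < Re w"
  shows "Ln z - Ln w = Ln (z / w)"
proof -
  have "z \<noteq> 0" "w \<noteq> 0" using assms by auto
  have "\<bar>Im (Ln z)\<bar> < pi / 2" "\<bar>Im (Ln w)\<bar> < pi / 2"
    using assms Re_Ln_pos_lt[of z] Re_Ln_pos_lt[of w] \<open>z \<noteq> 0\<close> \<open>w \<noteq> 0\<close> by auto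
  then have "Im (Ln z - Ln w) < pi" "- pi < Im (Ln z - Ln w)"
    unfolding minus_complex.sel by (simp_all only: abs_less_iff) linarith+
  then have "Ln (exp (Ln z - Ln w)) = Ln z - Ln w"
    by (simp add: Ln_exp)
  then show ?thesis
    using \<open>z \<noteq> 0\<close> \<open>w \<noteq> 0\<close> by (simp add: exp_diff)
qed

lemma stirling_quot_plus1:
  assumes "0 < Re z"
  shows "stirling_quot (z + 1) = stirling_quot z * exp (stirling_step z)"
proof -
  have "z \<noteq> 0" using assms by auto
  have "z \<notin> \<int>\<^sub>\<le>\<^sub>0"
    using assms by (auto simp: nonpos_Ints_def)
  then have "Gamma (z + 1) = exp (Ln z) * Gamma z"
    using \<open>z \<noteq> 0\<close> by (simp add: Gamma_plus1)
  then show ?thesis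
    by (simp add: stirling_quot_def stirling_step_def algebra_simps flip: exp_add)
qed

text \<open>With \<open>w = 1 / z\<close> the step is the Pade error times -(2 + w) / (2 w). The
  error is cubic in w, so the quotient is still quadratic, which is summable along z, z + 1, z + 2,
  ...\<close>

lemma norm_stirling_step_le:
  assumes "1 \<le> Re z"
  shows "norm (stirling_step z) \<le> 1 / norm z ^ 2"
proof -
  define w where "w = 1 / z"
  have z: "z \<noteq> 0" "1 \<le> norm z" using assms complex_Re_le_cmod[of z] by auto
  have w: "0 \<le> Re w" "w \<noteq> 0" "norm w \<le> 1"
    using assms z by (auto simp: w_def Re_divide norm_divide)
  have w2: "2 + w \<noteq> 0" using w by (auto simp: complex_eq_iff)
  have "Ln (z + 1) - Ln z = Ln (1 + w)"
    using assms z by (subst Ln_diff_Ln) (auto simp: w_def field_simps)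
  then have "stirling_step z = 1 - (1 / w + 1 / 2) * Ln (1 + w)"
    by (simp add: stirling_step_def w_def)
  also have "\<dots> = - ((2 + w) / (2 * w) * (Ln (1 + w) - 2 * w / (2 + w)))"
    using w w2 by (simp add: divide_simps)
  finally have "stirling_step z = - ((2 + w) / (2 * w) * (Ln (1 + w) - 2 * w / (2 + w)))" .
  then have "norm (stirling_step z) = norm (2 + w) / (2 * norm w) * norm (Ln (1 + w) - 2 * w / (2 + w))"
    by (simp only: norm_minus_cancel norm_mult norm_divide) simp
  also have "\<dots> \<le> 3 / (2 * norm w) * (norm w ^ 3 / 4)"
  proof (intro mult_mono norm_Ln_minus_Pade_le divide_right_mono w)
    show "norm (2 + w) \<le> 3"
      using norm_triangle_ineq[of 2 w] w by simp
  qed auto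
  also have "\<dots> = 3 / 8 * norm w ^ 2"
    using w by (simp add: eval_nat_numeral)
  also have "\<dots> \<le> norm w ^ 2" by simp
  finally show ?thesis by (simp add: w_def norm_divide power_divide)
qed

lemma norm_stirling_quot_shift:
  assumes "1 \<le> Re z"
  shows "norm (stirling_quot (z + of_nat n)) \<le> exp 2 * norm (stirling_quot z)"
    and "norm (stirling_quot z) \<le> exp 2 * norm (stirling_quot (z + of_nat n))"
proof -
  \<comment> \<open>A telescoping majorant of the sum of 1 / (1 + k)^2 over k < n: its increments
    are 1 / ((k + 1/2) (k + 3/2)), and that product is (k + 1)^2 - 1/4. It starts at
    \<open>c 0 = 0\<close> and stays below 2, hence the factor \<open>exp 2\<close>.\<close>
  define c where "c = (\<lambda>n::nat. 2 - 1 / (real n + 1 / 2))"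
  have "norm (stirling_quot (z + of_nat n)) \<le> exp (c n) * norm (stirling_quot z) \<and>
        norm (stirling_quot z) \<le> exp (c n) * norm (stirling_quot (z + of_nat n))"
  proof (induction n)
    case 0
    then show ?case by (simp add: c_def)
  next
    case (Suc n)
    let ?z = "z + of_nat n" and ?r = "Re (stirling_step (z + of_nat n))"
    have re: "1 + real n \<le> Re ?z" using assms by simp
    have "norm (stirling_step ?z) \<le> 1 / norm ?z ^ 2"
      using re by (intro norm_stirling_step_le) simp
    also have "\<dots> \<le> 1 / (1 + real n) ^ 2"
    proof (intro divide_left_mono power_mono)
      have "1 + real n \<le> norm ?z" using re complex_Re_le_cmod[of ?z] by linarith
      then show "1 + real n \<le> norm ?z" .
      then have "0 < norm ?z" by linarith
      then show "0 < norm ?z ^ 2 * (1 + real n) ^ 2" by (intro mult_pos_pos zero_less_power) auto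
    qed auto
    also have "\<dots> \<le> c (Suc n) - c n"
    proof -
      have "c (Suc n) - c n = 1 / ((real n + 1 / 2) * (real n + 3 / 2))"
        by (simp add: c_def divide_simps) (simp add: algebra_simps)
      also have "\<dots> \<ge> 1 / (1 + real n) ^ 2"
      proof (intro divide_left_mono mult_pos_pos zero_less_power)
        show "(real n + 1 / 2) * (real n + 3 / 2) \<le> (1 + real n)\<^sup>2"
          by (simp add: power2_eq_square algebra_simps)
      qed auto
      finally show ?thesis .
    qed
    finally have r: "\<bar>?r\<bar> \<le> c (Suc n) - c n"
      using abs_Re_le_cmod[of "stirling_step ?z"] by linarith
    have eq: "stirling_quot (z + of_nat (Suc n)) = stirling_quot ?z * exp (stirling_step ?z)"
      using stirling_quot_plus1[of ?z] re by (simp add: add_ac)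
    have n: "norm (stirling_quot (z + of_nat (Suc n))) = exp ?r * norm (stirling_quot ?z)"
      unfolding eq by (simp add: norm_mult)
    have up: "exp ?r * norm (stirling_quot ?z) \<le> exp (c (Suc n) - c n) * (exp (c n) * norm (stirling_quot z))"
      using r Suc by (intro mult_mono) auto
    have lo: "norm (stirling_quot z) \<le> exp (c n) * norm (stirling_quot ?z)"
      using Suc by simp
    have "norm (stirling_quot ?z) = exp (- ?r) * norm (stirling_quot (z + of_nat (Suc n)))"
      unfolding n by (simp add: exp_minus)
    also have "\<dots> \<le> exp (c (Suc n) - c n) * norm (stirling_quot (z + of_nat (Suc n)))"
      using r by (intro mult_right_mono) auto
    finally have "norm (stirling_quot z) \<le> exp (c n) * (exp (c (Suc n) - c n) * norm (stirling_quot (z + of_nat (Suc n))))"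
      using lo by (meson exp_ge_zero mult_left_mono order_trans)
    with up show ?case
      unfolding n by (simp add: exp_diff)
  qed
  moreover have "exp (c n) \<le> exp 2" by (simp add: c_def)
  ultimately show "norm (stirling_quot (z + of_nat n)) \<le> exp 2 * norm (stirling_quot z)"
    and "norm (stirling_quot z) \<le> exp 2 * norm (stirling_quot (z + of_nat n))"
    by (meson mult_right_mono norm_ge_zero order_trans)+
qed

lemma tendsto_of_nat_mult_Ln:
  fixes z :: complex
  shows "(\<lambda>n. of_nat (Suc n) * Ln (1 + z / of_nat (Suc n))) \<longlonglongrightarrow> z"
proof (rule Lim_transform2)
  show "(\<lambda>n. z) \<longlonglongrightarrow> z" by simp
  show "(\<lambda>n. z - of_nat (Suc n) * Ln (1 + z / of_nat (Suc n))) \<longlonglongrightarrow> 0"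
  proof (rule Lim_null_comparison)
    show "(\<lambda>n. norm z ^ 2 / real (Suc n) / (1 - norm z / real (Suc n))) \<longlonglongrightarrow> 0"
      by real_asymp
    have "(\<lambda>n. norm z / real (Suc n)) \<longlonglongrightarrow> 0" by real_asymp
    then have "eventually (\<lambda>n. norm z / real (Suc n) < 1) sequentially"
      by (rule order_tendstoD) simp
    then show "eventually (\<lambda>n. norm (z - of_nat (Suc n) * Ln (1 + z / of_nat (Suc n)))
        \<le> norm z ^ 2 / real (Suc n) / (1 - norm z / real (Suc n))) sequentially"
    proof eventually_elim
      case (elim n)
      let ?w = "z / of_nat (Suc n)"
      have nw: "norm ?w = norm z / real (Suc n)" by (simp add: norm_divide del: of_nat_Suc)
      have "z - of_nat (Suc n) * Ln (1 + ?w) = - (of_nat (Suc n) * (Ln (1 + ?w) - ?w))"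
        by (simp add: algebra_simps del: of_nat_Suc)
      then have "norm (z - of_nat (Suc n) * Ln (1 + ?w)) = real (Suc n) * norm (Ln (1 + ?w) - ?w)"
        by (simp only: norm_minus_cancel norm_mult norm_of_nat)
      also have "\<dots> \<le> real (Suc n) * ((norm ?w)\<^sup>2 / (1 - norm ?w))"
        using elim nw by (intro mult_left_mono Ln_approx_linear) (simp_all only: of_nat_0_le_iff)
      also have "\<dots> = norm z ^ 2 / real (Suc n) / (1 - norm z / real (Suc n))"
        by (simp add: nw power2_eq_square del: of_nat_Suc)
      finally show ?case .
    qed
  qed
qed

text \<open>Gauss's limit formula says that Gamma (z + n + 1) / n! is asymptotic to n^z. What
  remains of the ratio is exp (E n), where \<open>E n\<close> collects the logarithmic terms; they
  cancel in the limit because (n + 1) Ln (1 + z / (n + 1)) tends to z.\<close>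

lemma stirling_quot_ratio_tendsto:
  assumes "1 \<le> Re z"
  shows "(\<lambda>n. stirling_quot (z + of_nat (Suc n)) / stirling_quot (1 + of_nat n)) \<longlonglongrightarrow> 1"
proof -
  have z: "z \<notin> \<int>\<^sub>\<le>\<^sub>0"
    using assms by (auto simp: nonpos_Ints_def)
  have Gz: "Gamma z \<noteq> 0" using z by (simp add: Gamma_eq_zero_iff)
  define E where "E = (\<lambda>n. z + z * of_real (ln (real n)) + (of_nat n + 1 / 2) * Ln (of_nat (Suc n))
      - (z + of_nat n + 1 / 2) * Ln (z + of_nat (Suc n)))"
  have "(\<lambda>n. Gamma z / Gamma_series z n * exp (E n)) \<longlonglongrightarrow> Gamma z / Gamma z * exp 0"
  proof (intro tendsto_intros Gamma_series_LIMSEQ Gz)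
    define W where "W = (\<lambda>n. Ln (1 + z / of_nat (Suc n)))"
    have W1: "(\<lambda>n. of_nat (Suc n) * W n) \<longlonglongrightarrow> z"
      unfolding W_def by (rule tendsto_of_nat_mult_Ln)
    have "(\<lambda>n. of_nat (Suc n) * W n * (1 / of_nat (Suc n))) \<longlonglongrightarrow> z * 0"
      by (intro tendsto_mult W1 LIMSEQ_Suc lim_1_over_n)
    then have W0: "W \<longlonglongrightarrow> 0" by (simp del: of_nat_Suc)
    have L: "(\<lambda>n. of_real (ln (real (Suc n)) - ln (real n)) :: complex) \<longlonglongrightarrow> of_real 0"
      by (intro tendsto_of_real) real_asymp
    have "(\<lambda>n. z - z * (of_real (ln (real (Suc n)) - ln (real n))) - z * W n
        - (of_nat (Suc n) * W n) + 1 / 2 * W n) \<longlonglongrightarrow> z - z * of_real 0 - z * 0 - z + 1 / 2 * 0"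
      by (intro tendsto_intros W1 W0 L)
    moreover have "z - z * (of_real (ln (real (Suc n)) - ln (real n))) - z * W n
        - (of_nat (Suc n) * W n) + 1 / 2 * W n = E n" for n
    proof -
      have "Ln (z + of_nat (Suc n)) - Ln (of_nat (Suc n)) = W n"
        unfolding W_def using assms
        by (subst Ln_diff_Ln) (simp_all add: add_divide_distrib add.commute del: of_nat_Suc)
      then have *: "Ln (z + of_nat (Suc n)) = Ln (of_nat (Suc n)) + W n" by (simp add: algebra_simps)
      have **: "Ln (of_nat (Suc n)) = of_real (ln (real (Suc n)))"
        using Ln_of_nat[of "Suc n"] by simp
      show ?thesis
        unfolding E_def * unfolding ** by (simp add: algebra_simps)
    qed
    ultimately show "E \<longlonglongrightarrow> 0" by simp
  qed
  moreover have "eventually (\<lambda>n. Gamma z / Gamma_series z n * exp (E n) =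
      stirling_quot (z + of_nat (Suc n)) / stirling_quot (1 + of_nat n)) sequentially"
    using eventually_gt_at_top[of 0]
  proof eventually_elim
    case (elim n)
    have "Gamma (z + of_nat (Suc n)) = pochhammer z (Suc n) * Gamma z"
      using pochhammer_Gamma[OF z, of "Suc n"] Gz by simp
    moreover have "Gamma (1 + of_nat n :: complex) = fact n"
      by (simp add: Gamma_fact)
    moreover have "pochhammer z (Suc n) \<noteq> 0"
      using z by (auto simp: pochhammer_eq_0_iff)
    moreover have "exp (E n) / exp (z * of_real (ln (real n))) =
        exp (z + of_nat (Suc n) - (z + of_nat (Suc n) - 1 / 2) * Ln (z + of_nat (Suc n))) /
        exp (1 + of_nat n - (1 + of_nat n - 1 / 2) * Ln (1 + of_nat n))"
      unfolding exp_diff[symmetric] by (rule arg_cong[where f = exp]) (simp add: E_def algebra_simps)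
    ultimately show ?case
      using Gz by (simp add: stirling_quot_def Gamma_series_def field_simps del: of_nat_Suc)
  qed
  ultimately show ?thesis
    using Gz by (simp add: tendsto_cong)
qed

text \<open>The value at 1 is e, so by the shift bounds the values at integers lie between exp (-1)
  and exp 3. The ratio of the values along z + n + 1 to these tends to 1, and returning from z + n +
  1 to z costs another factor exp 2: this gives 5 = 2 + 3 and -3 = -2 - 1.\<close>

lemma norm_stirling_quot_bounds:
  assumes "1 \<le> Re z"
  shows "norm (stirling_quot z) \<le> exp 5" "exp (-3) \<le> norm (stirling_quot z)"
proof -
  let ?q = "\<lambda>n. stirling_quot (z + of_nat (Suc n)) / stirling_quot (1 + of_nat n)"
  have F1: "norm (stirling_quot 1) = exp 1" by (simp add: stirling_quot_def)
  have lim: "(\<lambda>n. norm (?q n)) \<longlonglongrightarrow> norm (1::complex)"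
    by (intro tendsto_norm stirling_quot_ratio_tendsto assms)
  have up: "norm (stirling_quot (1 + of_nat n)) \<le> exp 3" for n
    using norm_stirling_quot_shift(1)[of 1 n] F1 by (simp flip: exp_add)
  have lo: "exp (-1) \<le> norm (stirling_quot (1 + of_nat n))" for n
  proof -
    have "exp (-1) = exp (-2) * (exp 1 :: real)" by (simp flip: exp_add)
    also have "\<dots> \<le> exp (-2) * (exp 2 * norm (stirling_quot (1 + of_nat n)))"
      using norm_stirling_quot_shift(2)[of 1 n] F1 by (intro mult_left_mono) auto
    also have "\<dots> = norm (stirling_quot (1 + of_nat n))"
      by (simp add: exp_minus)
    finally show ?thesis .
  qed
  have pos: "0 < norm (stirling_quot (1 + of_nat n))" for n
    using lo[of n] by (rule less_le_trans[rotated]) simp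
  have "exp (-5) * norm (stirling_quot z) \<le> norm (?q n)" for n
  proof -
    have "exp (-5) * norm (stirling_quot z) \<le> exp (-5) * (exp 2 * norm (stirling_quot (z + of_nat (Suc n))))"
      using assms by (intro mult_left_mono norm_stirling_quot_shift) auto
    also have "\<dots> = norm (stirling_quot (z + of_nat (Suc n))) / exp 3"
      by (simp add: divide_inverse flip: exp_minus exp_add mult.assoc)
    also have "\<dots> \<le> norm (stirling_quot (z + of_nat (Suc n))) / norm (stirling_quot (1 + of_nat n))"
      using up[of n] pos[of n] by (intro divide_left_mono) auto
    finally show ?thesis by (simp add: norm_divide)
  qed
  then have "exp (-5) * norm (stirling_quot z) \<le> norm (1::complex)"
    by (intro LIMSEQ_le_const[OF lim]) auto
  then show "norm (stirling_quot z) \<le> exp 5"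
    by (simp add: exp_minus divide_simps)
  have "norm (?q n) \<le> exp 3 * norm (stirling_quot z)" for n
  proof -
    have "norm (?q n) = norm (stirling_quot (z + of_nat (Suc n))) / norm (stirling_quot (1 + of_nat n))"
      by (simp add: norm_divide)
    also have "\<dots> \<le> exp 2 * norm (stirling_quot z) / exp (-1)"
      using assms lo[of n] by (intro frac_le norm_stirling_quot_shift) auto
    also have "\<dots> = exp 3 * norm (stirling_quot z)"
    proof -
      have "exp 2 / exp (- 1) = (exp 3 :: real)" by (simp flip: exp_diff)
      then show ?thesis by (metis times_divide_eq_left)
    qed
    finally show ?thesis .
  qed
  then have "norm (1::complex) \<le> exp 3 * norm (stirling_quot z)"
    by (intro LIMSEQ_le_const2[OF lim]) auto
  then show "exp (-3) \<le> norm (stirling_quot z)"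
    by (simp add: exp_minus divide_simps mult.commute)
qed


text \<open>For z = x + iy the modulus is that of the Stirling quotient times |z|^(x - 1/2) exp (-y
  arg z - x). Here y arg z = pi |y| / 2 - |y| arctan (x / |y|), whose last term lies between 0 and
  x, and |y| <= |z| <= (1 + b) |y|. All deviations from \<open>G\<close> are thus bounded
  factors.\<close>

lemma norm_Gamma_bounds_right:
  assumes "1 \<le> Re z" "Re z \<le> b" "1 \<le> \<bar>Im z\<bar>"
  defines "G \<equiv> \<bar>Im z\<bar> powr (Re z - 1 / 2) * exp (- pi * \<bar>Im z\<bar> / 2)"
  shows "norm (Gamma z) \<le> exp 5 * (1 + b) powr b * G" "exp (- 3 - b) * G \<le> norm (Gamma z)"
proof -
  let ?x = "Re z" and ?y = "\<bar>Im z\<bar>"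
  have z: "z \<noteq> 0" using assms by auto
  have "Im (Ln z) = arctan (Im z / Re z)"
    using z assms by (subst Im_Ln_eq) auto
  then have "Im z * Im (Ln z) = ?y * arctan (?y / ?x)"
    by (cases "0 \<le> Im z") (auto simp: arctan_minus)
  also have "arctan (?y / ?x) = pi / 2 - arctan (?x / ?y)"
    using arctan_inverse[of "?y / ?x"] assms by (simp add: sgn_if)
  finally have arg: "Im z * Im (Ln z) = pi * ?y / 2 - ?y * arctan (?x / ?y)"
    by (simp add: algebra_simps)
  have "arctan (?x / ?y) \<le> ?x / ?y"
    using assms by (intro arctan_le_self) auto
  then have a1: "?y * arctan (?x / ?y) \<le> ?x"
    using assms by (simp add: field_simps)
  have a2: "0 \<le> ?y * arctan (?x / ?y)"
    using assms by simp
  have y_le: "?y \<le> norm z" by (rule abs_Im_le_cmod)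
  have "norm z \<le> ?x + ?y"
    using cmod_le[of z] assms by simp
  also have "\<dots> \<le> b * ?y + ?y"
    using assms mult_mono[of ?x b 1 ?y] by simp
  finally have le_y: "norm z \<le> (1 + b) * ?y" by (simp add: algebra_simps)
  have p: "?y powr (?x - 1 / 2) \<le> norm z powr (?x - 1 / 2)"
    using y_le assms by (intro powr_mono2) auto
  have q: "norm z powr (?x - 1 / 2) \<le> (1 + b) powr b * ?y powr (?x - 1 / 2)"
  proof -
    have "norm z powr (?x - 1 / 2) \<le> ((1 + b) * ?y) powr (?x - 1 / 2)"
      using le_y assms by (intro powr_mono2) auto
    also have "\<dots> = (1 + b) powr (?x - 1 / 2) * ?y powr (?x - 1 / 2)"
      using assms by (subst powr_mult) auto
    also have "\<dots> \<le> (1 + b) powr b * ?y powr (?x - 1 / 2)"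
      using assms by (intro mult_right_mono powr_mono) auto
    finally show ?thesis .
  qed
  have "Gamma z = stirling_quot z * exp ((z - 1 / 2) * Ln z - z)"
    by (simp add: stirling_quot_def flip: exp_add mult.assoc)
  then have "norm (Gamma z) = norm (stirling_quot z) * exp (Re ((z - 1 / 2) * Ln z - z))"
    by (simp add: norm_mult)
  also have "Re ((z - 1 / 2) * Ln z - z) =
      (?x - 1 / 2) * ln (norm z) + (- pi * ?y / 2) + (?y * arctan (?x / ?y) - ?x)"
    using z arg by simp
  also have "exp \<dots> = norm z powr (?x - 1 / 2) * exp (- pi * ?y / 2) * exp (?y * arctan (?x / ?y) - ?x)"
    unfolding exp_add powr_def using z by simp
  finally have G: "norm (Gamma z) = norm (stirling_quot z) *
     (norm z powr (?x - 1 / 2) * exp (- pi * ?y / 2) * exp (?y * arctan (?x / ?y) - ?x))" .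
  have "norm (Gamma z) \<le> exp 5 * ((1 + b) powr b * ?y powr (?x - 1 / 2) * exp (- pi * ?y / 2) * 1)"
    unfolding G using assms a1 by (intro mult_mono norm_stirling_quot_bounds q) auto
  then show "norm (Gamma z) \<le> exp 5 * (1 + b) powr b * G"
    by (simp add: G_def mult_ac)
  have lower: "exp (- 3) * (?y powr (?x - 1 / 2) * exp (- pi * ?y / 2) * exp (- b)) \<le> norm (Gamma z)"
    unfolding G
  proof (intro mult_mono norm_stirling_quot_bounds p)
    show "exp (- b) \<le> exp (?y * arctan (?x / ?y) - ?x)"
      unfolding exp_le_cancel_iff using a2 assms(2) by linarith
  qed (use assms in auto)
  then show "exp (- 3 - b) * G \<le> norm (Gamma z)"
  proof -
    have "exp (- 3 - b) = exp (- 3) * exp (- b)" by (simp flip: exp_add)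
    then show ?thesis using lower by (simp add: G_def mult_ac)
  qed
qed

text \<open>The functional equation moves the strip by \<open>N\<close> into Re >= 1. Each of the
  \<open>N\<close> factors of the Pochhammer symbol is comparable to |Im z|, so dividing by them
  lowers the exponent by exactly \<open>N\<close> and changes only the constant.\<close>

lemma norm_Gamma_bounds_strip:
  fixes a b :: real
  obtains C where "0 < C"
    and "\<And>z. a \<le> Re z \<Longrightarrow> Re z \<le> b \<Longrightarrow> 1 \<le> \<bar>Im z\<bar> \<Longrightarrow>
      norm (Gamma z) \<le> C * (\<bar>Im z\<bar> powr (Re z - 1 / 2) * exp (- pi * \<bar>Im z\<bar> / 2))"
    and "\<And>z. a \<le> Re z \<Longrightarrow> Re z \<le> b \<Longrightarrow> 1 \<le> \<bar>Im z\<bar> \<Longrightarrow>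
      norm (rGamma z) \<le> C * (\<bar>Im z\<bar> powr (- (Re z - 1 / 2)) * exp (pi * \<bar>Im z\<bar> / 2))"
proof -
  obtain N :: nat where N: "1 - a \<le> real N" using real_arch_simple by blast
  define b' where "b' = \<bar>b\<bar> + real N"
  define M where "M = 1 + (\<bar>a\<bar> + \<bar>b\<bar> + real N)"
  define C1 where "C1 = exp 5 * (1 + b') powr b'"
  define C2 where "C2 = exp (3 + b') * M ^ N"
  have C12: "0 < C1" "0 < C2" unfolding C1_def C2_def M_def b'_def by (auto intro!: mult_pos_pos zero_less_power)
  have M1: "1 \<le> M" unfolding M_def by auto
  have *: "norm (Gamma z) \<le> C1 * (\<bar>Im z\<bar> powr (Re z - 1 / 2) * exp (- pi * \<bar>Im z\<bar> / 2)) \<and>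
      norm (rGamma z) \<le> C2 * (\<bar>Im z\<bar> powr (- (Re z - 1 / 2)) * exp (pi * \<bar>Im z\<bar> / 2))"
    if z: "a \<le> Re z" "Re z \<le> b" "1 \<le> \<bar>Im z\<bar>" for z
  proof -
    let ?w = "z + of_nat N" and ?y = "\<bar>Im z\<bar>"
    let ?G = "?y powr (Re z - 1 / 2) * exp (- pi * ?y / 2)"
    let ?P = "pochhammer z N"
    have zn: "z \<notin> \<int>\<^sub>\<le>\<^sub>0" using z by (auto elim!: nonpos_Ints_cases)
    have w: "1 \<le> Re ?w" "Re ?w \<le> b'" "1 \<le> \<bar>Im ?w\<bar>"
      using z N by (auto simp: b'_def)
    have Gw: "Gamma ?w = ?P * Gamma z"
      using pochhammer_Gamma[OF zn, of N] zn by (simp add: Gamma_eq_zero_iff)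
    have P_eq: "norm ?P = (\<Prod>k<N. norm (z + of_nat k))"
      by (simp add: pochhammer_prod prod_norm[symmetric] atLeast0LessThan)
    have "(\<Prod>k<N. ?y) \<le> norm ?P"
      unfolding P_eq using abs_Im_le_cmod[of "z + of_nat k" for k] by (intro prod_mono) auto
    then have P_ge: "?y ^ N \<le> norm ?P" by simp
    have "norm (z + of_nat k) \<le> M * ?y" if "k < N" for k
    proof -
      have "norm (z + of_nat k) \<le> \<bar>Re z + real k\<bar> + ?y"
        using cmod_le[of "z + of_nat k"] by simp
      also have "\<dots> \<le> (\<bar>a\<bar> + \<bar>b\<bar> + real N) * 1 + ?y"
        using z that by auto
      also have "\<dots> \<le> (\<bar>a\<bar> + \<bar>b\<bar> + real N) * ?y + ?y"
        using z by (intro add_mono mult_left_mono) auto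
      finally show ?thesis by (simp add: M_def algebra_simps)
    qed
    then have "norm ?P \<le> (\<Prod>k<N. M * ?y)"
      unfolding P_eq by (intro prod_mono) auto
    then have P_le: "norm ?P \<le> M ^ N * ?y ^ N" by (simp add: power_mult_distrib)
    have y0: "0 < ?y" "0 < ?y ^ N" using z by auto
    have P0: "0 < norm ?P" using P_ge y0 by linarith
    have yN: "?y powr (Re ?w - 1 / 2) = ?y ^ N * ?y powr (Re z - 1 / 2)"
      using y0 by (simp add: powr_realpow[symmetric] flip: powr_add) (simp add: algebra_simps)
    note b = norm_Gamma_bounds_right[OF w]
    have Im_w: "Im ?w = Im z" by simp
    have "?y ^ N * norm (Gamma z) \<le> norm ?P * norm (Gamma z)"
      using P_ge by (intro mult_right_mono) auto
    also have "\<dots> \<le> C1 * (?y ^ N * ?G)"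
      using b(1) unfolding Gw norm_mult Im_w yN C1_def by (simp add: mult_ac)
    finally have 1: "norm (Gamma z) \<le> C1 * ?G"
      using y0 by (simp add: mult.left_commute[of C1] mult_le_cancel_left_pos)
    have "exp (- 3 - b') * (?y ^ N * ?G) \<le> norm ?P * norm (Gamma z)"
      using b(2) unfolding Gw norm_mult Im_w yN by (simp add: mult_ac)
    also have "\<dots> \<le> (M ^ N * ?y ^ N) * norm (Gamma z)"
      using P_le by (intro mult_right_mono) auto
    finally have "?y ^ N * (exp (- 3 - b') * ?G) \<le> ?y ^ N * (M ^ N * norm (Gamma z))"
      by (simp add: mult_ac)
    then have 2: "exp (- 3 - b') * ?G \<le> M ^ N * norm (Gamma z)"
      using y0 by (simp add: mult_le_cancel_left_pos)
    have G0: "0 < ?G" using y0 by simp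
    have nG: "0 < norm (Gamma z)" using zn by (simp add: Gamma_eq_zero_iff)
    have "norm (rGamma z) = 1 / norm (Gamma z)"
      by (simp add: rGamma_inverse_Gamma norm_inverse norm_divide inverse_eq_divide)
    also have "\<dots> \<le> M ^ N / (exp (- 3 - b') * ?G)"
      using 2 G0 nG by (simp add: field_simps)
    also have "\<dots> = C2 * (inverse (?y powr (Re z - 1 / 2)) * inverse (exp (- pi * ?y / 2)))"
    proof -
      have "inverse (exp (- 3 - b')) = exp (3 + b')" by (simp flip: exp_minus)
      then show ?thesis
        by (simp only: C2_def divide_inverse inverse_mult_distrib mult_ac)
    qed
    also have "\<dots> = C2 * (?y powr (- (Re z - 1 / 2)) * exp (pi * ?y / 2))"
      by (simp only: powr_minus flip: exp_minus) simp
    finally show ?thesis using 1 by blast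
  qed
  show thesis
  proof (rule that[of "C1 + C2"])
    fix z assume z: "a \<le> Re z" "Re z \<le> b" "1 \<le> \<bar>Im z\<bar>"
    show "norm (Gamma z) \<le> (C1 + C2) * (\<bar>Im z\<bar> powr (Re z - 1 / 2) * exp (- pi * \<bar>Im z\<bar> / 2))"
      using *[OF z] C12 by (intro order_trans[OF conjunct1[OF *[OF z]]] mult_right_mono) auto
    show "norm (rGamma z) \<le> (C1 + C2) * (\<bar>Im z\<bar> powr (- (Re z - 1 / 2)) * exp (pi * \<bar>Im z\<bar> / 2))"
      using *[OF z] C12 by (intro order_trans[OF conjunct2[OF *[OF z]]] mult_right_mono) auto
  qed (use C12 in simp)
qed

section \<open>Decay of Gamma quotients on vertical strips\<close>

text \<open>
  The growth of a product of Gamma factors \<open>\<Gamma>(b\<^sub>j + \<beta>\<^sub>j s)\<close> with total parameters \<open>b\<close> and \<open>\<beta>\<close>, where \<open>k\<close>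
  counts numerator factors minus denominator factors.
\<close>

definition strip_growth :: "real \<Rightarrow> real \<Rightarrow> (complex \<Rightarrow> complex) \<Rightarrow> real \<Rightarrow> real \<Rightarrow> real \<Rightarrow> bool" where
  "strip_growth x1 x2 f b \<beta> k \<longleftrightarrow> (\<exists>C>0. \<exists>Y\<ge>1. \<forall>s. x1 \<le> Re s \<longrightarrow> Re s \<le> x2 \<longrightarrow> Y \<le> \<bar>Im s\<bar> \<longrightarrow>
     norm (f s) \<le> C * (\<bar>Im s\<bar> powr (b + \<beta> * Re s - k / 2) * exp (- pi * \<beta> * \<bar>Im s\<bar> / 2)))"

lemma strip_growth_mult:
  assumes "strip_growth x1 x2 f b \<beta> k" "strip_growth x1 x2 g b' \<beta>' k'"
  shows "strip_growth x1 x2 (\<lambda>s. f s * g s) (b + b') (\<beta> + \<beta>') (k + k')"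
proof -
  let ?E = "\<lambda>b \<beta> k s. \<bar>Im s\<bar> powr (b + \<beta> * Re s - k / 2) * exp (- pi * \<beta> * \<bar>Im s\<bar> / 2)"
  obtain C Y where 1: "0 < C" "1 \<le> Y" "\<And>s. x1 \<le> Re s \<Longrightarrow> Re s \<le> x2 \<Longrightarrow> Y \<le> \<bar>Im s\<bar> \<Longrightarrow> norm (f s) \<le> C * ?E b \<beta> k s"
    using assms(1) unfolding strip_growth_def by blast
  obtain D Z where 2: "0 < D" "1 \<le> Z" "\<And>s. x1 \<le> Re s \<Longrightarrow> Re s \<le> x2 \<Longrightarrow> Z \<le> \<bar>Im s\<bar> \<Longrightarrow> norm (g s) \<le> D * ?E b' \<beta>' k' s"
    using assms(2) unfolding strip_growth_def by blast
  have "norm (f s * g s) \<le> C * D * ?E (b + b') (\<beta> + \<beta>') (k + k') s"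
    if s: "x1 \<le> Re s" "Re s \<le> x2" "max Y Z \<le> \<bar>Im s\<bar>" for s
  proof -
    have "norm (f s * g s) \<le> (C * ?E b \<beta> k s) * (D * ?E b' \<beta>' k' s)"
      unfolding norm_mult using s 1 by (intro mult_mono 1(3) 2(3)) auto
    also have "\<dots> = C * D * (\<bar>Im s\<bar> powr ((b + \<beta> * Re s - k / 2) + (b' + \<beta>' * Re s - k' / 2)) *
        exp ((- pi * \<beta> * \<bar>Im s\<bar> / 2) + (- pi * \<beta>' * \<bar>Im s\<bar> / 2)))"
      unfolding powr_add exp_add by (simp only: mult_ac)
    also have "(b + \<beta> * Re s - k / 2) + (b' + \<beta>' * Re s - k' / 2) = b + b' + (\<beta> + \<beta>') * Re s - (k + k') / 2"
      by (simp add: algebra_simps add_divide_distrib)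
    also have "(- pi * \<beta> * \<bar>Im s\<bar> / 2) + (- pi * \<beta>' * \<bar>Im s\<bar> / 2) = - pi * (\<beta> + \<beta>') * \<bar>Im s\<bar> / 2"
      by (simp add: algebra_simps add_divide_distrib)
    finally show ?thesis .
  qed
  then show ?thesis
    unfolding strip_growth_def using 1(1,2) 2(1,2)
    by (intro exI[of _ "C * D"] conjI exI[of _ "max Y Z"]) auto
qed

text \<open>The sign \<open>e\<close> is 1 for Gamma factors and -1 for reciprocal ones, so that one
  induction serves numerator and denominator.\<close>

lemma strip_growth_prod_list:
  assumes "\<And>b \<beta>. (b, \<beta>) \<in> set B \<Longrightarrow> strip_growth x1 x2 (g b \<beta>) (e * b) (e * \<beta>) e"
  shows "strip_growth x1 x2 (\<lambda>s. \<Prod>(b, \<beta>)\<leftarrow>B. g b \<beta> s)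
    (e * (\<Sum>(b, \<beta>)\<leftarrow>B. b)) (e * (\<Sum>(b, \<beta>)\<leftarrow>B. \<beta>)) (e * real (length B))"
  using assms
proof (induction B)
  case Nil
  show ?case unfolding strip_growth_def by (intro exI[of _ 1]) auto
next
  case (Cons p B)
  obtain b \<beta> where p: "p = (b, \<beta>)" by force
  have "strip_growth x1 x2 (g b \<beta>) (e * b) (e * \<beta>) e" by (rule Cons.prems) (simp add: p)
  from strip_growth_mult[OF this Cons.IH] Cons.prems show ?case
    by (simp add: p ring_distribs add.commute)
qed

lemma strip_growth_Gamma:
  assumes "0 < \<beta>"
  shows "strip_growth x1 x2 (\<lambda>s. Gamma (of_real b + of_real \<beta> * s)) b \<beta> 1"
    and "strip_growth x1 x2 (\<lambda>s. rGamma (of_real b + of_real \<beta> * s)) (- b) (- \<beta>) (- 1)"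
proof -
  obtain C where C: "0 < C"
    and G: "\<And>z. b + \<beta> * x1 \<le> Re z \<Longrightarrow> Re z \<le> b + \<beta> * x2 \<Longrightarrow> 1 \<le> \<bar>Im z\<bar> \<Longrightarrow>
      norm (Gamma z) \<le> C * (\<bar>Im z\<bar> powr (Re z - 1 / 2) * exp (- pi * \<bar>Im z\<bar> / 2))"
    and rG: "\<And>z. b + \<beta> * x1 \<le> Re z \<Longrightarrow> Re z \<le> b + \<beta> * x2 \<Longrightarrow> 1 \<le> \<bar>Im z\<bar> \<Longrightarrow>
      norm (rGamma z) \<le> C * (\<bar>Im z\<bar> powr (- (Re z - 1 / 2)) * exp (pi * \<bar>Im z\<bar> / 2))"
    using norm_Gamma_bounds_strip[of "b + \<beta> * x1" "b + \<beta> * x2"] by metis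
  \<comment> \<open>\<open>E\<close> bounds the exponent of \<beta> |Im s| throughout the strip. The
    power of \<beta> alone is then at most \<open>M\<close>, which leaves a pure power of |Im
    s|.\<close>
  define E where "E = \<bar>b\<bar> + \<beta> * (\<bar>x1\<bar> + \<bar>x2\<bar>) + 1 / 2"
  define M where "M = exp (\<bar>ln \<beta>\<bar> * E)"
  have M: "\<beta> powr e \<le> M" if "\<bar>e\<bar> \<le> E" for e
  proof -
    have "e * ln \<beta> \<le> \<bar>ln \<beta>\<bar> * \<bar>e\<bar>" by (metis abs_ge_self abs_mult mult.commute)
    also have "\<dots> \<le> \<bar>ln \<beta>\<bar> * E" using that by (intro mult_left_mono) auto
    finally show ?thesis using assms by (simp add: powr_def M_def)
  qed
  have main: "norm (Gamma (of_real b + of_real \<beta> * s)) \<le>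
        C * M * (\<bar>Im s\<bar> powr (b + \<beta> * Re s - 1 / 2) * exp (- pi * \<beta> * \<bar>Im s\<bar> / 2)) \<and>
      norm (rGamma (of_real b + of_real \<beta> * s)) \<le>
        C * M * (\<bar>Im s\<bar> powr (- (b + \<beta> * Re s - 1 / 2)) * exp (pi * \<beta> * \<bar>Im s\<bar> / 2))"
    if s: "x1 \<le> Re s" "Re s \<le> x2" "1 / \<beta> \<le> \<bar>Im s\<bar>" for s
  proof -
    let ?z = "of_real b + of_real \<beta> * s" and ?e = "b + \<beta> * Re s - 1 / 2"
    have y: "1 \<le> \<beta> * \<bar>Im s\<bar>" using s assms by (simp add: field_simps)
    have Im_z: "\<bar>Im ?z\<bar> = \<beta> * \<bar>Im s\<bar>" using assms by (simp add: abs_mult)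
    have Re_z: "Re ?z - 1 / 2 = ?e" by simp
    have z: "b + \<beta> * x1 \<le> Re ?z" "Re ?z \<le> b + \<beta> * x2" "1 \<le> \<bar>Im ?z\<bar>"
      unfolding Im_z using s y assms by auto
    have "\<bar>\<beta> * Re s\<bar> \<le> \<beta> * (\<bar>x1\<bar> + \<bar>x2\<bar>)"
      using s assms by (auto simp: abs_mult intro!: mult_left_mono)
    then have e: "\<bar>?e\<bar> \<le> E" "\<bar>- ?e\<bar> \<le> E" unfolding E_def by linarith+
    have powr_le: "(\<beta> * \<bar>Im s\<bar>) powr e \<le> M * \<bar>Im s\<bar> powr e" if "\<bar>e\<bar> \<le> E" for e
      using assms M[OF that] by (simp add: powr_mult mult_right_mono)
    have "norm (Gamma ?z) \<le> C * ((\<beta> * \<bar>Im s\<bar>) powr ?e * exp (- pi * (\<beta> * \<bar>Im s\<bar>) / 2))"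
      using G[OF z] unfolding Im_z Re_z .
    also have "\<dots> \<le> C * ((M * \<bar>Im s\<bar> powr ?e) * exp (- pi * (\<beta> * \<bar>Im s\<bar>) / 2))"
      using C by (intro mult_left_mono mult_right_mono powr_le e) auto
    finally have 1: "norm (Gamma ?z) \<le> C * M * (\<bar>Im s\<bar> powr ?e * exp (- pi * \<beta> * \<bar>Im s\<bar> / 2))"
      by (simp add: mult_ac)
    have "norm (rGamma ?z) \<le> C * ((\<beta> * \<bar>Im s\<bar>) powr (- ?e) * exp (pi * (\<beta> * \<bar>Im s\<bar>) / 2))"
      using rG[OF z] unfolding Im_z Re_z .
    also have "\<dots> \<le> C * ((M * \<bar>Im s\<bar> powr (- ?e)) * exp (pi * (\<beta> * \<bar>Im s\<bar>) / 2))"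
      using C by (intro mult_left_mono mult_right_mono powr_le e) auto
    finally show ?thesis using 1 by (simp add: mult_ac)
  qed
  have Y: "1 / \<beta> \<le> max 1 (1 / \<beta>)" "1 \<le> max 1 (1 / \<beta>)" "0 < C * M" using C by (auto simp: M_def)
  have e: "- b + - \<beta> * Re s - - 1 / 2 = - (b + \<beta> * Re s - 1 / 2)" "- pi * - \<beta> * \<bar>Im s\<bar> / 2 = pi * \<beta> * \<bar>Im s\<bar> / 2" for s
    by simp_all
  show "strip_growth x1 x2 (\<lambda>s. Gamma (of_real b + of_real \<beta> * s)) b \<beta> 1"
    unfolding strip_growth_def using main Y by (meson order_trans)
  show "strip_growth x1 x2 (\<lambda>s. rGamma (of_real b + of_real \<beta> * s)) (- b) (- \<beta>) (- 1)"
    unfolding strip_growth_def e using main Y by (meson order_trans)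
qed

text \<open>Reciprocal Gamma functions are entire, so in this form only the poles of the factors
  from \<open>B\<close> restrict holomorphy.\<close>

lemma gamma_quot_eq_rGamma:
  "gamma_quot A B s =
     (\<Prod>(b, \<beta>)\<leftarrow>B. Gamma (of_real b + of_real \<beta> * s)) * (\<Prod>(a, \<alpha>)\<leftarrow>A. rGamma (of_real a + of_real \<alpha> * s))"
proof -
  have "inverse (\<Prod>(a, \<alpha>)\<leftarrow>A. Gamma (of_real a + of_real \<alpha> * s)) =
      (\<Prod>(a, \<alpha>)\<leftarrow>A. rGamma (of_real a + of_real \<alpha> * s))"
    by (induction A) (auto simp: rGamma_inverse_Gamma)
  then show ?thesis by (simp add: gamma_quot_def divide_inverse)
qed

lemma holomorphic_on_gamma_quot:
  assumes "\<forall>(b, \<beta>)\<in>set B. 0 < \<beta> \<and> - b / \<beta> < x"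
  shows "gamma_quot A B holomorphic_on {s. x \<le> Re s}"
proof -
  have "(\<lambda>s. \<Prod>(b, \<beta>)\<leftarrow>B. Gamma (of_real b + of_real \<beta> * s)) holomorphic_on {s. x \<le> Re s}"
    using assms
  proof (induction B)
    case (Cons p B)
    obtain b \<beta> where p: "p = (b, \<beta>)" by force
    have "of_real b + of_real \<beta> * s \<notin> \<int>\<^sub>\<le>\<^sub>0" if "x \<le> Re s" for s
    proof -
      have "- b / \<beta> < Re s" "0 < \<beta>" using Cons.prems that by (auto simp: p)
      then have "0 < Re (of_real b + of_real \<beta> * s)" by (simp add: field_simps)
      then show ?thesis by (auto elim!: nonpos_Ints_cases simp: complex_eq_iff)
    qed
    then show ?case using Cons by (auto simp: p intro!: holomorphic_intros)
  qed auto
  moreover have "(\<lambda>s. \<Prod>(a, \<alpha>)\<leftarrow>A. rGamma (of_real a + of_real \<alpha> * s)) holomorphic_on {s. x \<le> Re s}"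
    by (induction A) (auto intro!: holomorphic_intros)
  ultimately have "(\<lambda>s. gamma_quot A B s) holomorphic_on {s. x \<le> Re s}"
    unfolding gamma_quot_eq_rGamma by (rule holomorphic_on_mult)
  then show ?thesis by simp
qed

lemma gamma_quot_of_real: "gamma_quot A B (of_real x) = complex_of_real (gamma_quot A B x)"
proof -
  have "(\<Prod>(b, \<beta>)\<leftarrow>L. Gamma (of_real b + of_real \<beta> * of_real x)) =
      complex_of_real (\<Prod>(b, \<beta>)\<leftarrow>L. Gamma (b + \<beta> * x))" for L
    by (induction L) (auto simp: Gamma_complex_of_real simp flip: of_real_mult of_real_add)
  then show ?thesis by (simp add: gamma_quot_def)
qed

text \<open>
  The exponent of \<open>\<bar>Im s\<bar>\<close> is \<open>\<mu> + a\<^sup>* Re s\<close>; it does not depend on the strip if \<open>a\<^sup>* = 0\<close>, and the factor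
  \<open>exp (- \<pi> a\<^sup>* \<bar>Im s\<bar> / 2)\<close> absorbs it if \<open>a\<^sup>* > 0\<close>.
\<close>

lemma gamma_quot_decay:
  assumes A: "\<forall>(a, \<alpha>)\<in>set A. 0 < \<alpha>"
    and B: "\<forall>(b, \<beta>)\<in>set B. 0 < \<beta> \<and> - b / \<beta> < x1"
    and star: "a_star A B > 0 \<or> a_star A B = 0 \<and> mu_exponent A B < -1"
  obtains C \<delta> where "0 < \<delta>" "0 < C"
    "\<And>s. x1 \<le> Re s \<Longrightarrow> Re s \<le> x2 \<Longrightarrow> norm (gamma_quot A B s) \<le> C * (1 + \<bar>Im s\<bar>) powr (-1 - \<delta>)"
proof -
  let ?m = "mu_exponent A B" and ?a = "a_star A B"
  have "strip_growth x1 x2 (\<lambda>s. \<Prod>(b, \<beta>)\<leftarrow>B. Gamma (of_real b + of_real \<beta> * s))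
      (1 * (\<Sum>(b, \<beta>)\<leftarrow>B. b)) (1 * (\<Sum>(b, \<beta>)\<leftarrow>B. \<beta>)) (1 * real (length B))"
    by (rule strip_growth_prod_list) (use B strip_growth_Gamma(1) in auto)
  moreover have "strip_growth x1 x2 (\<lambda>s. \<Prod>(b, \<beta>)\<leftarrow>A. rGamma (of_real b + of_real \<beta> * s))
      (-1 * (\<Sum>(b, \<beta>)\<leftarrow>A. b)) (-1 * (\<Sum>(b, \<beta>)\<leftarrow>A. \<beta>)) (-1 * real (length A))"
    by (rule strip_growth_prod_list) (use A strip_growth_Gamma(2) in auto)
  ultimately have growth: "strip_growth x1 x2 (gamma_quot A B)
      (1 * (\<Sum>(b, \<beta>)\<leftarrow>B. b) + -1 * (\<Sum>(b, \<beta>)\<leftarrow>A. b)) (1 * (\<Sum>(b, \<beta>)\<leftarrow>B. \<beta>) + -1 * (\<Sum>(b, \<beta>)\<leftarrow>A. \<beta>))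
      (1 * real (length B) + -1 * real (length A))"
    unfolding gamma_quot_eq_rGamma[abs_def] by (rule strip_growth_mult)
  have a: "1 * (\<Sum>(b, \<beta>)\<leftarrow>B. \<beta>) + -1 * (\<Sum>(b, \<beta>)\<leftarrow>A. \<beta>) = ?a" by (simp add: a_star_def)
  have m: "1 * (\<Sum>(b, \<beta>)\<leftarrow>B. b) + -1 * (\<Sum>(b, \<beta>)\<leftarrow>A. b) + ?a * x - (1 * real (length B) + -1 * real (length A)) / 2 = ?m + ?a * x" for x
    by (simp add: mu_exponent_def diff_divide_distrib)
  obtain C0 Y0 where C0: "0 < C0" "1 \<le> Y0"
    and le: "\<And>s. x1 \<le> Re s \<Longrightarrow> Re s \<le> x2 \<Longrightarrow> Y0 \<le> \<bar>Im s\<bar> \<Longrightarrow>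
      norm (gamma_quot A B s) \<le> C0 * (\<bar>Im s\<bar> powr (?m + ?a * Re s) * exp (- pi * ?a * \<bar>Im s\<bar> / 2))"
    using growth unfolding strip_growth_def a m by blast
  have "\<exists>\<delta> C Y. 0 < \<delta> \<and> 0 < C \<and> (\<forall>s. x1 \<le> Re s \<longrightarrow> Re s \<le> x2 \<longrightarrow> Y \<le> \<bar>Im s\<bar> \<longrightarrow>
      norm (gamma_quot A B s) \<le> C * (1 + \<bar>Im s\<bar>) powr (-1 - \<delta>))"
    using star
  proof
    assume a: "?a = 0 \<and> ?m < -1"
    show ?thesis
    proof (intro exI conjI allI impI)
      show "0 < -1 - ?m" using a by simp
      \<comment> \<open>The factor comes from |Im s| >= (1 + |Im s|) / 2 for |Im s| >= 1, raised to
        the negative exponent \<open>?m\<close>.\<close>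
      show "0 < C0 * (1 / 2) powr ?m" using C0 by simp
      fix s assume s: "x1 \<le> Re s" "Re s \<le> x2" "Y0 \<le> \<bar>Im s\<bar>"
      have "\<bar>Im s\<bar> powr ?m \<le> (1 / 2 * (1 + \<bar>Im s\<bar>)) powr ?m"
        using s C0 a by (intro powr_mono2') auto
      also have "\<dots> = (1 / 2) powr ?m * (1 + \<bar>Im s\<bar>) powr ?m"
        by (rule powr_mult)
      finally have "C0 * \<bar>Im s\<bar> powr ?m \<le> C0 * ((1 / 2) powr ?m * (1 + \<bar>Im s\<bar>) powr ?m)"
        using C0 by (intro mult_left_mono) auto
      then show "norm (gamma_quot A B s) \<le> C0 * (1 / 2) powr ?m * (1 + \<bar>Im s\<bar>) powr (-1 - (-1 - ?m))"
        using le[OF s] a by simp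
    qed
  next
    assume a: "0 < ?a"
    define E where "E = ?m + ?a * (\<bar>x1\<bar> + \<bar>x2\<bar>)"
    define c where "c = pi * ?a / 2"
    have "0 < c" using a by (simp add: c_def)
    then have "((\<lambda>y. y powr E * exp (- c * y) * (1 + y) powr 2) \<longlongrightarrow> 0) at_top"
      by real_asymp
    then have "eventually (\<lambda>y. y powr E * exp (- c * y) * (1 + y) powr 2 < 1) at_top"
      by (rule order_tendstoD) simp
    then obtain Y where Y: "\<And>y. Y \<le> y \<Longrightarrow> y powr E * exp (- c * y) * (1 + y) powr 2 < 1"
      unfolding eventually_at_top_linorder by blast
    show ?thesis
    proof (intro exI conjI allI impI)
      show "0 < (1::real)" by simp
      show "0 < C0" using C0 by simp
      fix s assume s: "x1 \<le> Re s" "Re s \<le> x2" "max Y (Y0) \<le> \<bar>Im s\<bar>"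
      let ?y = "\<bar>Im s\<bar>"
      have y: "1 \<le> ?y" using s C0 by auto
      have "?y powr (?m + ?a * Re s) \<le> ?y powr E"
        using y s a by (auto simp: E_def intro!: powr_mono mult_left_mono)
      then have "?y powr (?m + ?a * Re s) * exp (- pi * ?a * ?y / 2) \<le> ?y powr E * exp (- c * ?y)"
        by (intro mult_mono) (auto simp: c_def)
      also have "\<dots> \<le> (1 + ?y) powr (-1 - 1)"
        using Y[of ?y] s by (simp add: powr_minus field_simps)
      finally have "C0 * (?y powr (?m + ?a * Re s) * exp (- pi * ?a * ?y / 2)) \<le>
          C0 * (1 + ?y) powr (-1 - 1)"
        using C0 by (intro mult_left_mono) auto
      then show "norm (gamma_quot A B s) \<le> C0 * (1 + ?y) powr (-1 - 1)"
        using le[of s] s by simp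
    qed
  qed
  then obtain \<delta> C Y where C: "0 < \<delta>" "0 < C"
    and far: "\<And>s. x1 \<le> Re s \<Longrightarrow> Re s \<le> x2 \<Longrightarrow> Y \<le> \<bar>Im s\<bar> \<Longrightarrow>
      norm (gamma_quot A B s) \<le> C * (1 + \<bar>Im s\<bar>) powr (-1 - \<delta>)"
    by blast
  \<comment> \<open>Below the height \<open>Y\<close> compactness gives a bound \<open>M\<close>;
    multiplying it by (1 + |Y|)^(1 + \<delta>) compensates the weight, which is smallest at the top
    of the rectangle.\<close>
  define R where "R = cbox (Complex x1 (- \<bar>Y\<bar>)) (Complex x2 \<bar>Y\<bar>)"
  have "continuous_on R (gamma_quot A B)"
    by (intro holomorphic_on_imp_continuous_on holomorphic_on_subset[OF holomorphic_on_gamma_quot[of B x1]] B)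
       (auto simp: R_def in_cbox_complex_iff)
  then have "bounded (gamma_quot A B ` R)"
    by (intro compact_imp_bounded compact_continuous_image) (auto simp: R_def)
  then obtain M where M: "0 < M" "\<And>s. s \<in> R \<Longrightarrow> norm (gamma_quot A B s) \<le> M"
    unfolding bounded_pos by auto
  define D where "D = C + M * (1 + \<bar>Y\<bar>) powr (1 + \<delta>)"
  show thesis
  proof (rule that[of \<delta> D])
    have "0 \<le> M * (1 + \<bar>Y\<bar>) powr (1 + \<delta>)" using M by simp
    then show "0 < D" unfolding D_def using C by linarith
    fix s assume s: "x1 \<le> Re s" "Re s \<le> x2"
    show "norm (gamma_quot A B s) \<le> D * (1 + \<bar>Im s\<bar>) powr (-1 - \<delta>)"
    proof (cases "Y \<le> \<bar>Im s\<bar>")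
      case True
      have "C * (1 + \<bar>Im s\<bar>) powr (-1 - \<delta>) \<le> D * (1 + \<bar>Im s\<bar>) powr (-1 - \<delta>)"
        unfolding D_def using M by (intro mult_right_mono) auto
      then show ?thesis using far[OF s True] by simp
    next
      case False
      then have "s \<in> R" using s by (auto simp: R_def in_cbox_complex_iff)
      have "(1 + \<bar>Y\<bar>) powr (-1 - \<delta>) \<le> (1 + \<bar>Im s\<bar>) powr (-1 - \<delta>)"
        using False C by (intro powr_mono2') auto
      then have "M * (1 + \<bar>Y\<bar>) powr (1 + \<delta>) * (1 + \<bar>Y\<bar>) powr (-1 - \<delta>) \<le> D * (1 + \<bar>Im s\<bar>) powr (-1 - \<delta>)"
        unfolding D_def using C M by (intro mult_mono) auto
      moreover have "M * (1 + \<bar>Y\<bar>) powr (1 + \<delta>) * (1 + \<bar>Y\<bar>) powr (-1 - \<delta>) = M"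
        by (simp flip: powr_add)
      ultimately show ?thesis using M(2)[OF \<open>s \<in> R\<close>] by linarith
    qed
  qed (use C in auto)
qed

section \<open>Shifting vertical contours\<close>

lemma integrable_one_plus_abs_powr:
  assumes "0 < \<delta>"
  shows "integrable lborel (\<lambda>y::real. (1 + \<bar>y\<bar>) powr (-1 - \<delta>))"
proof -
  have half: "set_integrable lborel (einterval 0 \<infinity>) (\<lambda>y. (1 + y) powr (-1 - \<delta>))"
  proof (rule interval_integral_FTC_nonneg)
    fix y :: real assume y: "0 < ereal y"
    have "((\<lambda>y. (1 + y) powr (- \<delta>)) has_real_derivative (- \<delta> * (1 + y) powr (- \<delta> - of_nat 1) * 1)) (at y)"
      using y by (intro DERIV_fun_powr) (auto intro!: derivative_eq_intros)
    then show "((\<lambda>y. (1 + y) powr (- \<delta>) / (- \<delta>)) has_real_derivative (1 + y) powr (-1 - \<delta>)) (at y)"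
    proof (rule DERIV_cong[OF DERIV_cdivide])
      show "(- \<delta> * (1 + y) powr (- \<delta> - of_nat 1) * 1) / (- \<delta>) = (1 + y) powr (-1 - \<delta>)"
        using assms by (simp add: minus_diff_commute)
    qed
    show "isCont (\<lambda>y. (1 + y) powr (-1 - \<delta>)) y"
      using y by (auto intro!: continuous_intros)
  next
    have "((\<lambda>y. (1 + y) powr (- \<delta>) / (- \<delta>)) \<longlongrightarrow> - inverse \<delta>) (at_right 0)"
      using assms by real_asymp
    then show "(((\<lambda>y. (1 + y) powr (- \<delta>) / (- \<delta>)) \<circ> real_of_ereal) \<longlongrightarrow> - inverse \<delta>) (at_right 0)"
      by (simp add: ereal_tendsto_simps1 zero_ereal_def)
    have "((\<lambda>y. (1 + y) powr (- \<delta>) / (- \<delta>)) \<longlongrightarrow> 0) at_top"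
      using assms by real_asymp
    then show "(((\<lambda>y. (1 + y) powr (- \<delta>) / (- \<delta>)) \<circ> real_of_ereal) \<longlongrightarrow> 0) (at_left \<infinity>)"
      by (simp add: ereal_tendsto_simps1)
  qed auto
  have "(einterval 0 \<infinity> :: real set) = {0<..}" by (auto simp: einterval_def)
  with half have *: "integrable lborel (\<lambda>y. indicator {0<..} y * (1 + y) powr (-1 - \<delta>))"
    by (simp add: set_integrable_def)
  have "integrable lborel (\<lambda>y. indicator {0<..} (0 + (-1) * y) * (1 + (0 + (-1) * y)) powr (-1 - \<delta>))"
    by (rule lborel_integrable_real_affine[OF *]) simp
  then have "integrable lborel (\<lambda>y. indicator {0<..} y * (1 + y) powr (-1 - \<delta>) +
      indicator {0<..} (- y) * (1 - y) powr (-1 - \<delta>))"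
    using * by simp
  moreover have "AE y in lborel. indicator {0<..} y * (1 + y) powr (-1 - \<delta>) +
      indicator {0<..} (- y) * (1 - y) powr (-1 - \<delta>) = (1 + \<bar>y\<bar>) powr (-1 - \<delta>)"
    using AE_lborel_singleton[of 0] by eventually_elim (auto simp: indicator_def)
  ultimately show ?thesis
    by (subst (asm) integrable_cong_AE) auto
qed

text \<open>The decay is required only for |Im s| >= 1 and continuity covers the rest, so that the
  lemma applies to h s / (s - z), which has no useful bound near the real axis.\<close>

lemma integrable_vline:
  fixes f :: "complex \<Rightarrow> complex"
  assumes cont: "continuous_on {s. Re s = x} f"
    and \<delta>: "0 < \<delta>"
    and bound: "\<And>s. Re s = x \<Longrightarrow> 1 \<le> \<bar>Im s\<bar> \<Longrightarrow> norm (f s) \<le> C * (1 + \<bar>Im s\<bar>) powr (-1 - \<delta>)"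
  shows "integrable lborel (\<lambda>y. f (Complex x y))"
proof -
  have c: "continuous_on UNIV (\<lambda>y. f (Complex x y))"
    by (rule continuous_on_compose2[OF cont]) (auto intro!: continuous_intros simp: Complex_eq)
  have "bounded ((\<lambda>y. f (Complex x y)) ` {-1..1})"
    by (intro compact_imp_bounded compact_continuous_image continuous_on_subset[OF c]) auto
  then obtain M where M: "0 < M" "\<And>y. y \<in> {-1..1} \<Longrightarrow> norm (f (Complex x y)) \<le> M"
    unfolding bounded_pos by auto
  show ?thesis
  proof (rule Bochner_Integration.integrable_bound)
    let ?w = "\<lambda>y. M * indicator {-1..1} y + \<bar>C\<bar> * (1 + \<bar>y\<bar>) powr (-1 - \<delta>)"
    show "integrable lborel ?w"
      using integrable_one_plus_abs_powr[OF \<delta>] by (auto intro!: integrable_real_indicator)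
    show "(\<lambda>y. f (Complex x y)) \<in> borel_measurable lborel"
      using c by (simp add: borel_measurable_continuous_onI)
    show "AE y in lborel. norm (f (Complex x y)) \<le> norm (?w y)"
    proof (rule AE_I2)
      fix y :: real
      have nonneg: "0 \<le> \<bar>C\<bar> * (1 + \<bar>y\<bar>) powr (-1 - \<delta>)" "0 \<le> M * indicator {-1..1} y" using M by auto
      have "norm (f (Complex x y)) \<le> ?w y"
      proof (cases "\<bar>y\<bar> < 1")
        case True
        then have "norm (f (Complex x y)) \<le> M" "y \<in> {-1..1}" by (auto intro!: M)
        then show ?thesis using nonneg by (simp add: add_increasing2)
      next
        case False
        then have "norm (f (Complex x y)) \<le> C * (1 + \<bar>y\<bar>) powr (-1 - \<delta>)" using bound[of "Complex x y"] by simp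
        also have "\<dots> \<le> \<bar>C\<bar> * (1 + \<bar>y\<bar>) powr (-1 - \<delta>)" by (intro mult_right_mono) auto
        finally show ?thesis using nonneg by linarith
      qed
      then show "norm (f (Complex x y)) \<le> norm (?w y)" by simp
    qed
  qed
qed

text \<open>Links the Lebesgue integral over the whole line with the integrals over compact
  intervals of which contour integrals consist.\<close>

lemma integral_symmetric_tendsto:
  fixes g :: "real \<Rightarrow> 'a::euclidean_space"
  assumes "integrable lborel g"
  shows "(\<lambda>n. integral {- real n..real n} g) \<longlonglongrightarrow> integral\<^sup>L lborel g"
proof -
  have [measurable]: "g \<in> borel_measurable borel" using assms by simp
  have "(\<lambda>n. LINT y|lborel. indicator {- real n..real n} y *\<^sub>R g y) \<longlonglongrightarrow> integral\<^sup>L lborel g"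
  proof (rule integral_dominated_convergence[where w = "\<lambda>y. norm (g y)"])
    show "AE y in lborel. (\<lambda>n. indicator {- real n..real n} y *\<^sub>R g y) \<longlonglongrightarrow> g y"
    proof (rule AE_I2, rule tendsto_eventually)
      fix y :: real
      obtain N :: nat where "\<bar>y\<bar> \<le> real N" using real_arch_simple by blast
      then show "\<forall>\<^sub>F n in sequentially. indicator {- real n..real n} y *\<^sub>R g y = g y"
        by (intro eventually_sequentiallyI[of N]) (auto simp: indicator_def)
    qed
  qed (use assms in \<open>auto simp: indicator_def\<close>)
  moreover have "(LINT y|lborel. indicator {- real n..real n} y *\<^sub>R g y) = integral {- real n..real n} g" for n
  proof -
    have "set_integrable lborel {- real n..real n} g"
      unfolding set_integrable_def using assms by (intro integrable_mult_indicator) auto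
    from set_borel_integral_eq_integral(2)[OF this] show ?thesis
      by (simp add: set_lebesgue_integral_def)
  qed
  ultimately show ?thesis by simp
qed

lemma contour_integral_vertical_linepath:
  assumes "continuous_on {s. Re s = x} f" "a < b"
  shows "contour_integral (linepath (Complex x a) (Complex x b)) f = \<i> * integral {a..b} (\<lambda>y. f (Complex x y))"
proof -
  let ?l = "linepath (Complex x a) (Complex x b)"
  have "closed_segment (Complex x a) (Complex x b) \<subseteq> {s. Re s = x}"
    by (auto simp: closed_segment_same_Re)
  then have "f contour_integrable_on ?l"
    by (intro contour_integrable_continuous_linepath continuous_on_subset[OF assms(1)])
  then have "(f has_contour_integral contour_integral ?l f) ?l"
    by (rule has_contour_integral_integral)
  then have "((\<lambda>y. f (Complex x y)) has_integral (- \<i> * contour_integral ?l f)) {a..b}"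
    using has_contour_integral_linepath_same_Re_iff[of "Complex x a" x "Complex x b" a b f] assms by simp
  then show ?thesis by (simp add: integral_unique)
qed

lemma vline_integral_eq: "vline_integral \<gamma> f = \<i> * (LINT y|lborel. f (Complex \<gamma> y))"
  by (simp add: vline_integral_def mult.commute)

text \<open>Cauchy's integral formula on rectangles whose height tends to infinity.\<close>

lemma Cauchy_integral_formula_vertical_strip:
  fixes h :: "complex \<Rightarrow> complex" and z :: real
  assumes hol: "h holomorphic_on {s. x \<le> Re s}"
    and x: "x < \<gamma>1" "\<gamma>1 < z" "z < \<gamma>2"
    and \<delta>: "0 < \<delta>"
    and bound: "\<And>s::complex. \<gamma>1 \<le> Re s \<Longrightarrow> Re s \<le> \<gamma>2 \<Longrightarrow> 1 \<le> \<bar>Im s\<bar> \<Longrightarrow>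
      norm (h s / (s - z)) \<le> C * (1 + \<bar>Im s\<bar>) powr (-1 - \<delta>)"
  shows "vline_integral \<gamma>2 (\<lambda>s. h s / (s - z)) - vline_integral \<gamma>1 (\<lambda>s. h s / (s - z)) = 2 * pi * \<i> * h z"
proof -
  let ?f = "\<lambda>s. h s / (s - z)"
  define J where "J = (\<lambda>\<gamma> T. \<i> * integral {- T..T} (\<lambda>y. ?f (Complex \<gamma> y)))"
  have cont: "continuous_on S ?f" if "S \<subseteq> {s. x \<le> Re s}" "complex_of_real z \<notin> S" for S
    using that by (intro continuous_intros continuous_on_subset[OF holomorphic_on_imp_continuous_on[OF hol]]) auto
  have cont1: "continuous_on {s. Re s = \<gamma>1} ?f" and cont2: "continuous_on {s. Re s = \<gamma>2} ?f"
    using x by (auto intro!: cont)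
  have int1: "integrable lborel (\<lambda>y. ?f (Complex \<gamma>1 y))"
    by (rule integrable_vline[OF cont1 \<delta>, where C = C], rule bound) (use x in auto)
  have int2: "integrable lborel (\<lambda>y. ?f (Complex \<gamma>2 y))"
    by (rule integrable_vline[OF cont2 \<delta>, where C = C], rule bound) (use x in auto)
  have lim: "(\<lambda>n. J \<gamma>2 (real (Suc n)) - J \<gamma>1 (real (Suc n)))
      \<longlonglongrightarrow> \<i> * (LINT y|lborel. ?f (Complex \<gamma>2 y)) - \<i> * (LINT y|lborel. ?f (Complex \<gamma>1 y))"
    unfolding J_def by (intro tendsto_intros LIMSEQ_Suc[OF integral_symmetric_tendsto] int1 int2)
  \<comment> \<open>The deviation from the residue term is the contribution of the two horizontal
    sides, each of length \<gamma>2 - \<gamma>1 and at height T.\<close>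
  have diff: "norm (J \<gamma>2 T - J \<gamma>1 T - 2 * pi * \<i> * h z)
      \<le> 2 * (C * (1 + T) powr (-1 - \<delta>) * (\<gamma>2 - \<gamma>1))" if T: "1 \<le> T" for T :: real
  proof -
    define a1 where "a1 = Complex \<gamma>1 (- T)"
    define a2 where "a2 = Complex \<gamma>2 (- T)"
    define a3 where "a3 = Complex \<gamma>2 T"
    define a4 where "a4 = Complex \<gamma>1 T"
    have rect: "rectpath a1 a3 = linepath a1 a2 +++ linepath a2 a3 +++ linepath a3 a4 +++ linepath a4 a1"
      by (simp add: rectpath_def a1_def a2_def a3_def a4_def Let_def)
    have zbox: "complex_of_real z \<in> box a1 a3"
      using x T by (auto simp: in_box_complex_iff a1_def a3_def)
    have image: "path_image (rectpath a1 a3) = cbox a1 a3 - box a1 a3"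
      using x T by (intro path_image_rectpath_cbox_minus_box) (auto simp: a1_def a3_def)
    have sub: "path_image (rectpath a1 a3) \<subseteq> {s. x \<le> Re s} - {complex_of_real z}"
      unfolding image using zbox x by (auto simp: in_cbox_complex_iff a1_def a3_def)
    have int: "complex_of_real z \<in> interior {s. x \<le> Re s}"
      using x by (intro interiorI[of "{s. x < Re s}"] open_halfspace_Re_gt) auto
    have "(?f has_contour_integral 2 * pi * \<i> * winding_number (rectpath a1 a3) z * h z) (rectpath a1 a3)"
      using Cauchy_integral_formula_convex_simple[OF _ hol int valid_path_rectpath sub]
      by (simp add: convex_halfspace_Re_ge)
    then have total: "contour_integral (rectpath a1 a3) ?f = 2 * pi * \<i> * h z"
      using winding_number_rectpath[OF zbox] by (simp add: contour_integral_unique)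
    have seg: "closed_segment a1 a2 \<subseteq> path_image (rectpath a1 a3)" "closed_segment a2 a3 \<subseteq> path_image (rectpath a1 a3)"
      "closed_segment a3 a4 \<subseteq> path_image (rectpath a1 a3)" "closed_segment a4 a1 \<subseteq> path_image (rectpath a1 a3)"
      unfolding rect by (simp_all add: path_image_join) blast+
    have ci: "?f contour_integrable_on linepath a1 a2" "?f contour_integrable_on linepath a2 a3"
      "?f contour_integrable_on linepath a3 a4" "?f contour_integrable_on linepath a4 a1"
      using seg sub by (auto intro!: contour_integrable_continuous_linepath cont)
    have "contour_integral (rectpath a1 a3) ?f = contour_integral (linepath a1 a2) ?f +
        contour_integral (linepath a2 a3) ?f + contour_integral (linepath a3 a4) ?f + contour_integral (linepath a4 a1) ?f"
      unfolding rect using ci by (simp add: contour_integrable_joinI valid_path_join)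
    moreover have "contour_integral (linepath a2 a3) ?f = J \<gamma>2 T"
      unfolding J_def a2_def a3_def using T by (intro contour_integral_vertical_linepath cont2) auto
    moreover have "contour_integral (linepath a4 a1) ?f = - (J \<gamma>1 T)"
    proof -
      have "contour_integral (linepath a4 a1) ?f = - contour_integral (linepath a1 a4) ?f"
        by (rule contour_integral_reverse_linepath, rule continuous_on_subset[OF cont1])
          (auto simp: a1_def a4_def closed_segment_same_Re)
      also have "contour_integral (linepath a1 a4) ?f = J \<gamma>1 T"
        unfolding J_def a1_def a4_def by (rule contour_integral_vertical_linepath[OF cont1]) (use T in simp)
      finally show ?thesis .
    qed
    ultimately have eq: "J \<gamma>2 T - J \<gamma>1 T - 2 * pi * \<i> * h z =
      - contour_integral (linepath a1 a2) ?f - contour_integral (linepath a3 a4) ?f"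
      unfolding total by (simp add: algebra_simps)
    define D where "D = C * (1 + T) powr (-1 - \<delta>)"
    have on_seg: "norm (?f s) \<le> D" if "s \<in> closed_segment (Complex \<gamma>1 t) (Complex \<gamma>2 t)" "\<bar>t\<bar> = T" for s t
    proof -
      have "\<gamma>1 \<le> Re s" "Re s \<le> \<gamma>2" "Im s = t"
        using that x by (auto simp: closed_segment_same_Im closed_segment_eq_real_ivl)
      then show ?thesis unfolding D_def using bound[of s] T that by simp
    qed
    \<comment> \<open>The sign of \<open>C\<close> is not prescribed; non-negativity of
      \<open>D\<close> is read off from a norm at one corner.\<close>
    have D: "0 \<le> D" using on_seg[of a1 "- T"] T by (auto simp: a1_def intro: order_trans[OF norm_ge_zero])
    have b1: "norm (contour_integral (linepath a1 a2) ?f) \<le> D * norm (a2 - a1)"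
      by (rule contour_integral_bound_linepath[OF ci(1) D]) (use on_seg[of _ "- T"] T in \<open>auto simp: a1_def a2_def\<close>)
    have b2: "norm (contour_integral (linepath a3 a4) ?f) \<le> D * norm (a4 - a3)"
      by (rule contour_integral_bound_linepath[OF ci(3) D])
        (use on_seg[of _ T] T in \<open>auto simp: a3_def a4_def closed_segment_commute\<close>)
    have "norm (a2 - a1) = \<gamma>2 - \<gamma>1" "norm (a4 - a3) = \<gamma>2 - \<gamma>1"
      using x by (simp_all add: a1_def a2_def a3_def a4_def cmod_def)
    then show ?thesis
      unfolding eq using b1 b2 norm_triangle_ineq4[of "- contour_integral (linepath a1 a2) ?f" "contour_integral (linepath a3 a4) ?f"]
      by (simp add: D_def)
  qed
  have "(\<lambda>n. 2 * (C * (1 + real (Suc n)) powr (-1 - \<delta>) * (\<gamma>2 - \<gamma>1))) \<longlonglongrightarrow> 0"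
    using \<delta> by real_asymp
  then have "(\<lambda>n. J \<gamma>2 (real (Suc n)) - J \<gamma>1 (real (Suc n)) - 2 * pi * \<i> * h z) \<longlonglongrightarrow> 0"
    by (rule Lim_null_comparison[rotated], intro always_eventually allI diff) simp
  then have "(\<lambda>n. J \<gamma>2 (real (Suc n)) - J \<gamma>1 (real (Suc n))) \<longlonglongrightarrow> 2 * pi * \<i> * h z"
    by (simp only: LIM_zero_iff)
  from LIMSEQ_unique[OF lim this] show ?thesis
    by (simp only: vline_integral_eq of_real_mult of_real_numeral)
qed

text \<open>Cauchy's theorem as a degenerate case of Cauchy's formula: (s - z) g(s) vanishes at a
  real point z placed strictly between the two lines, so the residue term is 0.\<close>

lemma vline_integral_shift:
  assumes hol: "g holomorphic_on {s. x \<le> Re s}"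
    and x: "x < \<gamma>1" "\<gamma>1 \<le> \<gamma>2"
    and \<delta>: "0 < \<delta>"
    and bound: "\<And>s. \<gamma>1 \<le> Re s \<Longrightarrow> Re s \<le> \<gamma>2 \<Longrightarrow> norm (g s) \<le> C * (1 + \<bar>Im s\<bar>) powr (-1 - \<delta>)"
  shows "vline_integral \<gamma>1 g = vline_integral \<gamma>2 g"
proof (cases "\<gamma>1 = \<gamma>2")
  case False
  define z where "z = (\<gamma>1 + \<gamma>2) / 2"
  let ?h = "\<lambda>s. g s * (s - z)"
  have z: "\<gamma>1 < z" "z < \<gamma>2" using False x by (auto simp: z_def)
  have "vline_integral \<gamma>2 (\<lambda>s. ?h s / (s - z)) - vline_integral \<gamma>1 (\<lambda>s. ?h s / (s - z)) = 2 * pi * \<i> * ?h z"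
  proof (rule Cauchy_integral_formula_vertical_strip[OF _ x(1) z \<delta>])
    show "?h holomorphic_on {s. x \<le> Re s}" by (intro holomorphic_intros hol)
    fix s assume s: "\<gamma>1 \<le> Re s" "Re s \<le> \<gamma>2" "1 \<le> \<bar>Im s\<bar>"
    then have "s \<noteq> z" by auto
    then show "norm (?h s / (s - z)) \<le> C * (1 + \<bar>Im s\<bar>) powr (-1 - \<delta>)"
      using bound[OF s(1,2)] by simp
  qed
  moreover have "vline_integral \<gamma> (\<lambda>s. ?h s / (s - z)) = vline_integral \<gamma> g" if "\<gamma> \<noteq> z" for \<gamma>
    unfolding vline_integral_def
    by (intro Bochner_Integration.integral_cong) (use that in \<open>auto simp: complex_eq_iff\<close>)
  ultimately show ?thesis using z by simp
qed simp

lemma norm_of_real_powr: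
  "0 < \<tau> \<Longrightarrow> norm (complex_of_real \<tau> powr s) = \<tau> powr Re s"
  by (simp add: norm_powr_real_powr)

text \<open>Provides a margin: the finitely many rightmost poles lie strictly to the left of some x
  < \<gamma>, so the quotient is holomorphic on a half-plane containing the contour in its
  interior.\<close>

lemma foxH_contour_iff:
  assumes "\<forall>(b, \<beta>)\<in>set B. (0::real) < \<beta>"
  shows "foxH_contour B \<gamma> \<longleftrightarrow> (\<exists>x<\<gamma>. \<forall>(b, \<beta>)\<in>set B. 0 < \<beta> \<and> - b / \<beta> < x)"
proof
  assume \<gamma>: "foxH_contour B \<gamma>"
  \<comment> \<open>The midpoints between \<gamma> and the numbers -b / \<beta>; \<gamma> - 1 is
    inserted for the case that \<open>B\<close> is empty.\<close>
  define x where "x = Max (insert (\<gamma> - 1) ((\<lambda>(b, \<beta>). (\<gamma> - b / \<beta>) / 2) ` set B))"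
  have "x < \<gamma>"
    unfolding x_def using \<gamma> by (subst Max_less_iff) (auto simp: foxH_contour_def field_simps)
  moreover have "- b / \<beta> < x" if "(b, \<beta>) \<in> set B" for b \<beta>
  proof -
    have "- b / \<beta> < \<gamma>" using \<gamma> that by (auto simp: foxH_contour_def)
    moreover have "q < (\<gamma> + q) / 2" if "q < \<gamma>" for q using that by simp
    ultimately have "- b / \<beta> < (\<gamma> + - b / \<beta>) / 2" by blast
    also have "(\<gamma> + - b / \<beta>) / 2 = (\<gamma> - b / \<beta>) / 2" by simp
    also have "\<dots> \<le> x" unfolding x_def using that by (intro Max_ge) (simp, force)
    finally show ?thesis .
  qed
  ultimately show "\<exists>x<\<gamma>. \<forall>(b, \<beta>)\<in>set B. 0 < \<beta> \<and> - b / \<beta> < x" using assms by blast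
qed (force simp: foxH_contour_def)

section \<open>Independence of the Fox H-function of its contour\<close>

locale foxH_params =
  fixes A B :: "(real \<times> real) list"
  assumes A: "\<forall>(a, \<alpha>)\<in>set A. \<alpha> > 0 \<and> a + \<alpha> > 0"
    and B: "\<forall>(b, \<beta>)\<in>set B. \<beta> > 0 \<and> b + \<beta> > 0"
    and star: "a_star A B > 0 \<or> a_star A B = 0 \<and> mu_exponent A B < -1"
begin

lemma contourE:
  assumes "foxH_contour B \<gamma>"
  obtains x where "x < \<gamma>" "\<forall>(b, \<beta>)\<in>set B. 0 < \<beta> \<and> - b / \<beta> < x"
proof -
  have "\<forall>(b, \<beta>)\<in>set B. 0 < \<beta>" using B by auto
  from foxH_contour_iff[OF this] show thesis using assms that by blast
qed

lemma decay:
  assumes "\<forall>(b, \<beta>)\<in>set B. 0 < \<beta> \<and> - b / \<beta> < x1"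
  obtains C \<delta> where "0 < \<delta>" "0 < C"
    "\<And>s. x1 \<le> Re s \<Longrightarrow> Re s \<le> x2 \<Longrightarrow> norm (gamma_quot A B s) \<le> C * (1 + \<bar>Im s\<bar>) powr (-1 - \<delta>)"
proof -
  have "\<forall>(a, \<alpha>)\<in>set A. 0 < \<alpha>" using A by auto
  from gamma_quot_decay[OF this assms star] show thesis using that by blast
qed

lemma foxH_contour_mono: "foxH_contour B \<gamma> \<Longrightarrow> \<gamma> \<le> \<gamma>' \<Longrightarrow> foxH_contour B \<gamma>'"
  by (force simp: foxH_contour_def)

lemma foxH_contour_indep_le:
  assumes \<gamma>: "foxH_contour B \<gamma>1" "\<gamma>1 \<le> \<gamma>2" and \<tau>: "0 < \<tau>"
  shows "foxH A B \<gamma>1 \<tau> = foxH A B \<gamma>2 \<tau>"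
proof -
  obtain x where x: "x < \<gamma>1" "\<forall>(b, \<beta>)\<in>set B. 0 < \<beta> \<and> - b / \<beta> < x" using contourE[OF \<gamma>(1)] .
  obtain C \<delta> where C: "0 < \<delta>" "0 < C"
    "\<And>s. x \<le> Re s \<Longrightarrow> Re s \<le> \<gamma>2 \<Longrightarrow> norm (gamma_quot A B s) \<le> C * (1 + \<bar>Im s\<bar>) powr (-1 - \<delta>)"
    using decay[OF x(2)] by blast
  let ?g = "\<lambda>s. gamma_quot A B s * of_real \<tau> powr (- s)"
  \<comment> \<open>On the strip \<tau> powr (- Re s) is monotone in Re s, increasing or decreasing
    according to \<tau>, hence at most the sum of its values on the two edges.\<close>
  define M where "M = \<tau> powr (- \<gamma>1) + \<tau> powr (- \<gamma>2)"
  have "vline_integral \<gamma>1 ?g = vline_integral \<gamma>2 ?g"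
  proof (rule vline_integral_shift[OF _ x(1) \<gamma>(2) C(1), where C = "C * M"])
    show "?g holomorphic_on {s. x \<le> Re s}"
      using \<tau> by (intro holomorphic_intros holomorphic_on_gamma_quot[OF x(2), THEN holomorphic_on_compose_gen[unfolded o_def, of "\<lambda>s. s", simplified]]) auto
    fix s assume s: "\<gamma>1 \<le> Re s" "Re s \<le> \<gamma>2"
    have "\<tau> powr (- Re s) \<le> M"
    proof (cases "1 \<le> \<tau>")
      case True
      then have "\<tau> powr (- Re s) \<le> \<tau> powr (- \<gamma>1)" using s by (intro powr_mono) auto
      then show ?thesis unfolding M_def by (smt (verit) powr_ge_zero)
    next
      case False
      then have "\<tau> powr (- Re s) \<le> \<tau> powr (- \<gamma>2)" using s \<tau> by (intro powr_mono') auto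
      then show ?thesis unfolding M_def by (smt (verit) powr_ge_zero)
    qed
    then have "norm (?g s) \<le> (C * (1 + \<bar>Im s\<bar>) powr (-1 - \<delta>)) * M"
      unfolding norm_mult using s x C \<tau> by (intro mult_mono) (auto simp: norm_of_real_powr)
    then show "norm (?g s) \<le> C * M * (1 + \<bar>Im s\<bar>) powr (-1 - \<delta>)" by (simp add: mult_ac)
  qed
  then show ?thesis by (simp add: foxH_def)
qed

lemma foxH_contour_indep:
  assumes "foxH_contour B \<gamma>1" "foxH_contour B \<gamma>2" "0 < \<tau>"
  shows "foxH A B \<gamma>1 \<tau> = foxH A B \<gamma>2 \<tau>"
proof (cases "\<gamma>1 \<le> \<gamma>2")
  case True
  then show ?thesis using assms by (intro foxH_contour_indep_le)
next
  case False
  then show ?thesis using assms by (intro foxH_contour_indep_le[symmetric]) auto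
qed

lemma integrable_gamma_quot_vline:
  assumes "foxH_contour B \<gamma>"
  shows "integrable lborel (\<lambda>y. gamma_quot A B (Complex \<gamma> y))"
    and "continuous_on UNIV (\<lambda>y. gamma_quot A B (Complex \<gamma> y))"
proof -
  obtain x where x: "x < \<gamma>" "\<forall>(b, \<beta>)\<in>set B. 0 < \<beta> \<and> - b / \<beta> < x" using contourE[OF assms(1)] .
  obtain C \<delta> where C: "0 < \<delta>" "0 < C"
    "\<And>s. x \<le> Re s \<Longrightarrow> Re s \<le> \<gamma> \<Longrightarrow> norm (gamma_quot A B s) \<le> C * (1 + \<bar>Im s\<bar>) powr (-1 - \<delta>)"
    using decay[OF x(2)] by blast
  have c: "continuous_on {s. Re s = \<gamma>} (gamma_quot A B)"
    using x by (intro continuous_on_subset[OF holomorphic_on_imp_continuous_on[OF holomorphic_on_gamma_quot[OF x(2)]]]) auto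
  show "integrable lborel (\<lambda>y. gamma_quot A B (Complex \<gamma> y))"
    by (rule integrable_vline[OF c C(1), where C = C]) (use C x in auto)
  show "continuous_on UNIV (\<lambda>y. gamma_quot A B (Complex \<gamma> y))"
    by (rule continuous_on_compose2[OF c]) (auto intro!: continuous_intros simp: Complex_eq)
qed

end

section \<open>Laplace transform and moments of the Fox H-function\<close>

lemma integrable_pair_mult:
  fixes f g :: "_ \<Rightarrow> real"
  assumes "sigma_finite_measure M" "sigma_finite_measure N" "integrable M f" "integrable N g"
  shows "integrable (M \<Otimes>\<^sub>M N) (\<lambda>(x, y). f x * g y)"
proof -
  interpret pair_sigma_finite M N using assms by (simp add: pair_sigma_finite_def)
  have [measurable]: "f \<in> borel_measurable M" "g \<in> borel_measurable N" using assms by auto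
  show ?thesis
  proof (rule Fubini_integrable)
    have "(\<lambda>x. LINT y|N. norm (case (x, y) of (x, y) \<Rightarrow> f x * g y)) = (\<lambda>x. norm (f x) * (LINT y|N. norm (g y)))"
      by (simp add: abs_mult)
    then show "integrable M (\<lambda>x. LINT y|N. norm (case (x, y) of (x, y) \<Rightarrow> f x * g y))"
      using assms by simp
  qed (use assms in auto)
qed

section \<open>Mellin integrals of exponentials and of truncated powers\<close>

lemma exp_ln_powr: "0 < \<tau> \<Longrightarrow> complex_of_real \<tau> powr s = exp (s * of_real (ln \<tau>))"
  by (simp add: powr_def Ln_of_real)

text \<open>Euler's integral. Writing the power as
  \<open>exp ((u - 1) * of_real (ln \<tau>))\<close> makes the integrand evidently Borel measurable
  on the whole line, which allows the passage from \<open>lebesgue\<close> to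
  \<open>lborel\<close>.\<close>

lemma has_bochner_integral_Gamma:
  assumes "0 < Re u"
  shows "has_bochner_integral lborel (\<lambda>\<tau>. indicator {0<..} \<tau> *\<^sub>R (exp ((u - 1) * of_real (ln \<tau>)) * of_real (exp (- \<tau>)))) (Gamma u)"
proof -
  let ?f = "\<lambda>\<tau>. complex_of_real \<tau> powr (u - 1) / of_real (exp \<tau>)"
  let ?g = "\<lambda>\<tau>. indicator {0<..} \<tau> *\<^sub>R (exp ((u - 1) * of_real (ln \<tau>)) * complex_of_real (exp (- \<tau>)))"
  have eq: "(\<lambda>\<tau>. indicator {0<..} \<tau> *\<^sub>R ?f \<tau>) = ?g"
    by (auto simp: fun_eq_iff indicator_def exp_ln_powr exp_minus divide_inverse)
  have "set_integrable lebesgue {0<..} ?f"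
    using absolutely_integrable_Gamma_integral'[OF assms] .
  then have "integrable lebesgue ?g" and "integral\<^sup>L lebesgue ?g = integral {0<..} ?f"
    using set_lebesgue_integral_eq_integral(2)[of "{0<..}" ?f]
    by (simp_all add: set_integrable_def set_lebesgue_integral_def eq)
  moreover have "?g \<in> borel_measurable lborel" by measurable
  moreover have "integral {0<..} ?f = Gamma u"
    using Gamma_integral_complex'[OF assms] by (rule integral_unique)
  ultimately show ?thesis
    by (simp add: has_bochner_integral_iff integrable_completion integral_completion)
qed

lemma has_bochner_integral_Gamma_scaled:
  assumes "0 < Re u" "0 < s"
  shows "has_bochner_integral lborel (\<lambda>\<tau>. indicator {0<..} \<tau> *\<^sub>R (exp ((u - 1) * of_real (ln \<tau>)) * of_real (exp (- s * \<tau>))))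
    (Gamma u * of_real s powr (- u))"
proof -
  let ?f = "\<lambda>\<tau>. indicator {0<..} \<tau> *\<^sub>R (exp ((u - 1) * of_real (ln \<tau>)) * of_real (exp (- \<tau>))) :: complex"
  have "has_bochner_integral lborel (\<lambda>\<tau>. ?f (0 + s * \<tau>)) (Gamma u /\<^sub>R \<bar>s\<bar>)"
    using has_bochner_integral_Gamma[OF assms(1)] assms(2)
    by (subst lborel_has_bochner_integral_real_affine_iff[symmetric]) auto
  then have "has_bochner_integral lborel (\<lambda>\<tau>. of_real s powr (1 - u) * ?f (0 + s * \<tau>)) (of_real s powr (1 - u) * (Gamma u /\<^sub>R \<bar>s\<bar>))"
    by (rule has_bochner_integral_mult_right) 
  moreover have "of_real s powr (1 - u) * ?f (0 + s * \<tau>) =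
      indicator {0<..} \<tau> *\<^sub>R (exp ((u - 1) * of_real (ln \<tau>)) * of_real (exp (- s * \<tau>)))" for \<tau>
  proof (cases "0 < \<tau>")
    case True
    have "of_real s powr (1 - u) * exp ((u - 1) * of_real (ln (s * \<tau>))) = exp ((u - 1) * of_real (ln \<tau>))"
      using True assms(2) by (simp add: exp_ln_powr ln_mult ring_distribs flip: exp_add)
    then show ?thesis
      using True assms(2) by (simp flip: mult.assoc)
  qed (use assms in \<open>simp add: zero_less_mult_iff\<close>)
  moreover have "of_real s powr (1 - u) * (Gamma u /\<^sub>R \<bar>s\<bar>) = Gamma u * of_real s powr (- u)"
    using assms(2) by (simp add: powr_diff powr_minus scaleR_conv_of_real field_simps)
  ultimately show ?thesis by simp
qed

lemma has_vector_derivative_exp_ln: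
  assumes "0 < \<tau>" "k \<noteq> 0"
  shows "((\<lambda>\<tau>. exp (k * complex_of_real (ln \<tau>)) / k) has_vector_derivative exp ((k - 1) * of_real (ln \<tau>))) (at \<tau>)"
proof -
  have "((\<lambda>\<tau>. complex_of_real (ln \<tau>)) has_vector_derivative of_real (1 / \<tau>)) (at \<tau>)"
    using assms by (intro has_vector_derivative_of_real) (auto intro!: derivative_eq_intros simp flip: has_real_derivative_iff_has_vector_derivative)
  moreover have "((\<lambda>w. exp (k * w) / k) has_field_derivative exp (k * of_real (ln \<tau>))) (at (of_real (ln \<tau>)))"
    using assms by (auto intro!: derivative_eq_intros)
  ultimately have "(((\<lambda>w. exp (k * w) / k) \<circ> (\<lambda>\<tau>. complex_of_real (ln \<tau>))) has_vector_derivative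
      of_real (1 / \<tau>) * exp (k * of_real (ln \<tau>))) (at \<tau>)"
    by (rule field_vector_diff_chain_at)
  moreover have "of_real (1 / \<tau>) * exp (k * of_real (ln \<tau>)) = exp ((k - 1) * of_real (ln \<tau>))"
    using assms by (simp add: left_diff_distrib exp_diff exp_of_real)
  ultimately show ?thesis by (simp add: o_def)
qed

text \<open>Absolute integrability is that of the modulus \<tau>^(Re k - 1) and follows from the
  fundamental theorem for non-negative functions; only then does the complex fundamental theorem
  give the value. This is why both the real and the complex antiderivative need limits at the
  endpoints.\<close>

lemma has_bochner_integral_powr_interval:
  fixes k A' B' :: complex and a b :: ereal
  assumes ab: "0 \<le> a" "a < b" and k: "Re k \<noteq> 0"
    and lim: "(((\<lambda>\<tau>. exp (k * complex_of_real (ln \<tau>)) / k) \<circ> real_of_ereal) \<longlongrightarrow> A') (at_right a)"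
      "(((\<lambda>\<tau>. exp (k * complex_of_real (ln \<tau>)) / k) \<circ> real_of_ereal) \<longlongrightarrow> B') (at_left b)"
    and limr: "(((\<lambda>\<tau>. exp (Re k * ln \<tau>) / Re k) \<circ> real_of_ereal) \<longlongrightarrow> A'') (at_right a)"
      "(((\<lambda>\<tau>. exp (Re k * ln \<tau>) / Re k) \<circ> real_of_ereal) \<longlongrightarrow> B'') (at_left b)"
  shows "has_bochner_integral lborel (\<lambda>\<tau>. indicator (einterval a b) \<tau> *\<^sub>R exp ((k - 1) * of_real (ln \<tau>))) (B' - A')"
proof -
  have pos: "0 < \<tau>" if "a < ereal \<tau>" for \<tau>
    using that ab(1) by (metis ereal_less(2) le_less_trans)
  have "set_integrable lborel (einterval a b) (\<lambda>\<tau>. exp ((Re k - 1) * ln \<tau>))"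
  proof (rule interval_integral_FTC_nonneg(1)[OF ab(2) _ _ _ limr])
    fix \<tau> assume "a < ereal \<tau>"
    then have "0 < \<tau>" by (rule pos)
    then have "exp (Re k * ln \<tau>) / \<tau> = exp ((Re k - 1) * ln \<tau>)"
      by (simp add: left_diff_distrib exp_diff)
    then show "((\<lambda>\<tau>. exp (Re k * ln \<tau>) / Re k) has_real_derivative exp ((Re k - 1) * ln \<tau>)) (at \<tau>)"
      using k \<open>0 < \<tau>\<close> by (auto intro!: derivative_eq_intros simp: field_simps)
    show "isCont (\<lambda>\<tau>. exp ((Re k - 1) * ln \<tau>)) \<tau>"
      using \<open>0 < \<tau>\<close> by (intro continuous_intros) auto
  qed auto
  then have *: "integrable lborel (\<lambda>\<tau>. indicator (einterval a b) \<tau> *\<^sub>R exp ((Re k - 1) * ln \<tau>))"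
    by (simp add: set_integrable_def)
  have int: "set_integrable lborel (einterval a b) (\<lambda>\<tau>. exp ((k - 1) * complex_of_real (ln \<tau>)))"
    unfolding set_integrable_def
  proof (rule Bochner_Integration.integrable_bound[OF *])
    show "AE \<tau> in lborel. norm (indicator (einterval a b) \<tau> *\<^sub>R exp ((k - 1) * complex_of_real (ln \<tau>)))
        \<le> norm (indicator (einterval a b) \<tau> *\<^sub>R exp ((Re k - 1) * ln \<tau>))"
      by (auto simp: indicator_def)
  qed measurable
  have "(LBINT \<tau>=a..b. exp ((k - 1) * complex_of_real (ln \<tau>))) = B' - A'"
  proof (rule interval_integral_FTC_integrable[OF ab(2) _ _ int lim])
    fix \<tau> assume "a < ereal \<tau>"
    then have "0 < \<tau>" by (rule pos)
    show "((\<lambda>\<tau>. exp (k * complex_of_real (ln \<tau>)) / k) has_vector_derivative exp ((k - 1) * of_real (ln \<tau>))) (at \<tau>)"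
      using \<open>0 < \<tau>\<close> k by (intro has_vector_derivative_exp_ln) auto
    show "isCont (\<lambda>\<tau>. exp ((k - 1) * complex_of_real (ln \<tau>))) \<tau>"
      using \<open>0 < \<tau>\<close> by (intro continuous_intros) auto
  qed
  then show ?thesis
    using int less_imp_le[OF ab(2)] by (simp add: has_bochner_integral_iff set_integrable_def interval_lebesgue_integral_def set_lebesgue_integral_def)
qed

lemma tendsto_complex_exp_ln_zero:
  assumes "((\<lambda>\<tau>. exp (Re k * ln \<tau>)) \<longlongrightarrow> 0) F"
  shows "((\<lambda>\<tau>. exp (k * complex_of_real (ln \<tau>)) / k) \<longlongrightarrow> 0) F"
proof -
  have "((\<lambda>\<tau>. exp (k * complex_of_real (ln \<tau>))) \<longlongrightarrow> 0) F"
    by (rule tendsto_norm_zero_cancel) (use assms in simp)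
  from tendsto_divide_zero[OF this] show ?thesis .
qed

lemma has_bochner_integral_powr_0_1:
  assumes "0 < Re k"
  shows "has_bochner_integral lborel (\<lambda>\<tau>. indicator {0<..<1} \<tau> *\<^sub>R exp ((k - 1) * complex_of_real (ln \<tau>))) (1 / k)"
proof -
  have r0: "((\<lambda>\<tau>. exp (Re k * ln \<tau>)) \<longlongrightarrow> 0) (at_right (0::real))"
    using assms by real_asymp
  have r1: "((\<lambda>\<tau>. exp (Re k * ln \<tau>)) \<longlongrightarrow> exp (Re k * ln 1)) (at_left (1::real))"
    by (intro tendsto_intros) auto
  have c1: "((\<lambda>\<tau>. exp (k * complex_of_real (ln \<tau>)) / k) \<longlongrightarrow> exp (k * of_real (ln 1)) / k) (at_left (1::real))"
    using assms by (intro tendsto_intros) auto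
  have "has_bochner_integral lborel (\<lambda>\<tau>. indicator (einterval (ereal 0) (ereal 1)) \<tau> *\<^sub>R exp ((k - 1) * of_real (ln \<tau>)))
      (exp (k * of_real (ln 1)) / k - 0)"
  proof (rule has_bochner_integral_powr_interval)
    show "(((\<lambda>\<tau>. exp (k * complex_of_real (ln \<tau>)) / k) \<circ> real_of_ereal) \<longlongrightarrow> 0) (at_right (ereal 0))"
      using tendsto_complex_exp_ln_zero[OF r0] by (simp add: ereal_tendsto_simps)
    show "(((\<lambda>\<tau>. exp (k * complex_of_real (ln \<tau>)) / k) \<circ> real_of_ereal) \<longlongrightarrow> exp (k * of_real (ln 1)) / k) (at_left (ereal 1))"
      using c1 by (simp add: ereal_tendsto_simps)
    show "(((\<lambda>\<tau>. exp (Re k * ln \<tau>) / Re k) \<circ> real_of_ereal) \<longlongrightarrow> 0 / Re k) (at_right (ereal 0))"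
      unfolding ereal_tendsto_simps using assms by (intro tendsto_divide r0) auto
    show "(((\<lambda>\<tau>. exp (Re k * ln \<tau>) / Re k) \<circ> real_of_ereal) \<longlongrightarrow> exp (Re k * ln 1) / Re k) (at_left (ereal 1))"
      unfolding ereal_tendsto_simps using assms by (intro tendsto_divide r1) auto
  qed (use assms in auto)
  moreover have "einterval (ereal 0) (ereal 1) = {0<..<1}" by (auto simp: einterval_def)
  ultimately show ?thesis by simp
qed

lemma has_bochner_integral_powr_1_infinity:
  assumes "Re k < 0"
  shows "has_bochner_integral lborel (\<lambda>\<tau>. indicator {1<..} \<tau> *\<^sub>R exp ((k - 1) * complex_of_real (ln \<tau>))) (- 1 / k)"
proof -
  have r0: "((\<lambda>\<tau>. exp (Re k * ln \<tau>)) \<longlongrightarrow> 0) (at_top :: real filter)"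
    using assms by real_asymp
  have r1: "((\<lambda>\<tau>. exp (Re k * ln \<tau>)) \<longlongrightarrow> exp (Re k * ln 1)) (at_right (1::real))"
    by (intro tendsto_intros) auto
  have c1: "((\<lambda>\<tau>. exp (k * complex_of_real (ln \<tau>)) / k) \<longlongrightarrow> exp (k * of_real (ln 1)) / k) (at_right (1::real))"
    using assms by (intro tendsto_intros) auto
  have "has_bochner_integral lborel (\<lambda>\<tau>. indicator (einterval (ereal 1) \<infinity>) \<tau> *\<^sub>R exp ((k - 1) * of_real (ln \<tau>)))
      (0 - exp (k * of_real (ln 1)) / k)"
  proof (rule has_bochner_integral_powr_interval)
    show "(((\<lambda>\<tau>. exp (k * complex_of_real (ln \<tau>)) / k) \<circ> real_of_ereal) \<longlongrightarrow> 0) (at_left \<infinity>)"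
      using tendsto_complex_exp_ln_zero[OF r0] by (simp add: ereal_tendsto_simps)
    show "(((\<lambda>\<tau>. exp (k * complex_of_real (ln \<tau>)) / k) \<circ> real_of_ereal) \<longlongrightarrow> exp (k * of_real (ln 1)) / k) (at_right (ereal 1))"
      using c1 by (simp add: ereal_tendsto_simps)
    show "(((\<lambda>\<tau>. exp (Re k * ln \<tau>) / Re k) \<circ> real_of_ereal) \<longlongrightarrow> 0 / Re k) (at_left \<infinity>)"
      unfolding ereal_tendsto_simps using assms by (intro tendsto_divide r0) auto
    show "(((\<lambda>\<tau>. exp (Re k * ln \<tau>) / Re k) \<circ> real_of_ereal) \<longlongrightarrow> exp (Re k * ln 1) / Re k) (at_right (ereal 1))"
      unfolding ereal_tendsto_simps using assms by (intro tendsto_divide r1) auto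
  qed (use assms in auto)
  moreover have "einterval (ereal 1) \<infinity> = {1<..}" by (auto simp: einterval_def)
  ultimately show ?thesis by simp
qed

context foxH_params
begin

text \<open>Fubini for the weight \<open>w\<close> against the contour integral. On the line Re s =
  \<sigma> the modulus of the integrand factors into w(\<tau>) \<tau>^(-\<sigma>) and the modulus of
  the Gamma quotient, which explains the integrability hypothesis. \<open>I s\<close> is the Mellin
  transform of \<open>w\<close> at 1 - s.\<close>

lemma foxH_weighted:
  fixes w :: "real \<Rightarrow> real"
  assumes \<sigma>: "foxH_contour B \<sigma>"
    and w[measurable]: "w \<in> borel_measurable borel"
    and w0: "\<And>\<tau>. \<tau> \<le> 0 \<Longrightarrow> w \<tau> = 0"
    and int: "integrable lborel (\<lambda>\<tau>. w \<tau> * \<tau> powr (- \<sigma>))"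
    and inner: "\<And>y. (LINT \<tau>|lborel. of_real (w \<tau>) * exp (- Complex \<sigma> y * of_real (ln \<tau>))) = I (Complex \<sigma> y)"
  shows "has_bochner_integral lborel (\<lambda>\<tau>. of_real (w \<tau>) * foxH A B \<sigma> \<tau>)
      (1 / (2 * of_real pi * \<i>) * vline_integral \<sigma> (\<lambda>s. gamma_quot A B s * I s))"
proof -
  let ?Q = "\<lambda>y. gamma_quot A B (Complex \<sigma> y)"
  define F where "F = (\<lambda>\<tau> y. complex_of_real (w \<tau>) * (?Q y * exp (- Complex \<sigma> y * of_real (ln \<tau>))))"
  have Qint: "integrable lborel ?Q" and "continuous_on UNIV ?Q"
    using integrable_gamma_quot_vline[OF \<sigma>] by auto
  then have [measurable]: "?Q \<in> borel_measurable borel"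
    by (simp add: borel_measurable_continuous_onI)
  have [measurable]: "(\<lambda>y. Complex \<sigma> y) \<in> borel_measurable borel"
    by (intro borel_measurable_continuous_onI) (auto intro!: continuous_intros simp: Complex_eq)
  have F_eq: "(LINT y|lborel. F \<tau> y) = 2 * of_real pi * (of_real (w \<tau>) * foxH A B \<sigma> \<tau>)" for \<tau>
  proof (cases "0 < \<tau>")
    case True
    then show ?thesis by (simp add: F_def foxH_def vline_integral_eq exp_ln_powr)
  qed (simp add: F_def w0)
  have "integrable (lborel \<Otimes>\<^sub>M lborel) (\<lambda>(\<tau>, y). (w \<tau> * \<tau> powr (- \<sigma>)) * norm (?Q y))"
    by (intro integrable_pair_mult sigma_finite_lborel int integrable_norm Qint)
  then have Fint: "integrable (lborel \<Otimes>\<^sub>M lborel) (case_prod F)"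
  proof (rule Bochner_Integration.integrable_bound)
    show "case_prod F \<in> borel_measurable (lborel \<Otimes>\<^sub>M lborel)"
      unfolding F_def by measurable
    show "AE p in lborel \<Otimes>\<^sub>M lborel. norm (case_prod F p) \<le> norm (case p of (\<tau>, y) \<Rightarrow> (w \<tau> * \<tau> powr (- \<sigma>)) * norm (?Q y))"
    proof (intro AE_I2)
      fix p :: "real \<times> real"
      obtain \<tau> y where p: "p = (\<tau>, y)" by force
      show "norm (case_prod F p) \<le> norm (case p of (\<tau>, y) \<Rightarrow> (w \<tau> * \<tau> powr (- \<sigma>)) * norm (?Q y))"
        unfolding p by (cases "0 < \<tau>") (auto simp: F_def w0 norm_mult powr_def abs_mult)
    qed
  qed
  have "integrable lborel (\<lambda>\<tau>. LINT y|lborel. F \<tau> y)"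
    by (rule lborel_pair.integrable_fst[OF Fint])
  then have "integrable lborel (\<lambda>\<tau>. 1 / (2 * of_real pi) * (LINT y|lborel. F \<tau> y))"
    by (intro integrable_mult_right)
  moreover have "(\<lambda>\<tau>. 1 / (2 * of_real pi) * (LINT y|lborel. F \<tau> y)) = (\<lambda>\<tau>. of_real (w \<tau>) * foxH A B \<sigma> \<tau>)"
    unfolding F_eq by (simp add: fun_eq_iff)
  ultimately have 1: "integrable lborel (\<lambda>\<tau>. of_real (w \<tau>) * foxH A B \<sigma> \<tau>)"
    by simp
  have "2 * of_real pi * (LINT \<tau>|lborel. of_real (w \<tau>) * foxH A B \<sigma> \<tau>) = (LINT \<tau>|lborel. LINT y|lborel. F \<tau> y)"
    unfolding F_eq by simp
  also have "\<dots> = (LINT y|lborel. LINT \<tau>|lborel. F \<tau> y)"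
    by (rule lborel_pair.Fubini_integral[OF Fint, symmetric])
  also have "(\<lambda>y. LINT \<tau>|lborel. F \<tau> y) = (\<lambda>y. ?Q y * I (Complex \<sigma> y))"
  proof
    fix y
    have "(LINT \<tau>|lborel. F \<tau> y) = (LINT \<tau>|lborel. ?Q y * (of_real (w \<tau>) * exp (- Complex \<sigma> y * of_real (ln \<tau>))))"
      by (simp add: F_def mult.left_commute)
    also have "\<dots> = ?Q y * (LINT \<tau>|lborel. of_real (w \<tau>) * exp (- Complex \<sigma> y * of_real (ln \<tau>)))"
      by (rule integral_mult_right_zero)
    finally show "(LINT \<tau>|lborel. F \<tau> y) = ?Q y * I (Complex \<sigma> y)" by (simp only: inner)
  qed
  finally have "(LINT \<tau>|lborel. of_real (w \<tau>) * foxH A B \<sigma> \<tau>) =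
      1 / (2 * of_real pi * \<i>) * vline_integral \<sigma> (\<lambda>s. gamma_quot A B s * I s)"
    by (simp add: vline_integral_eq field_simps)
  with 1 show ?thesis by (simp add: has_bochner_integral_iff)
qed

lemma foxH_contour_wright:
  assumes "wright_contour B c"
  shows "foxH_contour B (1 - c)"
proof -
  have "1 - c > - b / \<beta>" if "(b, \<beta>) \<in> set B" for b \<beta>
  proof -
    have "c < (b + \<beta>) / \<beta>" "0 < \<beta>" using assms B that by (auto simp: wright_contour_def)
    then show ?thesis by (simp add: field_simps)
  qed
  then show ?thesis by (auto simp: foxH_contour_def)
qed

text \<open>The Mellin transform of exp (-s \<tau>) at 1 - u is Gamma (1 - u) s^(u - 1), valid for
  Re u < 1. The abscissa 1 - c satisfies this because c > 0, and substituting 1 - u for u turns the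
  resulting contour integral into the one that defines \<open>gen_wright\<close>.\<close>

lemma foxH_laplace:
  assumes \<gamma>: "foxH_contour B \<gamma>" and c: "wright_contour B c" and s: "0 < s"
  shows "has_bochner_integral lborel (\<lambda>\<tau>. of_real (indicator {0<..} \<tau> * exp (- s * \<tau>)) * foxH A B \<gamma> \<tau>) (gen_wright A B c (- s))"
proof -
  define \<sigma> where "\<sigma> = 1 - c"
  have \<sigma>: "foxH_contour B \<sigma>" "\<sigma> < 1" using foxH_contour_wright[OF c] c by (auto simp: \<sigma>_def wright_contour_def)
  let ?w = "\<lambda>\<tau>. indicator {0<..} \<tau> * exp (- s * \<tau>) :: real"
  define I where "I = (\<lambda>u. Gamma (1 - u) * complex_of_real s powr (- (1 - u)))"
  have I: "has_bochner_integral lborel (\<lambda>\<tau>. of_real (?w \<tau>) * exp (- u * of_real (ln \<tau>))) (I u)" if "Re u < 1" for u :: complex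
  proof -
    have "(\<lambda>\<tau>. of_real (?w \<tau>) * exp (- u * of_real (ln \<tau>))) =
      (\<lambda>\<tau>. indicator {0<..} \<tau> *\<^sub>R (exp ((1 - u - 1) * of_real (ln \<tau>)) * complex_of_real (exp (- s * \<tau>))))"
      by (auto simp: fun_eq_iff indicator_def)
    then show ?thesis
      unfolding I_def using has_bochner_integral_Gamma_scaled[of "1 - u" s] that s by simp
  qed
  have "has_bochner_integral lborel (\<lambda>\<tau>. of_real (?w \<tau>) * foxH A B \<sigma> \<tau>)
      (1 / (2 * of_real pi * \<i>) * vline_integral \<sigma> (\<lambda>s. gamma_quot A B s * I s))"
  proof (rule foxH_weighted[OF \<sigma>(1)])
    have "integrable lborel (\<lambda>\<tau>. norm (of_real (?w \<tau>) * exp (- of_real \<sigma> * complex_of_real (ln \<tau>))))"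
      using I[of "of_real \<sigma>"] \<sigma> by (intro integrable_norm) (simp add: has_bochner_integral_iff)
    moreover have "(\<lambda>\<tau>. norm (of_real (?w \<tau>) * exp (- of_real \<sigma> * complex_of_real (ln \<tau>)))) = (\<lambda>\<tau>. ?w \<tau> * \<tau> powr (- \<sigma>))"
      by (auto simp: fun_eq_iff indicator_def norm_mult powr_def)
    ultimately show "integrable lborel (\<lambda>\<tau>. ?w \<tau> * \<tau> powr (- \<sigma>))" by simp
    show "(LINT \<tau>|lborel. of_real (?w \<tau>) * exp (- Complex \<sigma> y * of_real (ln \<tau>))) = I (Complex \<sigma> y)" for y
      using I[of "Complex \<sigma> y"] \<sigma> by (intro has_bochner_integral_integral_eq) auto
  qed auto
  moreover have "1 / (2 * of_real pi * \<i>) * vline_integral \<sigma> (\<lambda>s. gamma_quot A B s * I s) = gen_wright A B c (- s)"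
  proof -
    have "vline_integral c (\<lambda>u. Gamma u * gamma_quot A B (1 - u) * of_real s powr (- u)) =
        \<i> * (LINT y|lborel. Gamma (Complex c y) * gamma_quot A B (1 - Complex c y) * of_real s powr (- Complex c y))"
      by (rule vline_integral_eq)
    \<comment> \<open>Replacing s by 1 - s reverses the direction of the vertical line; the
      reflection of y restores it.\<close>
    also have "\<dots> = \<i> * (LINT y|lborel. Gamma (Complex c (0 + -1 * y)) * gamma_quot A B (1 - Complex c (0 + -1 * y)) * of_real s powr (- Complex c (0 + -1 * y)))"
      by (subst lborel_integral_real_affine[of "-1" _ 0]) auto
    also have "(\<lambda>y. Gamma (Complex c (0 + -1 * y)) * gamma_quot A B (1 - Complex c (0 + -1 * y)) * of_real s powr (- Complex c (0 + -1 * y))) =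
        (\<lambda>y. gamma_quot A B (Complex \<sigma> y) * I (Complex \<sigma> y))"
    proof
      fix y
      have "1 - Complex c (0 + -1 * y) = Complex \<sigma> y" "Complex c (0 + -1 * y) = 1 - Complex \<sigma> y"
        by (simp_all add: \<sigma>_def complex_eq_iff)
      then show "Gamma (Complex c (0 + -1 * y)) * gamma_quot A B (1 - Complex c (0 + -1 * y)) * of_real s powr (- Complex c (0 + -1 * y)) =
          gamma_quot A B (Complex \<sigma> y) * I (Complex \<sigma> y)"
        by (simp only: I_def mult_ac)
    qed
    also have "\<i> * (LINT y|lborel. gamma_quot A B (Complex \<sigma> y) * I (Complex \<sigma> y)) =
        vline_integral \<sigma> (\<lambda>s. gamma_quot A B s * I s)"
      by (rule vline_integral_eq[symmetric])
    finally show ?thesis using s by (simp add: gen_wright_def)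
  qed
  moreover have "(\<lambda>\<tau>. of_real (?w \<tau>) * foxH A B \<sigma> \<tau>) = (\<lambda>\<tau>. of_real (?w \<tau>) * foxH A B \<gamma> \<tau>)"
    using foxH_contour_indep[OF \<sigma>(1) \<gamma>] by (auto simp: fun_eq_iff indicator_def)
  ultimately show ?thesis by simp
qed

text \<open>
  The contour is placed to the left of \<open>n + 1\<close> for \<open>\<tau> < 1\<close> and to the right of it for \<open>\<tau> > 1\<close>; the two
  integrals add up to the boundary integral of \<open>Q(s) / (s - n - 1)\<close> over a strip around \<open>n + 1\<close>.
\<close>

lemma foxH_moment:
  assumes \<gamma>: "foxH_contour B \<gamma>" and c: "wright_contour B c"
  shows "has_bochner_integral lborel (\<lambda>\<tau>. of_real (indicator {0<..} \<tau> * \<tau> ^ n) * foxH A B \<gamma> \<tau>) (of_real (gamma_quot A B (real n + 1)))"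
proof -
  \<comment> \<open>\<tau>^(n - s) is integrable on (0,1) for Re s < n + 1 and on (1,\<infinity>)
    for Re s > n + 1, so one abscissa is taken on either side of n + 1.\<close>
  define \<sigma>1 where "\<sigma>1 = 1 - c"
  define \<sigma>2 where "\<sigma>2 = real n + 2"
  have \<sigma>1: "foxH_contour B \<sigma>1" "\<sigma>1 < real n + 1"
    using foxH_contour_wright[OF c] c by (auto simp: \<sigma>1_def wright_contour_def)
  have \<sigma>2: "foxH_contour B \<sigma>2"
    by (rule foxH_contour_mono[OF \<sigma>1(1)]) (use \<sigma>1 in \<open>simp add: \<sigma>2_def\<close>)
  obtain x where x: "x < \<sigma>1" "\<forall>(b, \<beta>)\<in>set B. 0 < \<beta> \<and> - b / \<beta> < x" using contourE[OF \<sigma>1(1)] .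
  obtain C \<delta> where C: "0 < \<delta>" "0 < C"
    "\<And>s. x \<le> Re s \<Longrightarrow> Re s \<le> \<sigma>2 \<Longrightarrow> norm (gamma_quot A B s) \<le> C * (1 + \<bar>Im s\<bar>) powr (-1 - \<delta>)"
    using decay[OF x(2)] by blast
  let ?z = "real n + 1" and ?H = "\<lambda>S \<sigma> \<tau>. of_real (indicator S \<tau> * \<tau> ^ n) * foxH A B \<sigma> \<tau>"
  have strip: "vline_integral \<sigma>2 (\<lambda>s::complex. gamma_quot A B s / (s - ?z)) - vline_integral \<sigma>1 (\<lambda>s::complex. gamma_quot A B s / (s - ?z))
      = 2 * pi * \<i> * gamma_quot A B (complex_of_real ?z)"
  proof (rule Cauchy_integral_formula_vertical_strip[OF holomorphic_on_gamma_quot[OF x(2)] x(1) \<sigma>1(2) _ C(1)])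
    show "?z < \<sigma>2" by (simp add: \<sigma>2_def)
    fix s :: complex assume s: "\<sigma>1 \<le> Re s" "Re s \<le> \<sigma>2" "1 \<le> \<bar>Im s\<bar>"
    \<comment> \<open>Away from the real axis division by s - z does not increase the modulus, so
      the decay of the quotient is inherited.\<close>
    have "1 \<le> norm (s - ?z)" using s(3) abs_Im_le_cmod[of "s - ?z"] by simp
    then have "norm (gamma_quot A B s) / norm (s - ?z) \<le> norm (gamma_quot A B s) / 1"
      by (intro divide_left_mono) auto
    then have "norm (gamma_quot A B s / (s - ?z)) \<le> norm (gamma_quot A B s)"
      by (simp add: norm_divide)
    also have "\<dots> \<le> C * (1 + \<bar>Im s\<bar>) powr (-1 - \<delta>)" using s x by (intro C) auto
    finally show "norm (gamma_quot A B s / (s - complex_of_real ?z)) \<le> C * (1 + \<bar>Im s\<bar>) powr (-1 - \<delta>)" by simp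
  qed
  have pow: "of_real (\<tau> ^ n) * exp (- u * of_real (ln \<tau>)) = exp (((?z - u) - 1) * complex_of_real (ln \<tau>))" if "0 < \<tau>" for \<tau> :: real and u :: complex
  proof -
    have "complex_of_real (\<tau> ^ n) = exp (of_nat n * of_real (ln \<tau>))"
      using that by (simp add: exp_of_nat_mult exp_of_real)
    then show ?thesis by (simp add: algebra_simps flip: exp_add)
  qed
  have piece: "has_bochner_integral lborel (?H S \<gamma>)
      (1 / (2 * of_real pi * \<i>) * vline_integral \<sigma> (\<lambda>s. gamma_quot A B s * I s))"
    if \<sigma>: "foxH_contour B \<sigma>" and S: "S \<in> sets borel" "S \<subseteq> {0<..}"
      and I: "\<And>u :: complex. Re u = \<sigma> \<Longrightarrow> has_bochner_integral lborel (\<lambda>\<tau>. indicator S \<tau> *\<^sub>R exp (((?z - u) - 1) * complex_of_real (ln \<tau>))) (I u)"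
    for \<sigma> S I
  proof -
    have I': "has_bochner_integral lborel (\<lambda>\<tau>. of_real (indicator S \<tau> * \<tau> ^ n) * exp (- u * complex_of_real (ln \<tau>))) (I u)"
      if "Re u = \<sigma>" for u :: complex
    proof -
      have "(\<lambda>\<tau>. of_real (indicator S \<tau> * \<tau> ^ n) * exp (- u * complex_of_real (ln \<tau>))) =
          (\<lambda>\<tau>. indicator S \<tau> *\<^sub>R exp (((?z - u) - 1) * complex_of_real (ln \<tau>)))"
        using S(2) pow by (auto simp: fun_eq_iff indicator_def)
      then show ?thesis using I[OF that] by simp
    qed
    have "has_bochner_integral lborel (?H S \<sigma>)
      (1 / (2 * of_real pi * \<i>) * vline_integral \<sigma> (\<lambda>s. gamma_quot A B s * I s))"
    proof (rule foxH_weighted[OF \<sigma>])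
      show "(\<lambda>\<tau>. indicator S \<tau> * \<tau> ^ n) \<in> borel_measurable borel" using S(1) by measurable
      show "indicator S \<tau> * \<tau> ^ n = 0" if "\<tau> \<le> 0" for \<tau> using S(2) that by (auto simp: indicator_def)
      have "integrable lborel (\<lambda>\<tau>. norm (of_real (indicator S \<tau> * \<tau> ^ n) * exp (- of_real \<sigma> * complex_of_real (ln \<tau>))))"
        using I'[of "of_real \<sigma>"] by (intro integrable_norm) (simp add: has_bochner_integral_iff)
      moreover have "(\<lambda>\<tau>. norm (of_real (indicator S \<tau> * \<tau> ^ n) * exp (- of_real \<sigma> * complex_of_real (ln \<tau>)))) =
          (\<lambda>\<tau>. (indicator S \<tau> * \<tau> ^ n) * \<tau> powr (- \<sigma>))"
        using S(2) by (auto simp: fun_eq_iff indicator_def norm_mult powr_def norm_power)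
      ultimately show "integrable lborel (\<lambda>\<tau>. (indicator S \<tau> * \<tau> ^ n) * \<tau> powr (- \<sigma>))" by simp
      show "(LINT \<tau>|lborel. of_real (indicator S \<tau> * \<tau> ^ n) * exp (- Complex \<sigma> y * of_real (ln \<tau>))) = I (Complex \<sigma> y)" for y
        using I'[of "Complex \<sigma> y"] by (intro has_bochner_integral_integral_eq) auto
    qed
    moreover have "(?H S \<sigma>) = (?H S \<gamma>)"
      using foxH_contour_indep[OF \<sigma> \<gamma>] S(2) by (auto simp: fun_eq_iff indicator_def)
    ultimately show ?thesis by simp
  qed
  have p1: "has_bochner_integral lborel (?H {0<..<1} \<gamma>)
      (1 / (2 * of_real pi * \<i>) * vline_integral \<sigma>1 (\<lambda>s::complex. gamma_quot A B s * (1 / (?z - s))))"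
    by (rule piece[OF \<sigma>1(1)], simp, force, rule has_bochner_integral_powr_0_1) (use \<sigma>1 in simp)
  have p2: "has_bochner_integral lborel (?H {1<..} \<gamma>)
      (1 / (2 * of_real pi * \<i>) * vline_integral \<sigma>2 (\<lambda>s::complex. gamma_quot A B s * (- 1 / (?z - s))))"
    by (rule piece[OF \<sigma>2], simp, force, rule has_bochner_integral_powr_1_infinity) (simp add: \<sigma>2_def)
  have "vline_integral \<sigma>1 (\<lambda>s::complex. gamma_quot A B s * (1 / (?z - s))) = - vline_integral \<sigma>1 (\<lambda>s::complex. gamma_quot A B s / (s - ?z))"
  proof -
    have "gamma_quot A B s * (1 / (?z - s)) = - (gamma_quot A B s / (s - ?z))" for s :: complex
      by (metis (no_types, lifting) divide_minus_right minus_diff_eq mult.right_neutral times_divide_eq_right)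
    then show ?thesis by (simp add: vline_integral_eq)
  qed
  moreover have "vline_integral \<sigma>2 (\<lambda>s::complex. gamma_quot A B s * (- 1 / (?z - s))) = vline_integral \<sigma>2 (\<lambda>s::complex. gamma_quot A B s / (s - ?z))"
  proof -
    have "gamma_quot A B s * (- 1 / (?z - s)) = gamma_quot A B s / (s - ?z)" for s :: complex
      by (metis (no_types, lifting) divide_minus_right minus_diff_eq mult.right_neutral times_divide_eq_right minus_divide_left)
    then show ?thesis by simp
  qed
  ultimately have "1 / (2 * of_real pi * \<i>) * vline_integral \<sigma>1 (\<lambda>s::complex. gamma_quot A B s * (1 / (?z - s))) +
      1 / (2 * of_real pi * \<i>) * vline_integral \<sigma>2 (\<lambda>s::complex. gamma_quot A B s * (- 1 / (?z - s))) =
      1 / (2 * of_real pi * \<i>) * (2 * pi * \<i> * gamma_quot A B (complex_of_real ?z))"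
    unfolding strip[symmetric] by (simp add: algebra_simps)
  also have "\<dots> = of_real (gamma_quot A B ?z)"
    unfolding gamma_quot_of_real by simp
  finally have val: "1 / (2 * of_real pi * \<i>) * vline_integral \<sigma>1 (\<lambda>s::complex. gamma_quot A B s * (1 / (?z - s))) +
      1 / (2 * of_real pi * \<i>) * vline_integral \<sigma>2 (\<lambda>s::complex. gamma_quot A B s * (- 1 / (?z - s))) + measure lborel {1::real} *\<^sub>R foxH A B \<gamma> 1 =
      of_real (gamma_quot A B ?z)"
    by simp
  \<comment> \<open>The point \<tau> = 1 belongs to neither piece; its contribution is added
    explicitly and has measure 0.\<close>
  have p3: "has_bochner_integral lborel (\<lambda>\<tau>. indicator {1::real} \<tau> *\<^sub>R foxH A B \<gamma> 1) (measure lborel {1::real} *\<^sub>R foxH A B \<gamma> 1)"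
    by (rule has_bochner_integral_indicator) auto
  have split: "(?H {0<..} \<gamma>) =
     (\<lambda>\<tau>. of_real (indicator {0<..<1} \<tau> * \<tau> ^ n) * foxH A B \<gamma> \<tau> +
      of_real (indicator {1<..} \<tau> * \<tau> ^ n) * foxH A B \<gamma> \<tau> + indicator {1} \<tau> *\<^sub>R foxH A B \<gamma> 1)"
    by (auto simp: fun_eq_iff indicator_def)
  show ?thesis
    using has_bochner_integral_add[OF has_bochner_integral_add[OF p1 p2] p3] unfolding split val .
qed

end

section \<open>The Mandelbrot--van Ness kernel\<close>

lemma integrable_powr_0_1:
  fixes q :: real
  assumes "-1 < q"
  shows "integrable lborel (\<lambda>r. indicator {0<..<1} r * r powr q)"
proof -
  have "integrable lborel (\<lambda>r. norm (indicator {0<..<1} r *\<^sub>R exp ((of_real (q + 1) - 1) * complex_of_real (ln r))))"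
    using has_bochner_integral_powr_0_1[of "of_real (q + 1)"] assms
    by (intro integrable_norm) (simp add: has_bochner_integral_iff)
  moreover have "(\<lambda>r. norm (indicator {0<..<1} r *\<^sub>R exp ((of_real (q + 1) - 1) * complex_of_real (ln r)))) =
      (\<lambda>r. indicator {0<..<1} r * r powr q)"
    by (auto simp: fun_eq_iff indicator_def powr_def)
  ultimately show ?thesis by simp
qed

lemma integrable_powr_1_infinity:
  fixes q :: real
  assumes "q < -1"
  shows "integrable lborel (\<lambda>r. indicator {1<..} r * r powr q)"
proof -
  have "integrable lborel (\<lambda>r. norm (indicator {1<..} r *\<^sub>R exp ((of_real (q + 1) - 1) * complex_of_real (ln r))))"
    using has_bochner_integral_powr_1_infinity[of "of_real (q + 1)"] assms
    by (intro integrable_norm) (simp add: has_bochner_integral_iff)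
  moreover have "(\<lambda>r. norm (indicator {1<..} r *\<^sub>R exp ((of_real (q + 1) - 1) * complex_of_real (ln r)))) =
      (\<lambda>r. indicator {1<..} r * r powr q)"
    by (auto simp: fun_eq_iff indicator_def powr_def)
  ultimately show ?thesis by simp
qed

text \<open>For \<open>x = a\<close> and negative \<open>p\<close> the integrand is singular at the
  left endpoint; the antiderivative is still continuous there because p + 1 > 0.\<close>

lemma has_bochner_integral_shifted_powr:
  fixes a b x p :: real
  assumes "x \<le> a" "a < b" "-1 < p"
  shows "has_bochner_integral lborel (\<lambda>u. indicator {a<..<b} u * (u - x) powr p)
    (((b - x) powr (p + 1) - (a - x) powr (p + 1)) / (p + 1))"
proof -
  let ?F = "\<lambda>u. (u - x) powr (p + 1) / (p + 1)"
  have cont: "continuous_on {a..b} ?F"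
    using assms by (intro continuous_intros continuous_on_powr') auto
  have "(?F \<longlongrightarrow> ?F a) (at_right a)"
    by (rule continuous_on_Icc_at_rightD[OF cont assms(2)])
  moreover have "(?F \<longlongrightarrow> ?F b) (at_left b)"
    by (rule continuous_on_Icc_at_leftD[OF cont assms(2)])
  moreover have "(?F has_real_derivative (u - x) powr p) (at u)" if "a < u" for u
  proof -
    have "((\<lambda>u. (u - x) powr (p + 1)) has_real_derivative ((p + 1) * (u - x) powr (p + 1 - of_nat 1) * 1)) (at u)"
      using that assms by (intro DERIV_fun_powr) (auto intro!: derivative_eq_intros)
    from DERIV_cdivide[OF this, of "p + 1"] show ?thesis using assms by simp
  qed
  moreover have "isCont (\<lambda>u. (u - x) powr p) u" if "a < u" for u
    using that assms by (intro continuous_intros) auto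
  ultimately have "set_integrable lborel (einterval (ereal a) (ereal b)) (\<lambda>u. (u - x) powr p)"
    "(LBINT u=ereal a..ereal b. (u - x) powr p) = ?F b - ?F a"
    using assms
    by (intro interval_integral_FTC_nonneg[where F = ?F and A = "?F a" and B = "?F b"];
        simp add: ereal_tendsto_simps)+
  moreover have "einterval (ereal a) (ereal b) = {a<..<b}" by (auto simp: einterval_def)
  ultimately show ?thesis
    using assms by (simp add: has_bochner_integral_iff set_integrable_def interval_lebesgue_integral_def
        set_lebesgue_integral_def diff_divide_distrib)
qed

lemma integral_indicator_shifted_powr:
  fixes t x p :: real
  assumes "0 \<le> t" "-1 < p"
  shows "(LBINT u:{x<..}. indicator {0..<t} u * (u - x) powr p) =
    (max (t - x) 0 powr (p + 1) - max (- x) 0 powr (p + 1)) / (p + 1)"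
proof (cases "max x 0 < t")
  case True
  have "(LBINT u:{x<..}. indicator {0..<t} u * (u - x) powr p) =
      (LINT u|lborel. indicator {max x 0<..<t} u * (u - x) powr p)"
    unfolding set_lebesgue_integral_def
  proof (rule integral_cong_AE)
    show "AE u in lborel. indicator {x<..} u *\<^sub>R (indicator {0..<t} u * (u - x) powr p) =
        indicator {max x 0<..<t} u * (u - x) powr p"
      using AE_lborel_singleton[of 0] by eventually_elim (auto simp: indicator_def)
  qed measurable
  also have "\<dots> = ((t - x) powr (p + 1) - (max x 0 - x) powr (p + 1)) / (p + 1)"
    using has_bochner_integral_shifted_powr[of x "max x 0" t p] assms True
    by (intro has_bochner_integral_integral_eq) auto
  also have "max x 0 - x = max (- x) 0" by auto
  also have "t - x = max (t - x) 0" using True by auto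
  finally show ?thesis .
next
  \<comment> \<open>Either x >= t, and both positive parts are 0, or t = 0, and they
    coincide.\<close>
  case False
  have "(LBINT u:{x<..}. indicator {0..<t} u * (u - x) powr p) = 0"
    unfolding set_lebesgue_integral_def
    by (intro integral_eq_zero_AE AE_I2) (use False in \<open>auto simp: indicator_def\<close>)
  moreover have "max (t - x) 0 = max (- x) 0" using False assms by auto
  ultimately show ?thesis by simp
qed

text \<open>Off the point c the function is locally either a smooth power or 0. Since
  \<open>0 powr q = 0\<close> for every q, the formula also holds on the side where the positive
  part vanishes.\<close>

lemma DERIV_max_powr:
  fixes c x r :: real
  assumes "x \<noteq> c"
  shows "((\<lambda>y. max (c - y) 0 powr r) has_real_derivative - (r * max (c - x) 0 powr (r - 1))) (at x)"
proof (cases "x < c")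
  case True
  have "((\<lambda>y. (c - y) powr r) has_real_derivative (r * (c - x) powr (r - of_nat 1) * (-1))) (at x)"
    using True by (intro DERIV_fun_powr) (auto intro!: derivative_eq_intros)
  then have "((\<lambda>y. (c - y) powr r) has_real_derivative - (r * max (c - x) 0 powr (r - 1))) (at x)"
    using True by simp
  then show ?thesis
    by (rule DERIV_cong_ev[THEN iffD1, rotated 3])
      (use True eventually_nhds_in_open[of "{..<c}" x] in \<open>auto elim!: eventually_mono\<close>)
next
  case False
  have "((\<lambda>y. 0) has_real_derivative 0) (at x)" by simp
  then have "((\<lambda>y. 0) has_real_derivative - (r * max (c - x) 0 powr (r - 1))) (at x)"
    using False assms by simp
  then show ?thesis
    by (rule DERIV_cong_ev[THEN iffD1, rotated 3])
      (use False assms eventually_nhds_in_open[of "{c<..}" x] in \<open>auto elim!: eventually_mono\<close>)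
qed

text \<open>
  Since \<open>0 powr 0 = 0\<close>, the power of a positive part is the indicator of \<open>(0, \<infinity>)\<close> for \<open>H = 1/2\<close>, so that
  the formula is uniform in \<open>H\<close>.
\<close>

definition fbm_kernel :: "real \<Rightarrow> real \<Rightarrow> real \<Rightarrow> real" where
  "fbm_kernel H t x = K_hurst H / Gamma (H + 1 / 2) *
     (max (t - x) 0 powr (H - 1 / 2) - max (- x) 0 powr (H - 1 / 2))"

lemma K_hurst_half: "K_hurst (1 / 2) = 1"
proof -
  have "(LBINT s:{0<..}. ((1 + s) powr (0::real) - s powr 0)\<^sup>2) = 0"
    unfolding set_lebesgue_integral_def
    by (intro integral_eq_zero_AE AE_I2) (auto simp: indicator_def)
  then show ?thesis by (simp add: K_hurst_def)
qed

text \<open>For H < 1/2 differentiation lowers the exponent 1 - \<sigma> to -\<sigma> = H - 1/2, and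
  the factor 1 - \<sigma> cancels; the points 0 and t, where the derivative may fail, form a null
  set. For H > 1/2 the factor 1 / \<sigma> from integration is absorbed by Gamma (\<sigma> + 1) =
  \<sigma> Gamma \<sigma>. In both cases the Gamma factor becomes Gamma (H + 1/2).\<close>

lemma M_minus_indicator:
  assumes H: "0 < H" "H < 1" and t: "0 \<le> t"
  shows "AE x in lborel. M_minus H (indicator {0..<t}) x = fbm_kernel H t x"
proof -
  consider "H < 1 / 2" | "H = 1 / 2" | "H > 1 / 2" by linarith
  then show ?thesis
  proof cases
    case 1
    define \<sigma> where "\<sigma> = 1 / 2 - H"
    let ?g = "\<lambda>y. (max (t - y) 0 powr (1 - \<sigma>) - max (0 - y) 0 powr (1 - \<sigma>)) / (1 - \<sigma>)"
    have \<sigma>: "0 < \<sigma>" "\<sigma> < 1" using 1 H by (auto simp: \<sigma>_def)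
    have g: "(\<lambda>y. LBINT u:{y<..}. indicator {0..<t} u * (u - y) powr (- \<sigma>)) = ?g"
      using integral_indicator_shifted_powr[OF t, of "- \<sigma>"] \<sigma> by (simp add: fun_eq_iff)
    have "M_minus H (indicator {0..<t}) x = fbm_kernel H t x" if "x \<noteq> 0" "x \<noteq> t" for x
    proof -
      have "(?g has_real_derivative (- ((1 - \<sigma>) * max (t - x) 0 powr (1 - \<sigma> - 1)) -
          - ((1 - \<sigma>) * max (0 - x) 0 powr (1 - \<sigma> - 1))) / (1 - \<sigma>)) (at x)"
        using that by (intro DERIV_cdivide DERIV_diff DERIV_max_powr) auto
      then have "deriv ?g x = (- ((1 - \<sigma>) * max (t - x) 0 powr (1 - \<sigma> - 1)) -
          - ((1 - \<sigma>) * max (0 - x) 0 powr (1 - \<sigma> - 1))) / (1 - \<sigma>)"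
        by (rule DERIV_imp_deriv)
      also have "\<dots> = - (max (t - x) 0 powr (- \<sigma>) - max (- x) 0 powr (- \<sigma>))"
        using \<sigma> by (simp add: field_simps)
      finally have "frac_deriv \<sigma> (indicator {0..<t}) x =
          1 / Gamma (1 - \<sigma>) * (max (t - x) 0 powr (- \<sigma>) - max (- x) 0 powr (- \<sigma>))"
        unfolding frac_deriv_def g by (simp add: diff_divide_distrib)
      moreover have "1 - \<sigma> = H + 1 / 2" "- \<sigma> = H - 1 / 2" by (auto simp: \<sigma>_def)
      ultimately show ?thesis
        using 1 by (simp add: M_minus_def fbm_kernel_def \<sigma>_def add.commute)
    qed
    then show ?thesis
      using AE_lborel_singleton[of 0] AE_lborel_singleton[of t] by auto
  next
    case 2
    have "M_minus H (indicator {0..<t}) x = fbm_kernel H t x" for x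
      using t by (auto simp: 2 M_minus_def fbm_kernel_def K_hurst_half indicator_def max_def)
    then show ?thesis by simp
  next
    case 3
    define \<sigma> where "\<sigma> = H - 1 / 2"
    have \<sigma>: "0 < \<sigma>" "\<sigma> < 1" using 3 H by (auto simp: \<sigma>_def)
    have "\<sigma> \<notin> \<int>\<^sub>\<le>\<^sub>0" using \<sigma> by (auto elim!: nonpos_Ints_cases)
    then have G: "Gamma (\<sigma> + 1) = \<sigma> * Gamma \<sigma>" by (rule Gamma_plus1)
    have "frac_integral \<sigma> (indicator {0..<t}) x =
        1 / Gamma (\<sigma> + 1) * (max (t - x) 0 powr \<sigma> - max (- x) 0 powr \<sigma>)" for x
      unfolding frac_integral_def
      using integral_indicator_shifted_powr[OF t, of "\<sigma> - 1" x] \<sigma>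
      by (simp add: G)
    moreover have "\<sigma> + 1 = H + 1 / 2" by (simp add: \<sigma>_def)
    ultimately have "M_minus H (indicator {0..<t}) x = fbm_kernel H t x" for x
      using 3 by (simp add: M_minus_def fbm_kernel_def \<sigma>_def add.commute)
    then show ?thesis by simp
  qed
qed

section \<open>Inner products and linear independence of the kernels\<close>

context
  fixes H :: real
  assumes H: "0 < H" "H < 1"
begin

private abbreviation "h \<equiv> H - 1 / 2"

text \<open>The squared norm of the kernel increment over a unit interval before normalization;
  \<open>1 / (2 * H)\<close> is the part from the unit interval itself, where only one of the two
  powers is present. \<open>K_hurst\<close> is designed to cancel this constant.\<close>

private definition C where
  "C = (LBINT s:{0<..}. ((1 + s) powr (H - 1 / 2) - s powr (H - 1 / 2))\<^sup>2) + 1 / (2 * H)"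

private lemma C_pos: "0 < C"
proof -
  have "0 \<le> (LBINT s:{0<..}. ((1 + s) powr h - s powr h)\<^sup>2)"
    unfolding set_lebesgue_integral_def by (intro integral_nonneg_AE AE_I2) auto
  moreover have "0 < 1 / (2 * H)" using H by simp
  ultimately show ?thesis unfolding C_def by linarith
qed

private lemma set_integrable_increment:
  "integrable lborel (\<lambda>r. indicator {0<..} r * ((1 + r) powr h - r powr h)\<^sup>2)"
proof (rule Bochner_Integration.integrable_bound)
  \<comment> \<open>Near 0 the estimate (a - b)^2 <= a^2 + b^2 for a, b >= 0 leaves r^(2h), with 2h
    > -1; the power of 1 + r is at most 2 there. Beyond 1 the mean value theorem gains one order and
    leaves r^(2h - 2), with 2h - 2 < -1.\<close>
  let ?w = "\<lambda>r. 2 * indicator {0..1} r + indicator {0<..<1} r * r powr (2 * h) + h\<^sup>2 * (indicator {1<..} r * r powr (2 * h - 2))"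
  show "integrable lborel ?w"
    using H by (intro Bochner_Integration.integrable_add integrable_mult_right integrable_powr_0_1 integrable_powr_1_infinity integrable_real_indicator) auto
  have "(indicator {0<..} r * ((1 + r) powr h - r powr h)\<^sup>2) \<le> ?w r" if r: "r \<noteq> 1" for r
  proof -
    consider "r \<le> 0" | "0 < r" "r < 1" | "1 < r" using r by linarith
    then show ?thesis
    proof cases
      case 1
      then show ?thesis by (auto simp: indicator_def)
    next
      case 2
      let ?a = "(1 + r) powr h" and ?b = "r powr h"
      have "(?a - ?b)\<^sup>2 \<le> ?a\<^sup>2 + ?b\<^sup>2"
        by (simp add: power2_diff)
      also have "?b\<^sup>2 = r powr (2 * h)"
        using 2 by (simp add: powr_power)
      also have "?a\<^sup>2 \<le> 2"
      proof (cases "0 \<le> h")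
        case True
        have "?a\<^sup>2 = (1 + r) powr (2 * h)" using 2 by (simp add: powr_power)
        also have "\<dots> \<le> (1 + r) powr 1" using 2 H True by (intro powr_mono) auto
        finally show ?thesis using 2 by simp
      next
        case False
        have "?a \<le> 1 powr h" using 2 False by (intro powr_mono2') auto
        then have "?a\<^sup>2 \<le> 1\<^sup>2" by (intro power_mono) auto
        then show ?thesis by simp
      qed
      finally show ?thesis using 2 by (simp add: indicator_def)
    next
      case 3
      have "\<exists>z>r. z < 1 + r \<and> (1 + r) powr h - r powr h = (1 + r - r) * (h * z powr (h - 1))"
        using 3 by (intro MVT2) (auto intro!: derivative_eq_intros has_real_derivative_powr)
      then obtain z where z: "r < z" "(1 + r) powr h - r powr h = h * z powr (h - 1)" by auto
      have "z powr (h - 1) \<le> r powr (h - 1)" using z 3 H by (intro powr_mono2') auto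
      then have "(z powr (h - 1))\<^sup>2 \<le> (r powr (h - 1))\<^sup>2" by (intro power_mono) auto
      also have "\<dots> = r powr (2 * h - 2)" using 3 by (simp add: powr_power algebra_simps)
      finally have "(h * z powr (h - 1))\<^sup>2 \<le> h\<^sup>2 * r powr (2 * h - 2)"
        unfolding power_mult_distrib by (intro mult_left_mono) auto
      then show ?thesis using 3 z by (simp add: indicator_def)
    qed
  qed
  then show "AE r in lborel. norm (indicator {0<..} r * ((1 + r) powr h - r powr h)\<^sup>2) \<le> norm (?w r)"
    using AE_lborel_singleton[of 1] by (auto elim!: eventually_mono)
qed measurable

private lemma has_bochner_integral_increment:
  "has_bochner_integral lborel (\<lambda>r. (max (1 + r) 0 powr h - max r 0 powr h)\<^sup>2) C"
proof -
  have 1: "has_bochner_integral lborel (\<lambda>r. indicator {0<..} r * ((1 + r) powr h - r powr h)\<^sup>2)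
      (LBINT s:{0<..}. ((1 + s) powr h - s powr h)\<^sup>2)"
    using set_integrable_increment by (simp add: has_bochner_integral_iff set_lebesgue_integral_def)
  have 2: "has_bochner_integral lborel (\<lambda>r. indicator {-1<..<0} r * (r - (-1)) powr (2 * h)) (1 / (2 * H))"
    using has_bochner_integral_shifted_powr[of "-1" "-1" 0 "2 * h"] H by simp
  have "has_bochner_integral lborel (\<lambda>r. indicator {0<..} r * ((1 + r) powr h - r powr h)\<^sup>2 +
      indicator {-1<..<0} r * (r - (-1)) powr (2 * h)) C"
    unfolding C_def by (rule has_bochner_integral_add[OF 1 2])
  moreover have "AE r in lborel. indicator {0<..} r * ((1 + r) powr h - r powr h)\<^sup>2 +
      indicator {-1<..<0} r * (r - (-1)) powr (2 * h) = (max (1 + r) 0 powr h - max r 0 powr h)\<^sup>2"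
    using AE_lborel_singleton[of 0]
    by eventually_elim (auto simp: indicator_def max_def powr_power add.commute)
  ultimately show ?thesis
    by (subst (asm) has_bochner_integral_cong_AE) auto
qed

text \<open>Substituting x = s - d r with d = t - s, homogeneity gives d^(2h) and the Jacobian one
  more d; this is d^(2H), as 2h + 1 = 2H.\<close>

private lemma has_bochner_integral_scaled_increment:
  assumes "s < t"
  shows "has_bochner_integral lborel (\<lambda>x. (max (t - x) 0 powr h - max (s - x) 0 powr h)\<^sup>2) ((t - s) powr (2 * H) * C)"
proof -
  define d where "d = t - s"
  have d: "0 < d" using assms by (simp add: d_def)
  let ?f = "\<lambda>x. (max (t - x) 0 powr h - max (s - x) 0 powr h)\<^sup>2"
  have scale: "max (d * y) 0 powr h = d powr h * max y 0 powr h" for y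
  proof -
    have "max (d * y) 0 = d * max y 0" using d by (auto simp: max_def zero_le_mult_iff mult_le_0_iff)
    then show ?thesis using d by (simp add: powr_mult)
  qed
  have "?f (s + - d * r) = d powr (2 * h) * (max (1 + r) 0 powr h - max r 0 powr h)\<^sup>2" for r
  proof -
    have "t - (s + - d * r) = d * (1 + r)" "s - (s + - d * r) = d * r"
      by (simp_all add: d_def algebra_simps)
    then have "?f (s + - d * r) = (d powr h * max (1 + r) 0 powr h - d powr h * max r 0 powr h)\<^sup>2"
      by (simp only: scale)
    also have "\<dots> = (d powr h)\<^sup>2 * (max (1 + r) 0 powr h - max r 0 powr h)\<^sup>2"
      by (simp add: power_mult_distrib flip: right_diff_distrib)
    also have "(d powr h)\<^sup>2 = d powr (2 * h)" using d by (simp add: powr_power)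
    finally show ?thesis .
  qed
  then have "has_bochner_integral lborel (\<lambda>r. ?f (s + - d * r)) (d powr (2 * h) * C)"
    using has_bochner_integral_mult_right[OF has_bochner_integral_increment, of "d powr (2 * h)"] by simp
  moreover have "d powr (2 * h) * C = (d powr (2 * H) * C) /\<^sub>R \<bar>- d\<bar>"
  proof -
    have "2 * h = 2 * H - 1" by simp
    then have "d powr (2 * h) = d powr (2 * H) / d" using d by (simp only: powr_diff) simp
    moreover have "x / d * C = (x * C) /\<^sub>R \<bar>- d\<bar>" for x using d by (simp add: field_simps)
    ultimately show ?thesis by metis
  qed
  ultimately have "has_bochner_integral lborel (\<lambda>r. ?f (s + - d * r)) ((d powr (2 * H) * C) /\<^sub>R \<bar>- d\<bar>)"
    by (simp only:)
  moreover have "- d \<noteq> 0" using d by simp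
  ultimately show ?thesis
    using lborel_has_bochner_integral_real_affine_iff[of "- d" ?f "d powr (2 * H) * C" s] unfolding d_def[symmetric] by blast
qed

private lemma K_hurst_sq: "(K_hurst H / Gamma (H + 1 / 2))\<^sup>2 * C = 1"
proof -
  have "K_hurst H = Gamma (H + 1 / 2) * C powr (- 1 / 2)" by (simp add: K_hurst_def C_def)
  moreover have "Gamma (H + 1 / 2) \<noteq> 0" using H Gamma_real_pos[of "H + 1 / 2"] by linarith
  ultimately have "(K_hurst H / Gamma (H + 1 / 2))\<^sup>2 = (C powr (- 1 / 2))\<^sup>2" by simp
  also have "\<dots> = C powr (- 1)" using C_pos by (simp add: powr_power)
  also have "\<dots> = inverse C" using C_pos by (simp add: powr_minus)
  finally show ?thesis using C_pos by simp
qed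

lemma fbm_kernel_const_nonzero: "K_hurst H / Gamma (H + 1 / 2) \<noteq> 0"
  using K_hurst_sq by (metis power_zero_numeral mult_zero_left zero_neq_one)

lemma has_bochner_integral_fbm_kernel_diff:
  "has_bochner_integral lborel (\<lambda>x. (fbm_kernel H t x - fbm_kernel H s x)\<^sup>2) (\<bar>t - s\<bar> powr (2 * H))"
proof -
  have less: "has_bochner_integral lborel (\<lambda>x. (fbm_kernel H t x - fbm_kernel H s x)\<^sup>2) (\<bar>t - s\<bar> powr (2 * H))"
    if "s < t" for s t
  proof -
    let ?c = "(K_hurst H / Gamma (H + 1 / 2))\<^sup>2"
    have "(fbm_kernel H t x - fbm_kernel H s x)\<^sup>2 = ?c * (max (t - x) 0 powr h - max (s - x) 0 powr h)\<^sup>2" for x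
      unfolding fbm_kernel_def power_mult_distrib[symmetric] by (simp add: algebra_simps)
    moreover have "\<bar>t - s\<bar> powr (2 * H) = ?c * ((t - s) powr (2 * H) * C)"
      using K_hurst_sq that by (simp add: mult.left_commute[of _ "(t - s) powr (2 * H)"])
    ultimately show ?thesis
      using has_bochner_integral_mult_right[OF has_bochner_integral_scaled_increment[OF that], of ?c] by simp
  qed
  consider "s < t" | "t = s" | "t < s" by linarith
  then show ?thesis
  proof cases
    case 3
    then show ?thesis using less[OF 3] by (simp add: power2_commute abs_minus_commute)
  qed (use less in auto)
qed

text \<open>Polarization. The kernel at time 0 vanishes, so the increment formula also gives the
  squared norms.\<close>

lemma has_bochner_integral_fbm_kernel_mult:
  "has_bochner_integral lborel (\<lambda>x. fbm_kernel H t x * fbm_kernel H s x)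
     (1 / 2 * (\<bar>t\<bar> powr (2 * H) + \<bar>s\<bar> powr (2 * H) - \<bar>t - s\<bar> powr (2 * H)))"
proof -
  have 0: "fbm_kernel H 0 x = 0" for x by (simp add: fbm_kernel_def)
  have sq: "has_bochner_integral lborel (\<lambda>x. (fbm_kernel H t x)\<^sup>2) (\<bar>t\<bar> powr (2 * H))" for t
    using has_bochner_integral_fbm_kernel_diff[of t 0] by (simp add: 0)
  have "fbm_kernel H t x * fbm_kernel H s x = 1 / 2 * ((fbm_kernel H t x)\<^sup>2 + (fbm_kernel H s x)\<^sup>2 - (fbm_kernel H t x - fbm_kernel H s x)\<^sup>2)" for x
    by (simp add: power2_diff)
  then show ?thesis
    using has_bochner_integral_mult_right[OF has_bochner_integral_diff[OF has_bochner_integral_add[OF sq[of t] sq[of s]]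
      has_bochner_integral_fbm_kernel_diff[of t s]], of "1 / 2"] by presburger
qed

lemma fbm_kernel_measurable [measurable]: "fbm_kernel H t \<in> borel_measurable borel"
  unfolding fbm_kernel_def by measurable

lemma has_bochner_integral_fbm_kernel_sum:
  fixes t v :: "'n::finite \<Rightarrow> real"
  shows "has_bochner_integral lborel (\<lambda>x. (\<Sum>i\<in>UNIV. v i * fbm_kernel H (t i) x)\<^sup>2)
    ((\<chi> i. v i) \<bullet> (fbm_cov H t *v (\<chi> i. v i)))"
proof -
  have "has_bochner_integral lborel (\<lambda>x. \<Sum>i\<in>UNIV. \<Sum>j\<in>UNIV. v i * v j * (fbm_kernel H (t i) x * fbm_kernel H (t j) x))
      (\<Sum>i\<in>UNIV. \<Sum>j\<in>UNIV. v i * v j * (1 / 2 * (\<bar>t i\<bar> powr (2 * H) + \<bar>t j\<bar> powr (2 * H) - \<bar>t i - t j\<bar> powr (2 * H))))"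
    by (intro has_bochner_integral_sum has_bochner_integral_mult_right has_bochner_integral_fbm_kernel_mult)
  moreover have "(\<Sum>i\<in>UNIV. \<Sum>j\<in>UNIV. v i * v j * (fbm_kernel H (t i) x * fbm_kernel H (t j) x)) =
      (\<Sum>i\<in>UNIV. v i * fbm_kernel H (t i) x)\<^sup>2" for x
    by (simp add: power2_eq_square sum_product mult_ac)
  moreover have "(\<Sum>i\<in>UNIV. \<Sum>j\<in>UNIV. v i * v j * (1 / 2 * (\<bar>t i\<bar> powr (2 * H) + \<bar>t j\<bar> powr (2 * H) - \<bar>t i - t j\<bar> powr (2 * H)))) =
      (\<chi> i. v i) \<bullet> (fbm_cov H t *v (\<chi> i. v i))"
    by (simp add: inner_vec_def matrix_vector_mult_def fbm_cov_def sum_distrib_left mult_ac)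
  ultimately show ?thesis by simp
qed

text \<open>A triangular structure: for k the last index with a non-zero coefficient, just to the
  left of \<open>t k\<close> all earlier kernels vanish while the kernel of \<open>t k\<close> does
  not. This interval has positive measure.\<close>

lemma fbm_kernel_independent:
  fixes t v :: "'n::{finite,linorder} \<Rightarrow> real"
  assumes t: "strict_mono t" "\<And>i. 0 < t i"
    and zero: "AE x in lborel. (\<Sum>i\<in>UNIV. v i * fbm_kernel H (t i) x) = 0"
  shows "v i = 0"
proof (rule ccontr)
  assume "v i \<noteq> 0"
  define k where "k = Max {i. v i \<noteq> 0}"
  have k: "v k \<noteq> 0" "\<And>j. k < j \<Longrightarrow> v j = 0"
  proof -
    have ne: "{i. v i \<noteq> 0} \<noteq> {}" using \<open>v i \<noteq> 0\<close> by auto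
    show "v k \<noteq> 0" using Max_in[OF _ ne] by (simp add: k_def)
    show "v j = 0" if "k < j" for j
      using that Max_ge[of "{i. v i \<noteq> 0}" j] by (fastforce simp: k_def)
  qed
  \<comment> \<open>Inserting 0 keeps x > a positive, so that the power of the positive part of -x
    vanishes too; it also serves the case without earlier times.\<close>
  define a where "a = Max (insert 0 (t ` {..<k}))"
  have a: "0 \<le> a" "a < t k" "\<And>j. j < k \<Longrightarrow> t j \<le> a"
    unfolding a_def using t by (auto simp: strict_mono_less)
  have nz: "(\<Sum>i\<in>UNIV. v i * fbm_kernel H (t i) x) \<noteq> 0" if x: "a < x" "x < t k" for x
  proof -
    have "v j * fbm_kernel H (t j) x = 0" if "j \<noteq> k" for j
    proof (cases "j < k")
      case True
      then show ?thesis using a(1) a(3)[OF True] x by (simp add: fbm_kernel_def)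
    next
      case False
      then show ?thesis using k(2)[of j] that by simp
    qed
    then have "(\<Sum>i\<in>UNIV. v i * fbm_kernel H (t i) x) = (\<Sum>i\<in>{k}. v i * fbm_kernel H (t i) x)"
      by (intro sum.mono_neutral_right) auto
    also have "\<dots> = v k * (K_hurst H / Gamma (H + 1 / 2) * (t k - x) powr h)"
      using a x by (simp add: fbm_kernel_def)
    also have "\<dots> \<noteq> 0"
      using k fbm_kernel_const_nonzero x by simp
    finally show ?thesis .
  qed
  have "AE x in lborel. x \<notin> {a<..<t k}"
    using zero by eventually_elim (use nz in auto)
  then have "emeasure lborel {a<..<t k} = 0"
    by (subst (asm) AE_iff_measurable[of "{a<..<t k}"]) auto
  then show False using a by simp
qed

end

section \<open>Uniqueness of characteristic functions of random vectors\<close>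

text \<open>Levy's uniqueness theorem for the images of the finite measures with density
  \<open>g\<close>. They are normalized by their common mass, obtained from u = 0; if the mass is 0,
  then \<open>g\<close> vanishes almost everywhere and both sides are 0.\<close>

lemma weighted_marginal_eq:
  fixes f g :: "'a \<Rightarrow> real"
  assumes M: "prob_space M" and N: "prob_space N"
    and [measurable]: "f \<in> borel_measurable M" "f \<in> borel_measurable N"
    and g: "\<And>x. 0 \<le> g x" "integrable M g" "integrable N g"
    and char: "\<And>u. (CLINT x|M. of_real (g x) * iexp (u * f x)) =
      (CLINT x|N. of_real (g x) * iexp (u * f x))"
    and A: "A \<in> sets borel"
  shows "(LINT x|M. g x * indicator A (f x)) = (LINT x|N. g x * indicator A (f x))"
proof -
  define m where "m = (LINT x|M. g x)"
  have "complex_of_real (LINT x|M. g x) = of_real (LINT x|N. g x)"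
    using char[of 0] by (simp flip: integral_complex_of_real)
  then have m_N: "m = (LINT x|N. g x)" by (simp add: m_def)
  have m0: "0 \<le> m" unfolding m_def using g by simp
  show ?thesis
  proof (cases "m = 0")
    case True
    have zero: "(LINT x|L. g x * indicator A (f x)) = 0" if "integrable L g" "(LINT x|L. g x) = 0" for L
    proof -
      have "AE x in L. g x = 0" using integral_nonneg_eq_0_iff_AE[OF that(1)] that(2) g(1) by simp
      then show ?thesis by (intro integral_eq_zero_AE) auto
    qed
    show ?thesis using zero[OF g(2)] zero[OF g(3)] True m_N by (simp add: m_def)
  next
    case False
    with m0 have m: "0 < m" by simp
    define D where "D = (\<lambda>L. distr (density L (\<lambda>x. ennreal (g x / m))) borel f)"
    have D: "real_distribution (D L)"
      "char (D L) u = (CLINT x|L. of_real (g x) * iexp (u * f x)) / m"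
      "Sigma_Algebra.measure (D L) A = (LINT x|L. g x * indicator A (f x)) / m"
      if "prob_space L" and [measurable]: "f \<in> borel_measurable L" and int: "integrable L g" and Lm: "(LINT x|L. g x) = m" for L u
    proof -
      have [measurable]: "g \<in> borel_measurable L" using int by simp
      have "(\<integral>\<^sup>+x. ennreal (g x / m) \<partial>L) = ennreal (LINT x|L. g x / m)"
        using g(1) m int by (intro nn_integral_eq_integral) auto
      moreover have "emeasure (density L (\<lambda>x. ennreal (g x / m))) (space L) = (\<integral>\<^sup>+x. ennreal (g x / m) \<partial>L)"
        by (subst emeasure_density) (auto intro!: nn_integral_cong)
      ultimately have "emeasure (density L (\<lambda>x. ennreal (g x / m))) (space L) = 1"
        using m Lm by simp
      then interpret P: prob_space "density L (\<lambda>x. ennreal (g x / m))"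
        by (intro prob_spaceI) simp
      show rd: "real_distribution (D L)"
        unfolding D_def real_distribution_def real_distribution_axioms_def
        by (intro conjI P.prob_space_distr) auto
      have "char (D L) u = (CLINT x|L. of_real (g x / m) * iexp (u * f x))"
        unfolding char_def D_def using g(1) m
        by (simp add: integral_distr integral_density scaleR_conv_of_real)
      also have "\<dots> = (CLINT x|L. of_real (g x) * iexp (u * f x) / m)"
        by (intro Bochner_Integration.integral_cong) auto
      finally show "char (D L) u = (CLINT x|L. of_real (g x) * iexp (u * f x)) / m"
        by simp
      interpret R: real_distribution "D L" by (rule rd)
      have "Sigma_Algebra.measure (D L) A = (LINT x|D L. indicator A x)"
        using A by simp
      also have "\<dots> = (LINT x|density L (\<lambda>x. ennreal (g x / m)). indicator A (f x))"
        unfolding D_def using A by (intro integral_distr) auto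
      also have "\<dots> = (LINT x|L. g x / m * indicator A (f x))"
        using g(1) m A by (subst integral_density) auto
      finally show "Sigma_Algebra.measure (D L) A = (LINT x|L. g x * indicator A (f x)) / m"
        by simp
    qed
    have "char (D M) = char (D N)"
      using D(2)[OF M _ g(2)] D(2)[OF N _ g(3)] m_N char by (auto simp: m_def fun_eq_iff)
    then have "D M = D N"
      using D(1)[OF M _ g(2)] D(1)[OF N _ g(3)] m_N by (intro Levy_uniqueness) (auto simp: m_def)
    then show ?thesis
      using D(3)[OF M _ g(2)] D(3)[OF N _ g(3)] m_N m by (auto simp: m_def)
  qed
qed

text \<open>
  The one-dimensional uniqueness theorem is applied to one coordinate at a time: the weights
  \<open>1 + cos \<theta>\<close> and \<open>1 + sin \<theta>\<close> are non-negative and recover \<open>exp (\<i> \<theta>)\<close> by linearity.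
\<close>

lemma char_vec_marginals:
  fixes M N :: "(real^'n) measure" and S :: "'n::finite set"
  assumes M: "prob_space M" "sets M = sets borel" and N: "prob_space N" "sets N = sets borel"
    and char: "\<And>v. (CLINT x|M. iexp (v \<bullet> x)) = (CLINT x|N. iexp (v \<bullet> x))"
    and A: "\<And>i. A i \<in> sets borel"
  shows "(CLINT x|M. of_real (\<Prod>i\<in>S. indicator (A i) (x $ i)) * iexp (\<Sum>i\<in>-S. v i * x $ i)) =
         (CLINT x|N. of_real (\<Prod>i\<in>S. indicator (A i) (x $ i)) * iexp (\<Sum>i\<in>-S. v i * x $ i))"
  using finite[of S]
proof (induction S arbitrary: v rule: finite_induct)
  case empty
  show ?case using char[of "\<chi> i. v i"] by (simp add: inner_vec_def)
next
  case (insert k S)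
  interpret M: prob_space M by (rule M)
  interpret N: prob_space N by (rule N)
  note [measurable_cong] = M(2) N(2)
  note [measurable] = A
  define p where "p = (\<lambda>x::real^'n. \<Prod>i\<in>S. indicator (A i) (x $ i) :: real)"
  define \<theta> where "\<theta> = (\<lambda>x::real^'n. \<Sum>i\<in>- insert k S. v i * x $ i)"
  have p: "0 \<le> p x" "p x \<le> 1" for x unfolding p_def by (auto intro!: prod_nonneg prod_le_1)
  have [measurable]: "p \<in> borel_measurable borel" "\<theta> \<in> borel_measurable borel"
    unfolding p_def \<theta>_def by measurable
  \<comment> \<open>The coordinate \<open>k\<close> keeps a free frequency u, while the phase of the
    remaining ones is scaled by e; the values 0, 1 and -1 of e are used below.\<close>
  have IH: "(CLINT x|M. of_real (p x) * iexp (u * x $ k + e * \<theta> x)) =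
      (CLINT x|N. of_real (p x) * iexp (u * x $ k + e * \<theta> x))" for u e :: real
  proof -
    have "- S = insert k (- insert k S)" using insert.hyps by auto
    then have "(\<Sum>i\<in>-S. (if i = k then u else e * v i) * x $ i) = u * x $ k + e * \<theta> x" for x
      unfolding \<theta>_def by (simp add: sum_distrib_left mult.assoc)
    then show ?thesis
      using insert.IH[of "\<lambda>i. if i = k then u else e * v i"] unfolding p_def by simp
  qed
  have intp: "integrable L (\<lambda>x. of_real (p x) * iexp (u * x $ k + e * \<theta> x))"
    if "prob_space L" and [measurable_cong]: "sets L = sets borel" for L and u e :: real
  proof -
    interpret L: prob_space L by (rule that)
    show ?thesis
      by (rule L.integrable_const_bound[where B = 1]) (auto simp: norm_mult p)
  qed
  have intr: "integrable L (\<lambda>x. p x * q x)" if "prob_space L" and [measurable_cong]: "sets L = sets borel"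
    and [measurable]: "q \<in> borel_measurable borel" and "\<And>x. \<bar>q x\<bar> \<le> 2" for L q
  proof -
    interpret L: prob_space L by (rule that)
    have "\<bar>p x\<bar> * \<bar>q x\<bar> \<le> 1 * 2" for x
      using p that(4) by (intro mult_mono) auto
    then have "norm (p x * q x) \<le> 2" for x by (simp add: abs_mult)
    then show ?thesis
      by (intro L.integrable_const_bound[where B = 2] AE_I2) auto
  qed
  define J where "J = (\<lambda>L q. LINT x|L. p x * q x * indicator (A k) (x $ k))"
  \<comment> \<open>A weight that is a trigonometric polynomial in \<open>\<theta>\<close> splits
    the characteristic integral into three instances of \<open>IH\<close>.\<close>
  have comb: "J M q = J N q"
    if q: "\<And>x. 0 \<le> q x" "\<And>x. \<bar>q x\<bar> \<le> 2" and [measurable]: "q \<in> borel_measurable borel"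
      and eq: "\<And>x. complex_of_real (q x) = a + b * iexp (\<theta> x) + c * iexp (- \<theta> x)"
    for q a b c
    unfolding J_def
  proof (rule weighted_marginal_eq[OF M(1) N(1)])
    fix u :: real
    have split: "of_real (p x * q x) * iexp (u * x $ k) =
        a * (of_real (p x) * iexp (u * x $ k + 0 * \<theta> x)) +
        b * (of_real (p x) * iexp (u * x $ k + 1 * \<theta> x)) +
        c * (of_real (p x) * iexp (u * x $ k + - 1 * \<theta> x))" for x
      unfolding of_real_mult eq of_real_add ring_distribs exp_add by (simp add: algebra_simps exp_minus)
    have "(CLINT x|L. of_real (p x * q x) * iexp (u * x $ k)) =
        a * (CLINT x|L. of_real (p x) * iexp (u * x $ k + 0 * \<theta> x)) +
        b * (CLINT x|L. of_real (p x) * iexp (u * x $ k + 1 * \<theta> x)) +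
        c * (CLINT x|L. of_real (p x) * iexp (u * x $ k + - 1 * \<theta> x))"
      if L: "prob_space L" "sets L = sets borel" for L
      unfolding split using intp[OF L]
      by (simp only: Bochner_Integration.integral_add Bochner_Integration.integrable_add
          integrable_mult_right integral_mult_right_zero simp_thms)
    from this[OF M] this[OF N] show "(CLINT x|M. of_real (p x * q x) * iexp (u * x $ k)) =
        (CLINT x|N. of_real (p x * q x) * iexp (u * x $ k))"
      by (simp only: IH)
  qed (use q p A M N intr in auto)
  \<comment> \<open>The constant weight is treated on its own, as it has to be subtracted again from
    \<open>1 + cos\<close> and \<open>1 + sin\<close>.\<close>
  have c0: "J M (\<lambda>x. 1) = J N (\<lambda>x. 1)"
    by (rule comb[of "\<lambda>_. 1" 1 0 0]) auto
  have c1: "J M (\<lambda>x. 1 + cos (\<theta> x)) = J N (\<lambda>x. 1 + cos (\<theta> x))"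
  proof (rule comb[of _ 1 "1 / 2" "1 / 2"])
    show "0 \<le> 1 + cos (\<theta> x)" for x using cos_ge_minus_one[of "\<theta> x"] by linarith
    show "\<bar>1 + cos (\<theta> x)\<bar> \<le> 2" for x using cos_ge_minus_one[of "\<theta> x"] cos_le_one[of "\<theta> x"] by linarith
    show "complex_of_real (1 + cos (\<theta> x)) = 1 + 1 / 2 * iexp (\<theta> x) + 1 / 2 * iexp (- \<theta> x)" for x
      by (simp add: complex_eq_iff Re_exp Im_exp)
  qed measurable
  have c2: "J M (\<lambda>x. 1 + sin (\<theta> x)) = J N (\<lambda>x. 1 + sin (\<theta> x))"
  \<comment> \<open>Euler's formula: sin \<theta> = (exp (i \<theta>) - exp (-i \<theta>)) / (2i),
    and 1 / (2i) = -i/2.\<close>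
  proof (rule comb[of _ 1 "- \<i> / 2" "\<i> / 2"])
    show "0 \<le> 1 + sin (\<theta> x)" for x using sin_ge_minus_one[of "\<theta> x"] by linarith
    show "\<bar>1 + sin (\<theta> x)\<bar> \<le> 2" for x using sin_ge_minus_one[of "\<theta> x"] sin_le_one[of "\<theta> x"] by linarith
    show "complex_of_real (1 + sin (\<theta> x)) = 1 + - \<i> / 2 * iexp (\<theta> x) + \<i> / 2 * iexp (- \<theta> x)" for x
      by (simp add: complex_eq_iff Re_exp Im_exp)
  qed measurable
  have split: "(CLINT x|L. of_real (\<Prod>i\<in>insert k S. indicator (A i) (x $ i)) * iexp (\<Sum>i\<in>- insert k S. v i * x $ i)) =
      of_real (J L (\<lambda>x. 1 + cos (\<theta> x)) - J L (\<lambda>x. 1)) +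
      \<i> * of_real (J L (\<lambda>x. 1 + sin (\<theta> x)) - J L (\<lambda>x. 1))"
    if L: "prob_space L" and [measurable_cong]: "sets L = sets borel" for L
  proof -
    interpret L: prob_space L by (rule that)
    have int: "integrable L (\<lambda>x. p x * q x * indicator (A k) (x $ k))" if [measurable]: "q \<in> borel_measurable borel" and "\<And>x. \<bar>q x\<bar> \<le> 2" for q
      using intr[of L "\<lambda>x. q x * indicator (A k) (x $ k)"] that L \<open>sets L = sets borel\<close> by (simp add: mult.assoc indicator_def)
    have i0: "integrable L (\<lambda>x. p x * 1 * indicator (A k) (x $ k))" by (rule int) auto
    have i1: "integrable L (\<lambda>x. p x * (1 + cos (\<theta> x)) * indicator (A k) (x $ k))"
    proof (rule int)
      show "\<bar>1 + cos (\<theta> x)\<bar> \<le> 2" for x using cos_ge_minus_one[of "\<theta> x"] cos_le_one[of "\<theta> x"] by linarith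
    qed measurable
    have i2: "integrable L (\<lambda>x. p x * (1 + sin (\<theta> x)) * indicator (A k) (x $ k))"
    proof (rule int)
      show "\<bar>1 + sin (\<theta> x)\<bar> \<le> 2" for x using sin_ge_minus_one[of "\<theta> x"] sin_le_one[of "\<theta> x"] by linarith
    qed measurable
    have "of_real (\<Prod>i\<in>insert k S. indicator (A i) (x $ i)) * iexp (\<Sum>i\<in>- insert k S. v i * x $ i) =
        complex_of_real (p x * (1 + cos (\<theta> x)) * indicator (A k) (x $ k) - p x * 1 * indicator (A k) (x $ k)) +
        \<i> * of_real (p x * (1 + sin (\<theta> x)) * indicator (A k) (x $ k) - p x * 1 * indicator (A k) (x $ k))" for x
    proof -
      have th: "(\<Sum>i\<in>- insert k S. v i * x $ i) = \<theta> x" by (simp add: \<theta>_def)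
      have 1: "iexp (\<theta> x) = of_real (cos (\<theta> x)) + \<i> * of_real (sin (\<theta> x))"
        by (simp add: complex_eq_iff Re_exp Im_exp)
      have 2: "(\<Prod>i\<in>insert k S. indicator (A i) (x $ i)) = indicator (A k) (x $ k) * p x"
        using insert.hyps by (simp add: p_def)
      show ?thesis unfolding th 1 2 by (simp add: algebra_simps)
    qed
    then show ?thesis
      unfolding J_def using i0 i1 i2 by (simp only: Bochner_Integration.integral_add Bochner_Integration.integral_diff
        Bochner_Integration.integrable_diff integrable_of_real integral_complex_of_real integrable_mult_right integral_mult_right_zero)
  qed
  show ?case unfolding split[OF M] split[OF N] c0 c1 c2 ..
qed

text \<open>Once every coordinate has been localized no frequency is left, and the marginal identity
  compares the measures of open boxes, an intersection-stable generator.\<close>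

theorem char_vec_uniqueness:
  fixes M N :: "(real^'n::finite) measure"
  assumes M: "prob_space M" "sets M = sets borel" and N: "prob_space N" "sets N = sets borel"
    and char: "\<And>v. (CLINT x|M. iexp (v \<bullet> x)) = (CLINT x|N. iexp (v \<bullet> x))"
  shows "M = N"
proof -
  interpret M: prob_space M by (rule M)
  interpret N: prob_space N by (rule N)
  have box_eq: "emeasure M (box a b) = emeasure N (box a b)" for a b
  proof -
    let ?A = "\<lambda>i. {a $ i<..<b $ i}"
    have ind: "(\<Prod>i\<in>UNIV. indicator (?A i) (x $ i)) = (indicator (box a b) x :: real)" for x :: "real^'n"
      by (auto simp: indicator_def mem_box_cart)
    have "complex_of_real (Sigma_Algebra.measure L (box a b)) =
        (CLINT x|L. of_real (\<Prod>i\<in>UNIV. indicator (?A i) (x $ i)) * iexp (\<Sum>i\<in>-UNIV. 0 * x $ i))"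
      if "sets L = sets borel" for L
      using that by (simp add: ind)
    from this[OF M(2)] this[OF N(2)] have "complex_of_real (Sigma_Algebra.measure M (box a b)) = of_real (Sigma_Algebra.measure N (box a b))"
      using char_vec_marginals[OF M N char, of ?A UNIV "\<lambda>_. 0"] by simp
    then show ?thesis by (simp add: M.emeasure_eq_measure N.emeasure_eq_measure)
  qed
  let ?E = "range (\<lambda>(a, b). box a b :: (real^'n) set)"
  show ?thesis
  proof (rule measure_eqI_generator_eq)
    show "Int_stable ?E"
      by (auto simp: Int_stable_def box_Int_box)
    show "?E \<subseteq> Pow UNIV" "sets M = sigma_sets UNIV ?E" "sets N = sigma_sets UNIV ?E"
      by (simp_all add: borel_eq_box M N)
    let ?A = "\<lambda>n::nat. box (- (real n *\<^sub>R One)) (real n *\<^sub>R One) :: (real^'n) set"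
    show "range ?A \<subseteq> ?E" "(\<Union>i. ?A i) = UNIV"
      unfolding UN_box_eq_UNIV by auto
    show "emeasure M (?A i) \<noteq> \<infinity>" for i by simp
    show "emeasure M X = emeasure N X" if "X \<in> ?E" for X using that box_eq by auto
  qed
qed

section \<open>Multivariate Gaussian densities\<close>

lemma lborel_integral_prod:
  fixes F :: "'a::euclidean_space \<Rightarrow> real \<Rightarrow> complex"
  assumes F: "\<And>b. b \<in> Basis \<Longrightarrow> integrable lborel (F b)"
  shows "has_bochner_integral lborel (\<lambda>x. \<Prod>b\<in>Basis. F b (x \<bullet> b)) (\<Prod>b\<in>Basis. LINT x|lborel. F b x)"
proof -
  interpret product_sigma_finite "\<lambda>b::'a. lborel :: real measure"
    by (simp add: product_sigma_finite_def sigma_finite_lborel)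
  have [measurable]: "F b \<in> borel_measurable borel" if "b \<in> Basis" for b using F[OF that] by simp
  let ?T = "\<lambda>f. \<Sum>b\<in>Basis. f b *\<^sub>R b :: 'a"
  have T: "?T \<in> measurable (\<Pi>\<^sub>M b\<in>Basis. lborel) borel" by measurable
  have eq: "(\<Prod>b\<in>Basis. F b (?T f \<bullet> b)) = (\<Prod>b\<in>Basis. F b (f b))" for f
    by (intro prod.cong) (auto simp: inner_sum_left inner_Basis if_distrib sum.delta cong: if_cong)
  have "integrable (\<Pi>\<^sub>M b\<in>Basis. lborel) (\<lambda>f. \<Prod>b\<in>Basis. F b (f b))"
    by (rule product_integrable_prod) (use F in auto)
  moreover have "integral\<^sup>L (\<Pi>\<^sub>M b\<in>Basis. lborel) (\<lambda>f. \<Prod>b\<in>Basis. F b (f b)) = (\<Prod>b\<in>Basis. LINT x|lborel. F b x)"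
    by (rule product_integral_prod) (use F in auto)
  ultimately have "has_bochner_integral (\<Pi>\<^sub>M b\<in>Basis. lborel) (\<lambda>f. \<Prod>b\<in>Basis. F b (?T f \<bullet> b)) (\<Prod>b\<in>Basis. LINT x|lborel. F b x)"
    unfolding eq by (simp add: has_bochner_integral_iff)
  then show ?thesis
    by (subst lborel_eq) (subst has_bochner_integral_distr[OF _ T], auto simp: has_bochner_integral_iff)
qed

lemma sum_Basis_square: "(\<Sum>b\<in>Basis. - (v \<bullet> b)\<^sup>2 / 2) = - (v \<bullet> v) / 2"
  unfolding euclidean_inner[of v v]
  by (simp add: power2_eq_square sum_negf sum_divide_distrib del: inner_Basis)

lemma matrix_vector_mult_measurable [measurable]:
  fixes T :: "real^'n^'m"
  shows "(*v) T \<in> borel_measurable borel"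
  by (intro borel_measurable_continuous_onI linear_continuous_on matrix_vector_mul_bounded_linear)

definition std_gauss :: "'a::euclidean_space \<Rightarrow> real" where
  "std_gauss x = (\<Prod>b\<in>Basis. std_normal_density (x \<bullet> b))"

lemma std_gauss_measurable [measurable]: "std_gauss \<in> borel_measurable borel"
  unfolding std_gauss_def by measurable

lemma std_gauss_nonneg: "0 \<le> std_gauss x"
  unfolding std_gauss_def by (intro prod_nonneg) auto

lemma std_gauss_eq:
  fixes x :: "'a::euclidean_space"
  shows "std_gauss x = exp (- (x \<bullet> x) / 2) / (2 * pi) powr (real DIM('a) / 2)"
proof -
  have "std_gauss x = (\<Prod>b\<in>Basis. exp (- (x \<bullet> b)\<^sup>2 / 2) / sqrt (2 * pi))"
    unfolding std_gauss_def by (intro prod.cong refl) (simp add: std_normal_density_def)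
  also have "\<dots> = exp (\<Sum>b\<in>Basis. - (x \<bullet> b)\<^sup>2 / 2) / sqrt (2 * pi) ^ DIM('a)"
    by (simp add: prod_dividef exp_sum)
  also have "(\<Sum>b\<in>Basis. - (x \<bullet> b)\<^sup>2 / 2) = - (x \<bullet> x) / 2"
    by (rule sum_Basis_square)
  also have "sqrt (2 * pi) ^ DIM('a) = (2 * pi) powr (real DIM('a) / 2)"
    by (simp add: powr_half_sqrt[symmetric] powr_power)
  finally show ?thesis .
qed

lemma std_gauss_char:
  fixes v :: "'a::euclidean_space"
  shows "has_bochner_integral lborel (\<lambda>x. of_real (std_gauss x) * iexp (v \<bullet> x)) (of_real (exp (- (v \<bullet> v) / 2)))"
proof -
  let ?F = "\<lambda>b x. complex_of_real (std_normal_density x) * iexp ((v \<bullet> b) * x)"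
  have F: "has_bochner_integral lborel (?F b) (of_real (exp (- (v \<bullet> b)\<^sup>2 / 2)))" for b
  proof -
    interpret real_distribution std_normal_distribution by (rule real_dist_normal_dist)
    have "integrable std_normal_distribution (\<lambda>x. iexp ((v \<bullet> b) * x))"
      by (rule integrable_const_bound[where B = 1]) auto
    then have "integrable lborel (?F b)"
      by (subst (asm) integrable_density) (auto simp: scaleR_conv_of_real)
    moreover have "(LINT x|lborel. ?F b x) = char std_normal_distribution (v \<bullet> b)"
      unfolding char_def by (subst integral_density) (auto simp: scaleR_conv_of_real)
    ultimately show ?thesis
      by (simp add: has_bochner_integral_iff char_std_normal_distribution)
  qed
  have "has_bochner_integral lborel (\<lambda>x. \<Prod>b\<in>Basis. ?F b (x \<bullet> b)) (\<Prod>b\<in>Basis. LINT x|lborel. ?F b x)"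
    by (rule lborel_integral_prod) (use F in \<open>simp add: has_bochner_integral_iff\<close>)
  moreover have "(\<Prod>b\<in>Basis. LINT x|lborel. ?F b x) = of_real (exp (- (v \<bullet> v) / 2))"
  proof -
    have "(\<Prod>b\<in>Basis. LINT x|lborel. ?F b x) = (\<Prod>b\<in>Basis. of_real (exp (- (v \<bullet> b)\<^sup>2 / 2)))"
      by (intro prod.cong has_bochner_integral_integral_eq F refl)
    also have "\<dots> = of_real (exp (\<Sum>b\<in>Basis. - (v \<bullet> b)\<^sup>2 / 2))"
      by (simp add: exp_sum)
    also have "(\<Sum>b\<in>Basis. - (v \<bullet> b)\<^sup>2 / 2) = - (v \<bullet> v) / 2"
      by (rule sum_Basis_square)
    finally show ?thesis .
  qed
  moreover have "(\<Prod>b\<in>Basis. ?F b (x \<bullet> b)) = of_real (std_gauss x) * iexp (v \<bullet> x)" for x :: 'a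
  proof -
    have "v \<bullet> x = (\<Sum>b\<in>Basis. (v \<bullet> b) * (x \<bullet> b))" by (rule euclidean_inner)
    then show ?thesis by (simp add: prod.distrib std_gauss_def sum_distrib_left exp_sum)
  qed
  ultimately show ?thesis by simp
qed

text \<open>The total mass is the characteristic function at 0.\<close>

lemma prob_space_std_gauss: "prob_space (density lborel (\<lambda>x::'a::euclidean_space. ennreal (std_gauss x)))"
proof
  have "has_bochner_integral lborel (\<lambda>x::'a. complex_of_real (std_gauss x)) (of_real 1)"
    using std_gauss_char[of "0::'a"] by simp
  then have "has_bochner_integral lborel (\<lambda>x::'a. std_gauss x) 1"
    by (simp add: has_bochner_integral_iff complex_of_real_integrable_eq)
  then have "integral\<^sup>N lborel (\<lambda>x::'a. ennreal (std_gauss x)) = 1"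
    using nn_integral_eq_integral[of lborel "std_gauss :: 'a \<Rightarrow> real"] std_gauss_nonneg
    by (auto simp: has_bochner_integral_iff)
  then show "emeasure (density lborel (\<lambda>x::'a. ennreal (std_gauss x))) (space (density lborel (\<lambda>x::'a. ennreal (std_gauss x)))) = 1"
    by (simp add: emeasure_density)
qed

section \<open>Factorization of positive definite matrices\<close>

lemma inner_matrix_vector: "v \<bullet> (A *v x) = (transpose A *v v) \<bullet> x" for A :: "real^'n^'m"
  by (simp add: dot_lmul_matrix transpose_matrix_vector)

text \<open>Gram-Schmidt for the inner product given by \<open>Q\<close>: as long as k is below the
  dimension there is a vector outside the span, and its component orthogonal to \<open>S\<close> is
  non-zero and can be normalized by positivity.\<close>

lemma orthonormal_system_posdef:
  fixes Q :: "real^'n^'n"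
  assumes sym: "transpose Q = Q" and pos: "\<And>v. v \<noteq> 0 \<Longrightarrow> 0 < v \<bullet> (Q *v v)" and "k \<le> CARD('n)"
  shows "\<exists>S. finite S \<and> card S = k \<and> (\<forall>x\<in>S. \<forall>y\<in>S. x \<bullet> (Q *v y) = (if x = y then 1 else 0))"
  using assms(3)
proof (induction k)
  case 0
  then show ?case by (intro exI[of _ "{}"]) auto
next
  case (Suc k)
  then obtain S where S: "finite S" "card S = k"
    and orth: "\<And>x y. x \<in> S \<Longrightarrow> y \<in> S \<Longrightarrow> x \<bullet> (Q *v y) = (if x = y then 1 else 0)"
    by force
  have comm: "x \<bullet> (Q *v y) = y \<bullet> (Q *v x)" for x y
    unfolding inner_matrix_vector[of x] sym by (rule inner_commute)
  have "dim S \<le> k" using dim_le_card'[OF S(1)] S(2) by simp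
  then have "dim (span S) < DIM(real^'n)" using Suc.prems by simp
  then have "span S \<noteq> UNIV" by (metis dim_UNIV less_irrefl)
  then obtain w where w: "w \<notin> span S" by auto
  define w' where "w' = w - (\<Sum>b\<in>S. (b \<bullet> (Q *v w)) *\<^sub>R b)"
  have "w' \<noteq> 0"
  proof
    assume "w' = 0"
    then have "w = (\<Sum>b\<in>S. (b \<bullet> (Q *v w)) *\<^sub>R b)" by (simp add: w'_def)
    also have "\<dots> \<in> span S" by (intro span_sum span_mul span_base)
    finally show False using w by simp
  qed
  have w'_orth: "a \<bullet> (Q *v w') = 0" if a: "a \<in> S" for a
  proof -
    have "a \<bullet> (Q *v w') = a \<bullet> (Q *v w) - (\<Sum>b\<in>S. (b \<bullet> (Q *v w)) * (a \<bullet> (Q *v b)))"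
      by (simp add: w'_def matrix_vector_mult_diff_distrib inner_diff_right linear_sum[OF matrix_vector_mul_linear]
          inner_sum_right matrix_vector_mult_scaleR)
    also have "(\<Sum>b\<in>S. (b \<bullet> (Q *v w)) * (a \<bullet> (Q *v b))) = (\<Sum>b\<in>S. if b = a then b \<bullet> (Q *v w) else 0)"
      by (intro sum.cong) (use orth a in auto)
    also have "\<dots> = a \<bullet> (Q *v w)" using S a by simp
    finally show ?thesis by simp
  qed
  define r where "r = sqrt (w' \<bullet> (Q *v w'))"
  define u where "u = w' /\<^sub>R r"
  have r: "0 < r" "r\<^sup>2 = w' \<bullet> (Q *v w')" using pos[OF \<open>w' \<noteq> 0\<close>] by (simp_all add: r_def)
  have u1: "u \<bullet> (Q *v u) = 1"
    using r(1) by (simp add: u_def matrix_vector_mult_scaleR r(2)[symmetric] power2_eq_square) (simp add: field_simps)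
  have u_orth: "a \<bullet> (Q *v u) = 0" if "a \<in> S" for a
    using w'_orth[OF that] by (simp add: u_def matrix_vector_mult_scaleR)
  have "u \<notin> S" using u1 u_orth[of u] by auto
  moreover have "u \<bullet> (Q *v a) = 0" if "a \<in> S" for a
    using comm[of u a] u_orth[OF that] by (rule trans)
  ultimately show ?case
    using S orth u1 u_orth by (intro exI[of _ "insert u S"]) auto
qed

text \<open>Let the columns of R be a Q-orthonormal basis, so R^T Q R = 1. Then T = Q R has the
  inverse R^T, and T T^T = T R^T Q = Q.\<close>

lemma posdef_factorization:
  fixes Q :: "real^'n^'n"
  assumes sym: "transpose Q = Q" and pos: "\<And>v. v \<noteq> 0 \<Longrightarrow> 0 < v \<bullet> (Q *v v)"
  obtains T P :: "real^'n^'n" where "P ** T = mat 1" "T ** P = mat 1" "Q = T ** transpose T"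
proof -
  obtain S where S: "finite S" "card S = CARD('n)"
    and orth: "\<And>x y. x \<in> S \<Longrightarrow> y \<in> S \<Longrightarrow> x \<bullet> (Q *v y) = (if x = y then 1 else 0)"
    using orthonormal_system_posdef[of Q "CARD('n)"] sym pos by auto
  obtain f where f: "bij_betw f (UNIV :: 'n set) S"
    using finite_same_card_bij[of "UNIV :: 'n set" S] S by auto
  define R :: "real^'n^'n" where "R = (\<chi> i j. f j $ i)"
  have fS: "f i \<in> S" for i using f by (auto simp: bij_betw_def)
  have PQR: "transpose R ** (Q ** R) = mat 1"
  proof -
    have "(transpose R ** (Q ** R)) $ i $ j = f i \<bullet> (Q *v f j)" for i j
      by (simp add: matrix_matrix_mult_def transpose_def R_def inner_vec_def matrix_vector_mult_def)
    also have "\<dots> i j = (mat 1 :: real^'n^'n) $ i $ j" for i j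
      using orth[OF fS fS, of i j] f by (auto simp: mat_def bij_betw_def inj_on_def)
    finally show ?thesis by (simp add: vec_eq_iff)
  qed
  define T where "T = Q ** R"
  have PT: "transpose R ** T = mat 1" unfolding T_def by (rule PQR)
  then have TP: "T ** transpose R = mat 1" by (simp add: matrix_left_right_inverse)
  have "T ** transpose T = T ** (transpose R ** Q)"
    by (simp add: T_def matrix_transpose_mul sym)
  also have "\<dots> = Q" by (simp add: matrix_mul_assoc TP)
  finally show thesis using that[OF PT TP] by simp
qed

section \<open>Linear change of variables for Lebesgue measure\<close>

lemma det_reindex:
  fixes A :: "real^'n^'n" and f :: "'m::finite \<Rightarrow> 'n::finite"
  assumes f: "bij f"
  shows "det (\<chi> i j. A $ f i $ f j) = det A"
proof -
  \<comment> \<open>Conjugation by \<open>f\<close> is a bijection between the permutations of the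
    two index types and preserves the sign.\<close>
  let ?g = "\<lambda>p x. f (p (inv f x))"
  have inv: "inv f (f i) = i" "f (inv f x) = x" for i x
    using f by (simp_all add: bij_is_inj bij_is_surj surj_f_inv_f)
  have bij: "bij_betw ?g {p. p permutes (UNIV :: 'm set)} {p. p permutes (UNIV :: 'n set)}"
    using bij_betw_permutations[of f UNIV UNIV] f by simp
  have sgn: "sign (?g p) = sign p" if "p permutes (UNIV :: 'm set)" for p
  proof -
    have "map_permutation UNIV f p = ?g p"
      using f by (simp add: map_permutation_def restrict_id_def fun_eq_iff bij_is_surj)
    then show ?thesis using sign_map_permutation[of f UNIV p] f that by (simp add: bij_is_inj)
  qed
  have "det A = (\<Sum>p | p permutes (UNIV :: 'm set). of_int (sign (?g p)) * (\<Prod>i\<in>UNIV. A $ i $ ?g p i))"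
    unfolding det_def by (rule sum.reindex_bij_betw[OF bij, symmetric])
  also have "\<dots> = (\<Sum>p | p permutes (UNIV :: 'm set). of_int (sign p) * (\<Prod>i\<in>UNIV. A $ f i $ f (p i)))"
  proof (intro sum.cong refl arg_cong2[where f = "(*)"])
    fix p assume "p \<in> {p. p permutes (UNIV :: 'm set)}"
    then show "of_int (sign (?g p)) = (of_int (sign p) :: real)" by (simp add: sgn)
    show "(\<Prod>i\<in>UNIV. A $ i $ ?g p i) = (\<Prod>i\<in>UNIV. A $ f i $ f (p i))"
      using prod.reindex_bij_betw[of f UNIV UNIV "\<lambda>i. A $ i $ ?g p i"] f by (simp add: inv)
  qed
  finally show ?thesis by (simp add: det_def)
qed

lemma prod_Basis_cart:
  fixes x :: "real^'n" and F :: "real \<Rightarrow> real"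
  shows "(\<Prod>b\<in>Basis. F (x \<bullet> b)) = (\<Prod>i\<in>UNIV. F (x $ i))"
proof -
  have B: "(Basis :: (real^'n) set) = range (\<lambda>i. axis i 1)" by (auto simp: Basis_vec_def)
  have inj: "inj (\<lambda>i. axis i 1 :: real^'n)" by (auto simp: inj_on_def axis_eq_axis)
  show ?thesis
    unfolding B prod.reindex[OF inj] by (simp add: cart_eq_inner_axis)
qed

lemma lborel_reindex:
  fixes f :: "'m::finite \<Rightarrow> 'n::finite"
  assumes f: "bij f"
  shows "lborel = distr lborel borel (\<lambda>x :: real^'n. \<chi> j. x $ f j)"
proof (rule lborel_eqI)
  let ?\<phi> = "\<lambda>x :: real^'n. \<chi> j. x $ f j"
  have [measurable]: "?\<phi> \<in> borel_measurable borel"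
    by (intro borel_measurable_continuous_onI continuous_intros)
  fix l u :: "real^'m" assume le0: "\<And>b. b \<in> Basis \<Longrightarrow> l \<bullet> b \<le> u \<bullet> b"
  have le: "l $ i \<le> u $ i" for i
    using le0[of "axis i 1"] by (auto simp: inner_axis Basis_vec_def)
  let ?l = "\<chi> i. l $ inv f i" and ?u = "\<chi> i. u $ inv f i"
  have inv: "inv f (f i) = i" "f (inv f x) = x" for i x
    using f by (simp_all add: bij_is_inj bij_is_surj surj_f_inv_f)
  have "?\<phi> -` box l u = box ?l ?u"
    by (auto simp: mem_box_cart) (metis inv)+
  then have "emeasure (distr lborel borel ?\<phi>) (box l u) = emeasure lborel (box ?l ?u)"
    by (simp add: emeasure_distr)
  also have "\<dots> = ennreal (\<Prod>b\<in>Basis. (?u - ?l) \<bullet> b)"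
    by (rule emeasure_lborel_box) (auto simp: Basis_vec_def inner_axis le)
  also have "(\<Prod>b\<in>Basis. (?u - ?l) \<bullet> b) = (\<Prod>i\<in>UNIV. (u - l) $ inv f i)"
    using prod_Basis_cart[of "\<lambda>x. x" "?u - ?l"] by simp
  also have "\<dots> = (\<Prod>i\<in>UNIV. (u - l) $ i)"
    using prod.reindex_bij_betw[of "inv f" UNIV UNIV "\<lambda>i. (u - l) $ i"] f by (simp add: bij_imp_bij_inv)
  also have "\<dots> = (\<Prod>b\<in>Basis. (u - l) \<bullet> b)"
    using prod_Basis_cart[of "\<lambda>x. x" "u - l"] by simp
  finally show "emeasure (distr lborel borel ?\<phi>) (box l u) = ennreal (\<Prod>b\<in>Basis. (u - l) \<bullet> b)" .
qed simp

text \<open>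
  The library computes the Lebesgue measure of linear images only over a well-ordered index type.
  Every finite type has a well-ordered copy, to which the statement is transferred.
\<close>

typedef 'a wo = "UNIV :: 'a set" by simp

lemma bij_Rep_wo: "bij Rep_wo"
  by (rule bijI') (auto simp: Rep_wo_inject intro: Abs_wo_inverse[symmetric])

instance wo :: (finite) finite
proof
  have "finite (Rep_wo -` (UNIV :: 'a set))"
    by (rule finite_vimageI[OF finite bij_is_inj[OF bij_Rep_wo]])
  then show "finite (UNIV :: 'a wo set)" by simp
qed

definition wo_rank :: "'a::finite wo \<Rightarrow> nat" where
  "wo_rank = (SOME f. inj f)"

lemma inj_wo_rank: "inj wo_rank"
  unfolding wo_rank_def using finite_imp_inj_to_nat_seg[OF finite] by (intro someI_ex[of inj]) blast

instantiation wo :: (finite) wellorder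
begin

definition less_eq_wo :: "'a wo \<Rightarrow> 'a wo \<Rightarrow> bool" where "x \<le> y \<longleftrightarrow> wo_rank x \<le> wo_rank y"
definition less_wo :: "'a wo \<Rightarrow> 'a wo \<Rightarrow> bool" where "x < y \<longleftrightarrow> wo_rank x < wo_rank y"

instance
proof
  fix P :: "'a wo \<Rightarrow> bool" and a
  assume ind: "\<And>x. (\<And>y. y < x \<Longrightarrow> P y) \<Longrightarrow> P x"
  show "P a"
  proof (induction a rule: measure_induct_rule[of wo_rank])
    case (less x)
    show ?case by (rule ind, rule less) (simp add: less_wo_def)
  qed
qed (auto simp: less_eq_wo_def less_wo_def inj_eq[OF inj_wo_rank])

end

text \<open>It suffices to test open boxes. The preimage of a box under T is its image under the
  inverse P, of measure |det P| times that of the box, and |det T| |det P| = 1.\<close>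

lemma lborel_linear_density_wellorder:
  fixes T P :: "((real, 'n::{finite,wellorder}) vec, 'n) vec"
  assumes PT: "P ** T = mat 1" and TP: "T ** P = mat 1"
  shows "lborel = density (distr lborel borel ((*v) T)) (\<lambda>_. ennreal \<bar>det T\<bar>)"
proof (rule lborel_eqI)
  fix l u :: "(real, 'n) vec"
  assume le: "\<And>b. b \<in> Basis \<Longrightarrow> l \<bullet> b \<le> u \<bullet> b"
  have "det P * det T = 1" using PT by (metis det_I det_mul)
  then have detP: "\<bar>det T\<bar> * \<bar>det P\<bar> = 1" by (metis abs_mult abs_one mult.commute)
  have "(*v) T -` box l u = (*v) P ` box l u"
  proof (intro set_eqI iffI)
    fix x assume "x \<in> (*v) T -` box l u"
    then have "T *v x \<in> box l u" by simp
    moreover have "x = P *v (T *v x)" by (simp add: matrix_vector_mul_assoc PT)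
    ultimately show "x \<in> (*v) P ` box l u" by blast
  next
    fix x assume "x \<in> (*v) P ` box l u"
    then show "x \<in> (*v) T -` box l u" by (auto simp: matrix_vector_mul_assoc TP)
  qed
  moreover have m: "(*v) P ` box l u \<in> lmeasurable"
    by (intro measurable_linear_image matrix_vector_mul_linear) simp
  moreover have "Sigma_Algebra.measure lebesgue ((*v) P ` box l u) = \<bar>det P\<bar> * Sigma_Algebra.measure lebesgue (box l u)"
    by (subst measure_linear_image) (auto simp: matrix_vector_mul_linear matrix_of_matrix_vector_mul)
  ultimately have em: "emeasure lebesgue ((*v) T -` box l u) = ennreal (\<bar>det P\<bar> * Sigma_Algebra.measure lebesgue (box l u))"
    by (metis emeasure_eq_measure2 fmeasurableD)
  have bor: "(*v) T -` box l u \<in> sets borel"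
    using measurable_sets[of "(*v) T" borel borel "box l u"] by simp
  have "emeasure (density (distr lborel borel ((*v) T)) (\<lambda>_. ennreal \<bar>det T\<bar>)) (box l u) =
      ennreal \<bar>det T\<bar> * emeasure lborel ((*v) T -` box l u)"
    by (simp add: emeasure_density nn_integral_cmult emeasure_distr)
  also have "emeasure lborel ((*v) T -` box l u) = emeasure lebesgue ((*v) T -` box l u)"
    using bor by simp
  also have "ennreal \<bar>det T\<bar> * \<dots> = ennreal (\<bar>det T\<bar> * \<bar>det P\<bar> * Sigma_Algebra.measure lebesgue (box l u))"
    unfolding em by (simp add: ennreal_mult' mult.assoc)
  also have "\<dots> = (\<Prod>b\<in>Basis. (u - l) \<bullet> b)"
    using le by (simp add: detP measure_def inner_diff_left prod_nonneg)
  finally show "emeasure (density (distr lborel borel ((*v) T)) (\<lambda>_. ennreal \<bar>det T\<bar>)) (box l u) = ennreal (\<Prod>b\<in>Basis. (u - l) \<bullet> b)" .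
qed simp

text \<open>Relabelling coordinates preserves Lebesgue measure and determinants and intertwines T
  with its relabelled copy, so the statement carries over from the well-ordered index type.\<close>

lemma lborel_linear_density:
  fixes T P :: "real^'n^'n"
  assumes PT: "P ** T = mat 1" and TP: "T ** P = mat 1"
  shows "lborel = density (distr lborel borel ((*v) T)) (\<lambda>_. ennreal \<bar>det T\<bar>)"
proof -
  define f where "f = (Rep_wo :: 'n wo \<Rightarrow> 'n)"
  have f: "bij f" "bij (inv f)" unfolding f_def by (simp_all add: bij_Rep_wo bij_imp_bij_inv)
  have inv: "inv f (f i) = i" "f (inv f x) = x" for i x
    using f by (simp_all add: bij_is_inj bij_is_surj surj_f_inv_f)
  define re where "re = (\<lambda>A :: real^'n^'n. (\<chi> i j. A $ f i $ f j) :: real^('n wo)^('n wo))"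
  define \<psi> where "\<psi> = (\<lambda>x :: real^('n wo). \<chi> i. x $ inv f i)"
  have [measurable]: "\<psi> \<in> borel_measurable borel"
    unfolding \<psi>_def by (intro borel_measurable_continuous_onI continuous_intros)
  have sum_f: "(\<Sum>k\<in>UNIV. g (f k)) = (\<Sum>k\<in>UNIV. g k)" for g :: "'n \<Rightarrow> real"
    using sum.reindex_bij_betw[of f UNIV UNIV g] f by simp
  have re_mult: "re A ** re C = re (A ** C)" for A C
    by (simp add: re_def matrix_matrix_mult_def vec_eq_iff sum_f[of "\<lambda>k. A $ _ $ k * C $ k $ _"])
  have re_1: "re (mat 1) = mat 1"
    using f by (auto simp: re_def mat_def vec_eq_iff bij_is_inj inj_eq)
  have comm: "T *v \<psi> x = \<psi> (re T *v x)" for x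
  proof -
    have "(\<Sum>j\<in>UNIV. T $ i $ j * x $ inv f j) = (\<Sum>j\<in>UNIV. T $ i $ f j * x $ j)" for i
      using sum_f[of "\<lambda>j. T $ i $ j * x $ inv f j"] by (simp add: inv)
    then show ?thesis by (simp add: \<psi>_def re_def matrix_vector_mult_def vec_eq_iff inv)
  qed
  have lb: "(lborel :: (real^'n) measure) = distr lborel borel \<psi>"
    unfolding \<psi>_def by (rule lborel_reindex[OF f(2)])
  have "density (distr lborel borel ((*v) T)) (\<lambda>_. ennreal \<bar>det T\<bar>) =
      density (distr (distr lborel borel ((*v) (re T))) borel \<psi>) (\<lambda>_. ennreal \<bar>det T\<bar>)"
    by (subst lb) (simp add: distr_distr o_def comm)
  also have "\<dots> = distr (density (distr lborel borel ((*v) (re T))) (\<lambda>_. ennreal \<bar>det (re T)\<bar>)) borel \<psi>"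
    unfolding re_def det_reindex[OF f(1)] by (subst density_distr) auto
  also have "\<dots> = distr lborel borel \<psi>"
    using lborel_linear_density_wellorder[of "re P" "re T"] by (simp add: re_mult PT TP re_1)
  finally show ?thesis using lb by simp
qed

section \<open>Gaussian densities with given covariance matrix\<close>

lemma matrix_inv_unique:
  fixes A B :: "real^'n^'n"
  assumes "A ** B = mat 1" "B ** A = mat 1"
  shows "matrix_inv A = B"
  unfolding matrix_inv_def
proof (rule some_equality)
  fix C assume "A ** C = mat 1 \<and> C ** A = mat 1"
  then have "C = C ** (A ** B)" by (simp add: assms)
  also have "\<dots> = B" using \<open>A ** C = mat 1 \<and> C ** A = mat 1\<close> by (simp only: matrix_mul_assoc matrix_mul_lid)
  finally show "C = B" .
qed (use assms in simp)

text \<open>The formula of \<open>fbm_density\<close> for an arbitrary matrix in place of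
  \<open>fbm_cov H t\<close>.\<close>

definition gauss_density :: "real^'n^'n \<Rightarrow> real^'n \<Rightarrow> real" where
  "gauss_density Q x = 1 / ((2 * pi) powr (real CARD('n) / 2) * det Q powr (1 / 2)) *
     exp (- (x \<bullet> (matrix_inv Q *v x)) / 2)"

lemma gauss_density_measurable [measurable]: "gauss_density Q \<in> borel_measurable borel"
  unfolding gauss_density_def by measurable

lemma gauss_density_nonneg: "0 \<le> gauss_density Q x"
  by (simp add: gauss_density_def)

text \<open>For Q = T T^T with P inverse to T, the quadratic form of the inverse of Q at T x is the
  squared norm of P T x = x, and det Q powr (1/2) = |det T|. Hence |det T| times the density at T x
  is the standard density at x, which is the change of variables formula.\<close>

lemma gauss_density_distr:
  fixes T P :: "real^'n^'n"
  assumes PT: "P ** T = mat 1" and TP: "T ** P = mat 1"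
  shows "density lborel (\<lambda>x. ennreal (gauss_density (T ** transpose T) x)) =
    distr (density lborel (\<lambda>x. ennreal (std_gauss x))) borel ((*v) T)"
proof (rule measure_eqI)
  let ?Q = "T ** transpose T"
  have inv: "matrix_inv ?Q = transpose P ** P"
  proof -
    have 1: "(transpose P ** P) ** ?Q = mat 1"
    proof -
      have "(transpose P ** P) ** ?Q = transpose P ** (P ** T) ** transpose T"
        by (simp add: matrix_mul_assoc)
      also have "\<dots> = transpose (T ** P)" by (simp add: PT matrix_transpose_mul)
      finally show ?thesis by (simp add: TP)
    qed
    then have 2: "?Q ** (transpose P ** P) = mat 1" by (simp add: matrix_left_right_inverse)
    then show ?thesis using 1 by (intro matrix_inv_unique)
  qed
  have dT: "det T \<noteq> 0" using PT by (metis det_I det_mul mult_zero_right zero_neq_one)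
  have "det ?Q = \<bar>det T\<bar>\<^sup>2" by (simp add: det_mul det_transpose power2_eq_square)
  then have "det ?Q powr (1 / 2) = \<bar>det T\<bar>" by (simp add: powr_half_sqrt)
  moreover have "(T *v x) \<bullet> (matrix_inv ?Q *v (T *v x)) = x \<bullet> x" for x
  proof -
    have "(T *v x) \<bullet> (matrix_inv ?Q *v (T *v x)) = (P *v (T *v x)) \<bullet> (P *v (T *v x))"
      unfolding inv matrix_vector_mul_assoc[of "transpose P" P, symmetric] inner_matrix_vector transpose_transpose ..
    also have "P *v (T *v x) = x" by (simp add: matrix_vector_mul_assoc PT)
    finally show ?thesis .
  qed
  ultimately have key: "\<bar>det T\<bar> * gauss_density ?Q (T *v x) = std_gauss x" for x
    using dT by (simp add: gauss_density_def std_gauss_eq)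
  fix A assume "A \<in> sets (density lborel (\<lambda>x. ennreal (gauss_density ?Q x)))"
  then have [measurable]: "A \<in> sets borel" by simp
  have "emeasure (density lborel (\<lambda>x. ennreal (gauss_density ?Q x))) A = (\<integral>\<^sup>+x. ennreal (gauss_density ?Q x) * indicator A x \<partial>lborel)"
    by (simp add: emeasure_density)
  also have "\<dots> = (\<integral>\<^sup>+x. ennreal \<bar>det T\<bar> * (ennreal (gauss_density ?Q (T *v x)) * indicator A (T *v x)) \<partial>lborel)"
    by (subst lborel_linear_density[OF PT TP]) (simp add: nn_integral_density nn_integral_distr)
  also have "\<dots> = (\<integral>\<^sup>+x. ennreal (std_gauss x) * indicator A (T *v x) \<partial>lborel)"
    by (simp add: key[symmetric] ennreal_mult' gauss_density_nonneg mult.assoc)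
  also have "\<dots> = emeasure (distr (density lborel (\<lambda>x. ennreal (std_gauss x))) borel ((*v) T)) A"
  proof -
    have TA: "(*v) T -` A \<in> sets borel"
      using measurable_sets[of "(*v) T" borel borel A] by simp
    have "emeasure (distr (density lborel (\<lambda>x. ennreal (std_gauss x))) borel ((*v) T)) A =
        emeasure (density lborel (\<lambda>x. ennreal (std_gauss x))) ((*v) T -` A)"
      by (subst emeasure_distr) auto
    also have "\<dots> = (\<integral>\<^sup>+x. ennreal (std_gauss x) * indicator ((*v) T -` A) x \<partial>lborel)"
      using TA by (intro emeasure_density) auto
    finally show ?thesis by (simp add: indicator_def)
  qed
  finally show "emeasure (density lborel (\<lambda>x. ennreal (gauss_density ?Q x))) A =
    emeasure (distr (density lborel (\<lambda>x. ennreal (std_gauss x))) borel ((*v) T)) A" .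
qed simp

lemma gauss_density_char:
  fixes Q :: "real^'n^'n"
  assumes sym: "transpose Q = Q" and pos: "\<And>v. v \<noteq> 0 \<Longrightarrow> 0 < v \<bullet> (Q *v v)"
  shows "prob_space (density lborel (\<lambda>x. ennreal (gauss_density Q x)))"
    and "(CLINT x|density lborel (\<lambda>x. ennreal (gauss_density Q x)). iexp (v \<bullet> x)) = of_real (exp (- (v \<bullet> (Q *v v)) / 2))"
proof -
  obtain T P :: "real^'n^'n" where PT: "P ** T = mat 1" "T ** P = mat 1" and Q: "Q = T ** transpose T"
    by (rule posdef_factorization[OF sym]) (use pos in auto)
  have D: "density lborel (\<lambda>x. ennreal (gauss_density Q x)) = distr (density lborel (\<lambda>x. ennreal (std_gauss x))) borel ((*v) T)"
    unfolding Q by (rule gauss_density_distr[OF PT])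
  interpret G: prob_space "density lborel (\<lambda>x::real^'n. ennreal (std_gauss x))" by (rule prob_space_std_gauss)
  show "prob_space (density lborel (\<lambda>x. ennreal (gauss_density Q x)))"
    unfolding D by (rule G.prob_space_distr) simp
  have inner: "v \<bullet> (T *v x) = (transpose T *v v) \<bullet> x" for x
    by (rule inner_matrix_vector)
  have "(CLINT x|density lborel (\<lambda>x. ennreal (gauss_density Q x)). iexp (v \<bullet> x)) =
      (CLINT x|density lborel (\<lambda>x. ennreal (std_gauss x)). iexp ((transpose T *v v) \<bullet> x))"
    unfolding D by (subst integral_distr) (auto simp: inner)
  also have "\<dots> = (CLINT x|lborel. of_real (std_gauss x) * iexp ((transpose T *v v) \<bullet> x))"
    by (subst integral_density) (auto simp: std_gauss_nonneg scaleR_conv_of_real)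
  also have "\<dots> = of_real (exp (- ((transpose T *v v) \<bullet> (transpose T *v v)) / 2))"
    by (rule has_bochner_integral_integral_eq[OF std_gauss_char])
  also have "(transpose T *v v) \<bullet> (transpose T *v v) = v \<bullet> (Q *v v)"
    unfolding Q inner[symmetric] by (simp only: matrix_vector_mul_assoc)
  finally show "(CLINT x|density lborel (\<lambda>x. ennreal (gauss_density Q x)). iexp (v \<bullet> x)) = of_real (exp (- (v \<bullet> (Q *v v)) / 2))" .
qed

section \<open>Square integrable limits and the extended pairing\<close>

lemma square_integrable_lincomb:
  assumes "square_integrable M f" "square_integrable M g"
  shows "square_integrable M (\<lambda>x. r * f x + s * g x)"
proof -
  have [measurable]: "f \<in> borel_measurable M" "g \<in> borel_measurable M"
    and int: "integrable M (\<lambda>x. (f x)\<^sup>2)" "integrable M (\<lambda>x. (g x)\<^sup>2)"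
    using assms by (auto simp: square_integrable_def)
  have "integrable M (\<lambda>x. (r * f x + s * g x)\<^sup>2)"
  proof (rule Bochner_Integration.integrable_bound)
    show "integrable M (\<lambda>x. 2 * r\<^sup>2 * (f x)\<^sup>2 + 2 * s\<^sup>2 * (g x)\<^sup>2)"
      using int by simp
    have "(r * f x + s * g x)\<^sup>2 \<le> 2 * r\<^sup>2 * (f x)\<^sup>2 + 2 * s\<^sup>2 * (g x)\<^sup>2" for x
      using zero_le_power2[of "r * f x - s * g x"] by (simp add: power2_eq_square algebra_simps)
    then show "AE x in M. norm ((r * f x + s * g x)\<^sup>2) \<le> norm (2 * r\<^sup>2 * (f x)\<^sup>2 + 2 * s\<^sup>2 * (g x)\<^sup>2)"
      by simp
  qed measurable
  then show ?thesis by (simp add: square_integrable_def)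
qed

lemma square_integrable_diff:
  assumes "square_integrable M f" "square_integrable M g"
  shows "square_integrable M (\<lambda>x. f x - g x)"
  using square_integrable_lincomb[OF assms, of 1 "-1"] by simp

lemma L2_tendsto_lincomb:
  assumes "L2_tendsto M F f" "L2_tendsto M G g"
  shows "L2_tendsto M (\<lambda>n x. r * F n x + s * G n x) (\<lambda>x. r * f x + s * g x)"
  unfolding L2_tendsto_def
proof (intro conjI allI)
  have sq: "square_integrable M (F n)" "square_integrable M f" "square_integrable M (G n)" "square_integrable M g"
    and lim: "(\<lambda>n. LINT x|M. (F n x - f x)\<^sup>2) \<longlonglongrightarrow> 0" "(\<lambda>n. LINT x|M. (G n x - g x)\<^sup>2) \<longlonglongrightarrow> 0" for n
    using assms by (auto simp: L2_tendsto_def)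
  show "square_integrable M (\<lambda>x. r * F n x + s * G n x)" for n by (intro square_integrable_lincomb sq)
  show "square_integrable M (\<lambda>x. r * f x + s * g x)" by (intro square_integrable_lincomb sq)
  have df: "square_integrable M (\<lambda>x. F n x - f x)" and dg: "square_integrable M (\<lambda>x. G n x - g x)" for n
    by (intro square_integrable_diff sq)+
  have "(\<lambda>n. 2 * r\<^sup>2 * (LINT x|M. (F n x - f x)\<^sup>2) + 2 * s\<^sup>2 * (LINT x|M. (G n x - g x)\<^sup>2)) \<longlonglongrightarrow> 2 * r\<^sup>2 * 0 + 2 * s\<^sup>2 * 0"
    by (intro tendsto_intros lim)
  then have up: "(\<lambda>n. 2 * r\<^sup>2 * (LINT x|M. (F n x - f x)\<^sup>2) + 2 * s\<^sup>2 * (LINT x|M. (G n x - g x)\<^sup>2)) \<longlonglongrightarrow> 0"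
    by simp
  show "(\<lambda>n. LINT x|M. (r * F n x + s * G n x - (r * f x + s * g x))\<^sup>2) \<longlonglongrightarrow> 0"
  proof (rule tendsto_sandwich[OF _ _ tendsto_const up])
    show "eventually (\<lambda>n. 0 \<le> (LINT x|M. (r * F n x + s * G n x - (r * f x + s * g x))\<^sup>2)) sequentially"
      by (intro always_eventually allI integral_nonneg_AE AE_I2) simp
    have "(LINT x|M. (r * F n x + s * G n x - (r * f x + s * g x))\<^sup>2) \<le>
        2 * r\<^sup>2 * (LINT x|M. (F n x - f x)\<^sup>2) + 2 * s\<^sup>2 * (LINT x|M. (G n x - g x)\<^sup>2)" for n
    proof -
      have "(LINT x|M. (r * F n x + s * G n x - (r * f x + s * g x))\<^sup>2) \<le>
          (LINT x|M. 2 * r\<^sup>2 * (F n x - f x)\<^sup>2 + 2 * s\<^sup>2 * (G n x - g x)\<^sup>2)"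
      proof (rule integral_mono)
        show "integrable M (\<lambda>x. (r * F n x + s * G n x - (r * f x + s * g x))\<^sup>2)"
          using square_integrable_diff[OF square_integrable_lincomb[OF sq(1) sq(3)] square_integrable_lincomb[OF sq(2) sq(4)]]
          by (simp add: square_integrable_def)
        show "integrable M (\<lambda>x. 2 * r\<^sup>2 * (F n x - f x)\<^sup>2 + 2 * s\<^sup>2 * (G n x - g x)\<^sup>2)"
          using df[of n] dg[of n] by (simp add: square_integrable_def)
        fix x
        show "(r * F n x + s * G n x - (r * f x + s * g x))\<^sup>2 \<le> 2 * r\<^sup>2 * (F n x - f x)\<^sup>2 + 2 * s\<^sup>2 * (G n x - g x)\<^sup>2"
          using zero_le_power2[of "r * (F n x - f x) - s * (G n x - g x)"] by (simp add: power2_eq_square algebra_simps)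
      qed
      also have "\<dots> = 2 * r\<^sup>2 * (LINT x|M. (F n x - f x)\<^sup>2) + 2 * s\<^sup>2 * (LINT x|M. (G n x - g x)\<^sup>2)"
        using df[of n] dg[of n] by (simp add: square_integrable_def)
      finally show ?thesis .
    qed
    then show "eventually (\<lambda>n. (LINT x|M. (r * F n x + s * G n x - (r * f x + s * g x))\<^sup>2) \<le>
        2 * r\<^sup>2 * (LINT x|M. (F n x - f x)\<^sup>2) + 2 * s\<^sup>2 * (LINT x|M. (G n x - g x)\<^sup>2)) sequentially"
      by (intro always_eventually allI)
  qed
qed

text \<open>With g = F - f one has |F^2 - f^2| <= |2 f g| + g^2, and the weighted inequality |2 f g|
  <= \<epsilon> f^2 + g^2 / \<epsilon> splits this into a small multiple of the limit norm and a
  multiple of the distance.\<close>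

lemma L2_tendsto_norm:
  assumes "L2_tendsto M F f"
  shows "(\<lambda>n. LINT x|M. (F n x)\<^sup>2) \<longlonglongrightarrow> (LINT x|M. (f x)\<^sup>2)"
proof (rule LIMSEQ_I)
  fix e :: real assume e: "0 < e"
  define N where "N = (LINT x|M. (f x)\<^sup>2)"
  define d where "d = (\<lambda>n. LINT x|M. (F n x - f x)\<^sup>2)"
  have sq: "square_integrable M (F n)" "square_integrable M f" for n using assms by (auto simp: L2_tendsto_def)
  have dn: "square_integrable M (\<lambda>x. F n x - f x)" for n by (intro square_integrable_diff sq)
  have N0: "0 \<le> N" unfolding N_def by simp
  \<comment> \<open>N + 1 rather than N, so that \<epsilon> N < e / 2 also holds for N = 0.\<close>
  define \<epsilon> where "\<epsilon> = e / (2 * (N + 1))"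
  have \<epsilon>: "0 < \<epsilon>" "\<epsilon> * N < e / 2"
    using e N0 by (auto simp: \<epsilon>_def field_simps add_pos_nonneg)
  have bound: "\<bar>(LINT x|M. (F n x)\<^sup>2) - N\<bar> \<le> \<epsilon> * N + (1 + 1 / \<epsilon>) * d n" for n
  proof -
    have int: "integrable M (\<lambda>x. (F n x)\<^sup>2)" "integrable M (\<lambda>x. (f x)\<^sup>2)" "integrable M (\<lambda>x. (F n x - f x)\<^sup>2)"
      using sq dn by (auto simp: square_integrable_def)
    have "(LINT x|M. (F n x)\<^sup>2) - N = (LINT x|M. (F n x)\<^sup>2 - (f x)\<^sup>2)"
      using int by (simp add: N_def)
    also have "\<bar>\<dots>\<bar> \<le> (LINT x|M. \<bar>(F n x)\<^sup>2 - (f x)\<^sup>2\<bar>)"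
      by (rule integral_abs_bound)
    also have "\<dots> \<le> (LINT x|M. \<epsilon> * (f x)\<^sup>2 + (1 + 1 / \<epsilon>) * (F n x - f x)\<^sup>2)"
    proof (rule integral_mono)
      fix x
      define g where "g = F n x - f x"
      have F: "F n x = f x + g" by (simp add: g_def)
      have sg: "2 * s * f x * g \<le> \<epsilon> * (f x)\<^sup>2 + 1 / \<epsilon> * g\<^sup>2" if "s = 1 \<or> s = -1" for s
      proof -
        have "0 \<le> (\<epsilon> * f x - s * g)\<^sup>2 / \<epsilon>" using \<epsilon> by simp
        also have "(\<epsilon> * f x - s * g)\<^sup>2 / \<epsilon> = \<epsilon> * (f x)\<^sup>2 - 2 * s * f x * g + s\<^sup>2 * g\<^sup>2 / \<epsilon>"
          using \<epsilon> by (simp add: power2_eq_square field_simps)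
        finally show ?thesis using that by auto
      qed
      have "\<bar>2 * f x * g\<bar> \<le> \<epsilon> * (f x)\<^sup>2 + 1 / \<epsilon> * g\<^sup>2"
        using sg[of 1] sg[of "-1"] by (auto simp: abs_le_iff)
      moreover have "(F n x)\<^sup>2 - (f x)\<^sup>2 = 2 * f x * g + g\<^sup>2"
        unfolding F by (simp add: power2_eq_square algebra_simps)
      moreover have "\<bar>2 * f x * g + g\<^sup>2\<bar> \<le> \<bar>2 * f x * g\<bar> + g\<^sup>2"
        using abs_triangle_ineq[of "2 * f x * g" "g\<^sup>2"] by simp
      ultimately have "\<bar>(F n x)\<^sup>2 - (f x)\<^sup>2\<bar> \<le> \<epsilon> * (f x)\<^sup>2 + (1 + 1 / \<epsilon>) * g\<^sup>2"
        by (simp add: ring_distribs)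
      then show "\<bar>(F n x)\<^sup>2 - (f x)\<^sup>2\<bar> \<le> \<epsilon> * (f x)\<^sup>2 + (1 + 1 / \<epsilon>) * (F n x - f x)\<^sup>2"
        by (simp only: g_def)
    qed (use int in auto)
    also have "\<dots> = \<epsilon> * N + (1 + 1 / \<epsilon>) * d n"
      using int by (simp add: N_def d_def)
    finally show ?thesis .
  qed
  have "(\<lambda>n. (1 + 1 / \<epsilon>) * d n) \<longlonglongrightarrow> (1 + 1 / \<epsilon>) * 0"
    unfolding d_def using assms by (intro tendsto_intros) (simp add: L2_tendsto_def)
  then have "eventually (\<lambda>n. (1 + 1 / \<epsilon>) * d n < e / 2) sequentially"
    by (rule order_tendstoD) (use e in simp)
  then obtain n0 where n0: "\<And>n. n0 \<le> n \<Longrightarrow> (1 + 1 / \<epsilon>) * d n < e / 2"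
    unfolding eventually_sequentially by blast
  show "\<exists>no. \<forall>n\<ge>no. norm ((LINT x|M. (F n x)\<^sup>2) - (LINT x|M. (f x)\<^sup>2)) < e"
  proof (intro exI allI impI)
    fix n assume "n0 \<le> n"
    then show "norm ((LINT x|M. (F n x)\<^sup>2) - (LINT x|M. (f x)\<^sup>2)) < e"
      unfolding real_norm_def N_def[symmetric] using bound[of n] n0[of n] \<epsilon>(2) by linarith
  qed
qed

lemma norm_iexp_diff_le: "norm (exp (\<i> * of_real a) - exp (\<i> * of_real b)) \<le> \<bar>a - b\<bar>" for a b :: real
proof -
  have "exp (\<i> * of_real a) - exp (\<i> * of_real b) = exp (\<i> * of_real b) * (iexp (a - b) - 1)"
    by (simp add: algebra_simps flip: exp_add)
  then have "norm (exp (\<i> * of_real a) - exp (\<i> * of_real b)) = norm (iexp (a - b) - 1)"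
    by (simp add: norm_mult)
  also have "\<dots> \<le> \<bar>a - b\<bar>"
    using iexp_approx1[of "a - b" 0] by simp
  finally show ?thesis .
qed

text \<open>The map a -> exp (i a) is 1-Lipschitz, and the first absolute moment is bounded by the
  root of the second because a variance is non-negative.\<close>

lemma (in prob_space) L2_tendsto_char:
  assumes "L2_tendsto M Y Z"
  shows "(\<lambda>n. CLINT \<omega>|M. iexp (Y n \<omega>)) \<longlonglongrightarrow> (CLINT \<omega>|M. iexp (Z \<omega>))"
proof -
  have sq: "square_integrable M (Y n)" "square_integrable M Z" for n using assms by (auto simp: L2_tendsto_def)
  have [measurable]: "Y n \<in> borel_measurable M" "Z \<in> borel_measurable M" for n
    using sq by (auto simp: square_integrable_def)
  have D: "square_integrable M (\<lambda>\<omega>. Y n \<omega> - Z \<omega>)" for n by (intro square_integrable_diff sq)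
  have int: "integrable M (\<lambda>\<omega>. \<bar>Y n \<omega> - Z \<omega>\<bar>)" for n
  proof (rule integrable_abs, rule square_integrable_imp_integrable)
    show "(\<lambda>\<omega>. Y n \<omega> - Z \<omega>) \<in> borel_measurable M" by measurable
    show "integrable M (\<lambda>\<omega>. (Y n \<omega> - Z \<omega>)\<^sup>2)" using D[of n] by (simp add: square_integrable_def)
  qed
  have le: "norm ((CLINT \<omega>|M. iexp (Y n \<omega>)) - (CLINT \<omega>|M. iexp (Z \<omega>))) \<le> sqrt (LINT \<omega>|M. (Y n \<omega> - Z \<omega>)\<^sup>2)" for n
  proof -
    have ie: "integrable M (\<lambda>\<omega>. iexp (W \<omega>))" if [measurable]: "W \<in> borel_measurable M" for W
      by (rule integrable_const_bound[where B = 1]) auto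
    have "(CLINT \<omega>|M. iexp (Y n \<omega>)) - (CLINT \<omega>|M. iexp (Z \<omega>)) =
        (CLINT \<omega>|M. iexp (Y n \<omega>) - iexp (Z \<omega>))"
      by (subst Bochner_Integration.integral_diff) (auto intro: ie)
    also have "norm \<dots> \<le> (LINT \<omega>|M. norm (iexp (Y n \<omega>) - iexp (Z \<omega>)))"
      by (rule integral_norm_bound)
    also have "\<dots> \<le> (LINT \<omega>|M. \<bar>Y n \<omega> - Z \<omega>\<bar>)"
      by (intro integral_mono integrable_norm Bochner_Integration.integrable_diff ie int norm_iexp_diff_le) auto
    also have "\<dots> \<le> sqrt (LINT \<omega>|M. (Y n \<omega> - Z \<omega>)\<^sup>2)"
    proof (rule real_le_rsqrt)
      have "variance (\<lambda>\<omega>. \<bar>Y n \<omega> - Z \<omega>\<bar>) = expectation (\<lambda>\<omega>. \<bar>Y n \<omega> - Z \<omega>\<bar>\<^sup>2) - (expectation (\<lambda>\<omega>. \<bar>Y n \<omega> - Z \<omega>\<bar>))\<^sup>2"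
        using D[of n] int[of n] by (intro variance_eq) (auto simp: square_integrable_def)
      then show "(LINT \<omega>|M. \<bar>Y n \<omega> - Z \<omega>\<bar>)\<^sup>2 \<le> (LINT \<omega>|M. (Y n \<omega> - Z \<omega>)\<^sup>2)"
        using variance_positive[of "\<lambda>\<omega>. \<bar>Y n \<omega> - Z \<omega>\<bar>"] by simp
    qed
    finally show ?thesis .
  qed
  have "(\<lambda>n. sqrt (LINT \<omega>|M. (Y n \<omega> - Z \<omega>)\<^sup>2)) \<longlonglongrightarrow> sqrt 0"
    using assms by (intro tendsto_real_sqrt) (simp add: L2_tendsto_def)
  then have lim: "(\<lambda>n. sqrt (LINT \<omega>|M. (Y n \<omega> - Z \<omega>)\<^sup>2)) \<longlonglongrightarrow> 0" by (simp only: real_sqrt_zero)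
  have "(\<lambda>n. (CLINT \<omega>|M. iexp (Y n \<omega>)) - (CLINT \<omega>|M. iexp (Z \<omega>))) \<longlonglongrightarrow> 0"
    by (rule Lim_null_comparison[OF always_eventually[OF allI[OF le]] lim])
  then show ?thesis by (rule LIM_zero_cancel)
qed

section \<open>Linearity of the extended pairing\<close>

lemma schwartz_lincomb:
  assumes \<phi>: "\<phi> \<in> schwartz" and \<psi>: "\<psi> \<in> schwartz"
  shows "(\<lambda>x. r * \<phi> x + s * \<psi> x) \<in> schwartz"
proof -
  let ?h = "\<lambda>x. r * \<phi> x + s * \<psi> x"
  have diff: "(deriv ^^ n) \<phi> differentiable (at x)" "(deriv ^^ n) \<psi> differentiable (at x)" for n x
    using assms by (auto simp: schwartz_def)
  have D: "(deriv ^^ n) ?h = (\<lambda>x. r * (deriv ^^ n) \<phi> x + s * (deriv ^^ n) \<psi> x)" for n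
  proof (induction n)
    case (Suc n)
    have "deriv (\<lambda>x. r * (deriv ^^ n) \<phi> x + s * (deriv ^^ n) \<psi> x) x = r * deriv ((deriv ^^ n) \<phi>) x + s * deriv ((deriv ^^ n) \<psi>) x" for x
      using diff[of n x] by (intro DERIV_imp_deriv DERIV_add DERIV_cmult) (auto simp: DERIV_deriv_iff_real_differentiable)
    then have "deriv (\<lambda>x. r * (deriv ^^ n) \<phi> x + s * (deriv ^^ n) \<psi> x) = (\<lambda>x. r * deriv ((deriv ^^ n) \<phi>) x + s * deriv ((deriv ^^ n) \<psi>) x)"
      by (rule ext)
    then show ?case by (simp only: funpow.simps o_apply Suc)
  qed simp
  have "bounded (range (\<lambda>x. x ^ k * (deriv ^^ n) ?h x))" for k n
  proof -
    have "bounded (range (\<lambda>x. x ^ k * (deriv ^^ n) \<phi> x))" "bounded (range (\<lambda>x. x ^ k * (deriv ^^ n) \<psi> x))"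
      using assms by (auto simp: schwartz_def)
    then obtain a b where a: "\<And>x. norm (x ^ k * (deriv ^^ n) \<phi> x) \<le> a" and b: "\<And>x. norm (x ^ k * (deriv ^^ n) \<psi> x) \<le> b"
      unfolding bounded_iff by blast
    have "norm (x ^ k * (deriv ^^ n) ?h x) \<le> \<bar>r\<bar> * a + \<bar>s\<bar> * b" for x
    proof -
      have "x ^ k * (deriv ^^ n) ?h x = r * (x ^ k * (deriv ^^ n) \<phi> x) + s * (x ^ k * (deriv ^^ n) \<psi> x)"
        unfolding D by (simp add: algebra_simps)
      also have "norm \<dots> \<le> \<bar>r\<bar> * norm (x ^ k * (deriv ^^ n) \<phi> x) + \<bar>s\<bar> * norm (x ^ k * (deriv ^^ n) \<psi> x)"
        by (rule order_trans[OF norm_triangle_ineq]) (simp add: abs_mult)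
      also have "\<dots> \<le> \<bar>r\<bar> * a + \<bar>s\<bar> * b" by (intro add_mono mult_left_mono a b) auto
      finally show ?thesis .
    qed
    then show ?thesis unfolding bounded_iff by blast
  qed
  moreover have "(deriv ^^ n) ?h differentiable (at x)" for n x
    unfolding D using diff[of n x] by (intro differentiable_add differentiable_mult) auto
  ultimately show ?thesis by (auto simp: schwartz_def)
qed

lemma tempered_lincomb:
  "\<omega> \<in> tempered \<Longrightarrow> \<phi> \<in> schwartz \<Longrightarrow> \<psi> \<in> schwartz \<Longrightarrow> \<omega> (\<lambda>x. r * \<phi> x + s * \<psi> x) = r * \<omega> \<phi> + s * \<omega> \<psi>"
  by (simp add: tempered_def)

lemma space_cylinder_algebra: "space cylinder_algebra = tempered"
  unfolding cylinder_algebra_def by (rule space_measure_of) auto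

text \<open>A functional \<omega> is linear only if it lies in \<open>tempered\<close>, so
  approximating sequences can be compared only on the space of the measure.\<close>

lemma L2_tendsto_cong_space:
  assumes "\<And>n x. x \<in> space M \<Longrightarrow> F n x = G n x" and "L2_tendsto M F f"
  shows "L2_tendsto M G f"
proof -
  have "(\<lambda>n. LINT x|M. (F n x - f x)\<^sup>2) = (\<lambda>n. LINT x|M. (G n x - f x)\<^sup>2)"
    by (intro ext Bochner_Integration.integral_cong) (auto simp: assms(1))
  moreover have "square_integrable M (F n) \<longleftrightarrow> square_integrable M (G n)" for n
    unfolding square_integrable_def
    by (intro arg_cong2[where f = "(\<and>)"] measurable_cong Bochner_Integration.integrable_cong) (auto simp: assms(1))
  ultimately show ?thesis using assms(2) by (simp add: L2_tendsto_def)
qed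

lemma is_pairing_lincomb:
  assumes \<mu>: "space \<mu> = tempered" and "is_pairing \<mu> f Y" "is_pairing \<mu> g Z"
  shows "is_pairing \<mu> (\<lambda>x. r * f x + s * g x) (\<lambda>\<omega>. r * Y \<omega> + s * Z \<omega>)"
proof -
  obtain \<phi> where \<phi>: "\<And>n. \<phi> n \<in> schwartz" "L2_tendsto lborel \<phi> f" "L2_tendsto \<mu> (\<lambda>n \<omega>. \<omega> (\<phi> n)) Y"
    using assms(2) by (auto simp: is_pairing_def)
  obtain \<psi> where \<psi>: "\<And>n. \<psi> n \<in> schwartz" "L2_tendsto lborel \<psi> g" "L2_tendsto \<mu> (\<lambda>n \<omega>. \<omega> (\<psi> n)) Z"
    using assms(3) by (auto simp: is_pairing_def)
  have "L2_tendsto \<mu> (\<lambda>n \<omega>. \<omega> (\<lambda>x. r * \<phi> n x + s * \<psi> n x)) (\<lambda>\<omega>. r * Y \<omega> + s * Z \<omega>)"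
    by (rule L2_tendsto_cong_space[OF _ L2_tendsto_lincomb[OF \<phi>(3) \<psi>(3)]])
      (simp add: \<mu> tempered_lincomb[OF _ \<phi>(1) \<psi>(1)])
  then show ?thesis
    unfolding is_pairing_def using \<phi>(1) \<psi>(1)
    by (intro exI[of _ "\<lambda>n x. r * \<phi> n x + s * \<psi> n x"] conjI allI schwartz_lincomb L2_tendsto_lincomb \<phi>(2) \<psi>(2)) auto
qed

lemma is_pairing_sum:
  assumes \<mu>: "space \<mu> = tempered" and "\<And>i. i \<in> I \<Longrightarrow> is_pairing \<mu> (f i) (Y i)" and "finite I" "I \<noteq> {}"
  shows "is_pairing \<mu> (\<lambda>x. \<Sum>i\<in>I. v i * f i x) (\<lambda>\<omega>. \<Sum>i\<in>I. v i * Y i \<omega>)"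
  using assms(3,4,2)
proof (induction I rule: finite_ne_induct)
  case (singleton i)
  then have "is_pairing \<mu> (f i) (Y i)" by simp
  from is_pairing_lincomb[OF \<mu> this this, of "v i" 0] show ?case by simp
next
  case (insert i I)
  have "is_pairing \<mu> (f i) (Y i)" "is_pairing \<mu> (\<lambda>x. \<Sum>i\<in>I. v i * f i x) (\<lambda>\<omega>. \<Sum>i\<in>I. v i * Y i \<omega>)"
    using insert by auto
  from is_pairing_lincomb[OF \<mu> this, of "v i" 1] show ?case using insert by simp
qed

text \<open>Allows \<open>M_minus\<close> to be replaced by the explicit kernel. Since
  \<open>lborel\<close> is not complete, measurability of \<open>g\<close> does not follow from that
  of \<open>f\<close>.\<close>

lemma is_pairing_cong_AE:
  assumes "is_pairing \<mu> f Y" and eq: "AE x in lborel. f x = g x" and [measurable]: "g \<in> borel_measurable borel"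
  shows "is_pairing \<mu> g Y"
proof -
  have "L2_tendsto lborel \<phi> g" if "L2_tendsto lborel \<phi> f" for \<phi>
  proof -
    have [measurable]: "f \<in> borel_measurable borel" "\<phi> n \<in> borel_measurable borel" for n
      using that by (auto simp: L2_tendsto_def square_integrable_def)
    have "(LINT x|lborel. (\<phi> n x - f x)\<^sup>2) = (LINT x|lborel. (\<phi> n x - g x)\<^sup>2)" for n
      by (rule integral_cong_AE) (use eq in auto)
    moreover have "integrable lborel (\<lambda>x. (f x)\<^sup>2) \<longleftrightarrow> integrable lborel (\<lambda>x. (g x)\<^sup>2)"
      by (rule integrable_cong_AE) (use eq in auto)
    ultimately show ?thesis using that by (simp add: L2_tendsto_def square_integrable_def)
  qed
  then show ?thesis using assms(1) unfolding is_pairing_def by blast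
qed

section \<open>The Gaussian scale mixture\<close>

lemma K_const_eq_gamma_quot: "K_const A B = gamma_quot A B 1"
  by (simp add: K_const_def gamma_quot_def)

lemma prod_list_Gamma_pos:
  assumes "\<forall>(b, \<beta>)\<in>set B. 0 < b + \<beta>"
  shows "0 < (\<Prod>(b, \<beta>)\<leftarrow>B. Gamma (b + \<beta> :: real))"
  using assms by (induction B) (auto intro!: mult_pos_pos Gamma_real_pos)

lemma integral_pair_mult:
  fixes f g :: "_ \<Rightarrow> real"
  assumes "sigma_finite_measure M" "sigma_finite_measure N" "has_bochner_integral M f a" "has_bochner_integral N g b"
  shows "has_bochner_integral (M \<Otimes>\<^sub>M N) (\<lambda>(x, y). f x * g y) (a * b)"
proof -
  interpret pair_sigma_finite M N using assms by (simp add: pair_sigma_finite_def)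
  have int: "integrable (M \<Otimes>\<^sub>M N) (\<lambda>(x, y). f x * g y)"
    using assms by (intro integrable_pair_mult) (auto simp: has_bochner_integral_iff)
  moreover have "integral\<^sup>L (M \<Otimes>\<^sub>M N) (\<lambda>(x, y). f x * g y) = (LINT x|M. LINT y|N. f x * g y)"
    using integral_fst'[OF int] by simp
  ultimately show ?thesis using assms(3,4) by (simp add: has_bochner_integral_iff)
qed

section \<open>The mixing distribution and its Laplace transform\<close>

locale foxH_mixture = foxH_params A B for A B +
  fixes \<gamma> c :: real
  assumes \<gamma>: "foxH_contour B \<gamma>" and c: "wright_contour B c"
    and nonneg: "\<And>\<tau>. 0 < \<tau> \<Longrightarrow> foxH A B \<gamma> \<tau> \<in> \<real>\<^sub>\<ge>\<^sub>0"
begin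

abbreviation "K \<equiv> K_const A B"

lemma K_pos: "0 < K"
proof -
  have "0 < (\<Prod>(b, \<beta>)\<leftarrow>B. Gamma (b + \<beta>))" "0 < (\<Prod>(a, \<alpha>)\<leftarrow>A. Gamma (a + \<alpha>))"
    using A B by (auto intro!: prod_list_Gamma_pos)
  then show ?thesis by (simp add: K_const_def)
qed

definition \<rho> :: "real \<Rightarrow> real" where
  "\<rho> \<tau> = indicator {0<..} \<tau> * Re (foxH A B \<gamma> \<tau>) / K"

lemma rho_nonneg: "0 \<le> \<rho> \<tau>"
  using nonneg[of \<tau>] K_pos by (auto simp: \<rho>_def indicator_def complex_nonneg_Reals_iff)

text \<open>A value in the non-negative reals has no imaginary part, so passing to \<open>Re\<close>
  in \<rho> loses nothing; this transfers the complex integrals of the Fox H-function to real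
  ones.\<close>

lemma rho_foxH: "of_real (w * \<rho> \<tau> * K) = complex_of_real (indicator {0<..} \<tau> * w) * foxH A B \<gamma> \<tau>"
  using nonneg[of \<tau>] K_pos by (auto simp: \<rho>_def indicator_def complex_nonneg_Reals_iff complex_eq_iff)

lemma has_bochner_integral_rho:
  assumes "has_bochner_integral lborel (\<lambda>\<tau>. complex_of_real (indicator {0<..} \<tau> * w \<tau>) * foxH A B \<gamma> \<tau>) I"
  shows "has_bochner_integral lborel (\<lambda>\<tau>. w \<tau> * \<rho> \<tau>) (Re I / K)" and "I = of_real (Re I)"
proof -
  have int: "integrable lborel (\<lambda>\<tau>. complex_of_real (w \<tau> * \<rho> \<tau> * K))" and I: "(CLINT \<tau>|lborel. of_real (w \<tau> * \<rho> \<tau> * K)) = I"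
    using assms unfolding rho_foxH[symmetric] by (auto simp: has_bochner_integral_iff)
  have int': "integrable lborel (\<lambda>\<tau>. w \<tau> * \<rho> \<tau> * K)"
    using int by (simp only: complex_of_real_integrable_eq)
  have I': "of_real (LINT \<tau>|lborel. w \<tau> * \<rho> \<tau> * K) = I"
    using I by (simp only: integral_complex_of_real)
  show "I = of_real (Re I)" unfolding I'[symmetric] by simp
  have "has_bochner_integral lborel (\<lambda>\<tau>. w \<tau> * \<rho> \<tau> * K) (Re I)"
    using int' I' by (auto simp: has_bochner_integral_iff)
  from has_bochner_integral_divide[OF this, of K] show "has_bochner_integral lborel (\<lambda>\<tau>. w \<tau> * \<rho> \<tau>) (Re I / K)"
    using K_pos by simp
qed

lemma rho_moment: "has_bochner_integral lborel (\<lambda>\<tau>. \<tau> ^ n * \<rho> \<tau>) (gamma_quot A B (real n + 1) / K)"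
  using has_bochner_integral_rho(1)[OF foxH_moment[OF \<gamma> c, of n]] by simp

lemma rho_measurable [measurable]: "\<rho> \<in> borel_measurable borel"
  using rho_moment[of 0] by (auto simp: has_bochner_integral_iff dest: borel_measurable_integrable)

definition R :: "real measure" where
  "R = density lborel (\<lambda>\<tau>. ennreal (\<rho> \<tau>))"

lemma sets_R [measurable_cong, simp]: "sets R = sets borel" and space_R [simp]: "space R = UNIV"
  by (simp_all add: R_def)

lemma has_bochner_integral_R:
  fixes f :: "real \<Rightarrow> real"
  assumes "has_bochner_integral lborel (\<lambda>\<tau>. f \<tau> * \<rho> \<tau>) I" and [measurable]: "f \<in> borel_measurable borel"
  shows "has_bochner_integral R f I"
  unfolding R_def using assms rho_nonneg
  by (intro has_bochner_integral_density) (auto simp: mult.commute)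

lemma R_moment: "has_bochner_integral R (\<lambda>\<tau>. \<tau> ^ n) (gamma_quot A B (real n + 1) / K)"
  by (rule has_bochner_integral_R[OF rho_moment]) simp

sublocale R: prob_space R
proof
  have one: "has_bochner_integral lborel (\<lambda>\<tau>. \<rho> \<tau>) 1"
    using rho_moment[of 0] K_pos by (simp add: K_const_eq_gamma_quot)
  have "emeasure R (space R) = (\<integral>\<^sup>+\<tau>. ennreal (\<rho> \<tau>) \<partial>lborel)"
    by (simp add: R_def emeasure_density)
  also have "\<dots> = ennreal 1"
    using one rho_nonneg by (subst nn_integral_eq_integral) (auto simp: has_bochner_integral_iff)
  finally show "emeasure R (space R) = 1" by simp
qed

lemma AE_R_pos: "AE \<tau> in R. 0 < \<tau>"
proof -
  have "AE \<tau> in lborel. 0 < ennreal (\<rho> \<tau>) \<longrightarrow> 0 < \<tau>"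
    by (auto simp: \<rho>_def indicator_def)
  then show ?thesis unfolding R_def by (subst AE_density) auto
qed

definition L :: "real \<Rightarrow> real" where
  "L s = (LINT \<tau>|R. exp (- s * \<tau>))"

text \<open>At s = 0 the Wright function is given by its series, not by the contour integral; there
  the identity says that \<open>R\<close> has total mass 1.\<close>

lemma gen_wright_eq_L:
  assumes "0 \<le> s"
  shows "1 / of_real K * gen_wright A B c (- s) = complex_of_real (L s)"
proof (cases "s = 0")
  case True
  then show ?thesis using K_pos R.prob_space by (simp add: L_def gen_wright_0)
next
  case False
  then have s: "0 < s" using assms by simp
  note lap = has_bochner_integral_rho[OF foxH_laplace[OF \<gamma> c s]]
  have "has_bochner_integral R (\<lambda>\<tau>. exp (- s * \<tau>)) (Re (gen_wright A B c (- s)) / K)"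
    by (rule has_bochner_integral_R[OF lap(1)]) simp
  then have "L s = Re (gen_wright A B c (- s)) / K"
    by (simp add: L_def has_bochner_integral_iff)
  then show ?thesis using lap(2) by simp
qed

text \<open>Continuity of the Laplace transform on the closed half-line, endpoint included: almost
  all \<tau> are positive, so the exponentials are dominated by 1.\<close>

lemma L_tendsto:
  assumes "\<And>n. 0 \<le> s n" "s \<longlonglongrightarrow> l"
  shows "(\<lambda>n. L (s n)) \<longlonglongrightarrow> L l"
  unfolding L_def
proof (rule integral_dominated_convergence[where w = "\<lambda>_. 1"])
  show "AE \<tau> in R. (\<lambda>n. exp (- s n * \<tau>)) \<longlonglongrightarrow> exp (- l * \<tau>)"
    using assms(2) by (intro AE_I2 tendsto_intros)
  show "AE \<tau> in R. norm (exp (- s n * \<tau>)) \<le> 1" for n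
    using AE_R_pos by eventually_elim (use assms(1) in simp)
qed auto

definition law :: "real \<Rightarrow> real measure" where
  "law q = distr (R \<Otimes>\<^sub>M std_normal_distribution) borel (\<lambda>(\<tau>, z). sqrt (\<tau> * q) * z)"

lemma prob_space_law: "prob_space (law q)"
proof -
  interpret G: real_distribution std_normal_distribution by (rule real_dist_normal_dist)
  interpret pair_prob_space R std_normal_distribution ..
  show ?thesis unfolding law_def by (rule prob_space_distr) measurable
qed

lemma char_law:
  assumes "0 \<le> q"
  shows "char (law q) u = of_real (L (u\<^sup>2 * q / 2))"
proof -
  interpret G: real_distribution std_normal_distribution by (rule real_dist_normal_dist)
  interpret P: pair_prob_space R std_normal_distribution ..
  let ?f = "\<lambda>(\<tau>, z). iexp (u * (sqrt (\<tau> * q) * z))"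
  have int: "integrable (R \<Otimes>\<^sub>M std_normal_distribution) ?f"
    by (rule P.integrable_const_bound[where B = 1]) (auto simp: split_beta')
  have "char (law q) u = integral\<^sup>L (R \<Otimes>\<^sub>M std_normal_distribution) ?f"
    unfolding char_def law_def by (subst integral_distr) (auto simp: split_beta')
  also have "\<dots> = (CLINT \<tau>|R. CLINT z|std_normal_distribution. iexp (u * (sqrt (\<tau> * q) * z)))"
    using P.integral_fst'[OF int] by simp
  also have "\<dots> = (CLINT \<tau>|R. char std_normal_distribution (u * sqrt (\<tau> * q)))"
    by (simp add: char_def mult.assoc)
  also have "\<dots> = (CLINT \<tau>|R. of_real (exp (- (u\<^sup>2 * q / 2) * \<tau>)))"
  proof (rule integral_cong_AE)
    show "AE \<tau> in R. char std_normal_distribution (u * sqrt (\<tau> * q)) = of_real (exp (- (u\<^sup>2 * q / 2) * \<tau>))"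
      using AE_R_pos
    proof eventually_elim
      case (elim \<tau>)
      have "- (u * sqrt (\<tau> * q))\<^sup>2 / 2 = - (u\<^sup>2 * q / 2) * \<tau>"
        using elim assms by (simp add: power_mult_distrib)
      then show ?case by (simp only: char_std_normal_distribution)
    qed
  qed (auto simp: char_std_normal_distribution)
  also have "\<dots> = of_real (L (u\<^sup>2 * q / 2))"
    unfolding L_def by (rule integral_complex_of_real)
  finally show ?thesis .
qed

lemma law_moments:
  assumes q: "0 \<le> q"
  shows "has_bochner_integral (law q) (\<lambda>x. x ^ (2 * n))
      (1 / K * gamma_quot A B (real n + 1) * (fact (2 * n) / (fact n * 2 ^ n)) * q ^ n)" (is ?even)
    and "has_bochner_integral (law q) (\<lambda>x. x ^ (2 * n + 1)) 0" (is ?odd)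
proof -
  interpret G: real_distribution std_normal_distribution by (rule real_dist_normal_dist)
  have sf: "sigma_finite_measure R" "sigma_finite_measure std_normal_distribution"
    by (rule R.sigma_finite_measure_axioms G.sigma_finite_measure_axioms)+
  have to_law: "has_bochner_integral (law q) (\<lambda>x. x ^ k) (a * b)"
    if "has_bochner_integral R (\<lambda>\<tau>. sqrt (\<tau> * q) ^ k) a" "has_bochner_integral std_normal_distribution (\<lambda>z. z ^ k) b" for k a b
    unfolding law_def
  proof (rule has_bochner_integral_distr)
    show "has_bochner_integral (R \<Otimes>\<^sub>M std_normal_distribution) (\<lambda>x. (case x of (\<tau>, z) \<Rightarrow> sqrt (\<tau> * q) * z) ^ k) (a * b)"
      using integral_pair_mult[OF sf that] by (simp add: split_beta' power_mult_distrib)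
  qed measurable
  have even_R: "has_bochner_integral R (\<lambda>\<tau>. sqrt (\<tau> * q) ^ (2 * k)) (gamma_quot A B (real k + 1) / K * q ^ k)" for k
  proof -
    have "has_bochner_integral R (\<lambda>\<tau>. \<tau> ^ k * q ^ k) (gamma_quot A B (real k + 1) / K * q ^ k)"
      by (intro has_bochner_integral_mult_left R_moment)
    moreover have "AE \<tau> in R. \<tau> ^ k * q ^ k = sqrt (\<tau> * q) ^ (2 * k)"
      using AE_R_pos by eventually_elim (use q in \<open>simp add: power_mult power_mult_distrib\<close>)
    ultimately show ?thesis by (subst (asm) has_bochner_integral_cong_AE) auto
  qed
  have "has_bochner_integral std_normal_distribution (\<lambda>z. z ^ (2 * n)) (fact (2 * n) / (2 ^ n * fact n))"
    using std_normal_moment_even[of n] by (intro has_bochner_integral_density) auto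
  from to_law[OF even_R this] show ?even by (simp add: mult_ac)
  \<comment> \<open>The odd power is a half-integer moment of \<tau>, bounded by the sum of the two
    neighbouring even powers. Only its finiteness enters, since it is multiplied by an odd Gaussian
    moment, which is 0.\<close>
  have odd_R: "integrable R (\<lambda>\<tau>. sqrt (\<tau> * q) ^ (2 * n + 1))"
  proof (rule Bochner_Integration.integrable_bound)
    show "integrable R (\<lambda>\<tau>. sqrt (\<tau> * q) ^ (2 * n) + sqrt (\<tau> * q) ^ (2 * (n + 1)))"
      using even_R[of n] even_R[of "n + 1"] by (intro Bochner_Integration.integrable_add) (auto simp: has_bochner_integral_iff)
    show "AE \<tau> in R. norm (sqrt (\<tau> * q) ^ (2 * n + 1)) \<le> norm (sqrt (\<tau> * q) ^ (2 * n) + sqrt (\<tau> * q) ^ (2 * (n + 1)))"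
      using AE_R_pos
    proof eventually_elim
      case (elim \<tau>)
      define y where "y = sqrt (\<tau> * q)"
      have y: "0 \<le> y" using elim q by (simp add: y_def)
      have "y ^ (2 * n + 1) \<le> y ^ (2 * n) + y ^ (2 * (n + 1))"
      proof (cases "y \<le> 1")
        case True
        then have "y ^ (2 * n + 1) \<le> y ^ (2 * n)" using y by (intro power_decreasing) auto
        moreover have "0 \<le> y ^ (2 * (n + 1))" using y by simp
        ultimately show ?thesis by linarith
      next
        case False
        then have "y ^ (2 * n + 1) \<le> y ^ (2 * (n + 1))" by (intro power_increasing) auto
        moreover have "0 \<le> y ^ (2 * n)" using y by simp
        ultimately show ?thesis by linarith
      qed
      moreover have "0 \<le> y ^ (2 * n + 1)" using y by simp
      ultimately show ?case unfolding y_def[symmetric] real_norm_def by linarith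
    qed
  qed measurable
  have "has_bochner_integral std_normal_distribution (\<lambda>z. z ^ (2 * n + 1)) 0"
    using std_normal_moment_odd[of n] by (intro has_bochner_integral_density) auto
  from to_law[OF has_bochner_integral_integrable[OF odd_R] this] show ?odd by simp
qed

end

section \<open>Distribution of a pairing under the Fox H-measure\<close>

locale foxH_measure = foxH_mixture +
  fixes \<mu>
  assumes \<mu>: "is_foxH_measure A B c \<mu>"
begin

sublocale prob_space \<mu>
  using \<mu> by (simp add: is_foxH_measure_def)

lemma space_mu: "space \<mu> = tempered"
  using \<mu> sets_eq_imp_space_eq[of \<mu> cylinder_algebra] by (simp add: is_foxH_measure_def space_cylinder_algebra)

lemma pairing_measurable: "is_pairing \<mu> f Y \<Longrightarrow> Y \<in> borel_measurable \<mu>"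
  by (auto simp: is_pairing_def L2_tendsto_def square_integrable_def)

text \<open>Both sides pass to the limit along an approximating sequence: the left by convergence in
  L2 of the measure, the right by convergence of the norms and continuity of
  \<open>L\<close>.\<close>

lemma pairing_char:
  assumes "is_pairing \<mu> f Y"
  shows "(CLINT \<omega>|\<mu>. iexp (Y \<omega>)) = of_real (L ((LINT x|lborel. (f x)\<^sup>2) / 2))"
proof -
  obtain \<phi> where \<phi>: "\<And>n. \<phi> n \<in> schwartz" "L2_tendsto lborel \<phi> f" "L2_tendsto \<mu> (\<lambda>n \<omega>. \<omega> (\<phi> n)) Y"
    using assms by (auto simp: is_pairing_def)
  define N where "N = (\<lambda>n. (LINT x|lborel. (\<phi> n x)\<^sup>2) / 2)"
  have "N \<longlonglongrightarrow> (LINT x|lborel. (f x)\<^sup>2) / 2"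
    unfolding N_def by (intro tendsto_divide L2_tendsto_norm[OF \<phi>(2)]) auto
  then have "(\<lambda>n. complex_of_real (L (N n))) \<longlonglongrightarrow> of_real (L ((LINT x|lborel. (f x)\<^sup>2) / 2))"
    by (intro tendsto_of_real L_tendsto) (auto simp: N_def)
  moreover have "(CLINT \<omega>|\<mu>. iexp (\<omega> (\<phi> n))) = of_real (L (N n))" for n
  proof -
    have "(CLINT \<omega>|\<mu>. iexp (\<omega> (\<phi> n))) =
        1 / of_real (K_const A B) * gen_wright A B c (- (1 / 2) * (LBINT x. \<phi> n x * \<phi> n x))"
      using \<mu> \<phi>(1) by (simp add: is_foxH_measure_def)
    also have "- (1 / 2) * (LBINT x. \<phi> n x * \<phi> n x) = - N n"
      by (simp add: N_def power2_eq_square)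
    also have "1 / of_real (K_const A B) * gen_wright A B c (- N n) = of_real (L (N n))"
      by (rule gen_wright_eq_L) (simp add: N_def)
    finally show ?thesis .
  qed
  ultimately have "(\<lambda>n. CLINT \<omega>|\<mu>. iexp (\<omega> (\<phi> n))) \<longlonglongrightarrow> of_real (L ((LINT x|lborel. (f x)\<^sup>2) / 2))"
    by simp
  then show ?thesis
    using L2_tendsto_char[OF \<phi>(3)] LIMSEQ_unique by blast
qed

text \<open>Since u Y is a pairing for u f, the previous identity at frequency 1 determines the
  whole characteristic function.\<close>

lemma pairing_law:
  assumes Y: "is_pairing \<mu> f Y" and q: "has_bochner_integral lborel (\<lambda>x. (f x)\<^sup>2) q"
  shows "distr \<mu> borel Y = law q"
proof (rule Levy_uniqueness)
  have [measurable]: "Y \<in> borel_measurable \<mu>" by (rule pairing_measurable[OF Y])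
  have "0 \<le> (LINT x|lborel. (f x)\<^sup>2)" by simp
  then have q0: "0 \<le> q" using has_bochner_integral_integral_eq[OF q] by simp
  show "real_distribution (distr \<mu> borel Y)" by simp
  show "real_distribution (law q)"
    unfolding real_distribution_def real_distribution_axioms_def using prob_space_law by (simp add: law_def)
  show "char (distr \<mu> borel Y) = char (law q)"
  proof
    fix u
    have "is_pairing \<mu> (\<lambda>x. u * f x) (\<lambda>\<omega>. u * Y \<omega>)"
      using is_pairing_lincomb[OF space_mu Y Y, of u 0] by simp
    from pairing_char[OF this] have "(CLINT \<omega>|\<mu>. iexp (u * Y \<omega>)) = of_real (L ((LINT x|lborel. (u * f x)\<^sup>2) / 2))" .
    moreover have "(LINT x|lborel. (u * f x)\<^sup>2) = u\<^sup>2 * q"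
      using q by (simp add: power_mult_distrib has_bochner_integral_iff)
    ultimately show "char (distr \<mu> borel Y) u = char (law q) u"
      unfolding char_law[OF q0] by (simp add: char_def integral_distr)
  qed
qed

lemma pairing_moments:
  assumes Y: "is_pairing \<mu> f Y" and q: "has_bochner_integral lborel (\<lambda>x. (f x)\<^sup>2) q"
  shows "has_bochner_integral \<mu> (\<lambda>\<omega>. Y \<omega> ^ (2 * n))
      (1 / K * gamma_quot A B (real n + 1) * (fact (2 * n) / (fact n * 2 ^ n)) * q ^ n)"
    and "has_bochner_integral \<mu> (\<lambda>\<omega>. Y \<omega> ^ (2 * n + 1)) 0"
proof -
  have [measurable]: "Y \<in> borel_measurable \<mu>" by (rule pairing_measurable[OF Y])
  have "0 \<le> (LINT x|lborel. (f x)\<^sup>2)" by simp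
  then have q0: "0 \<le> q" using has_bochner_integral_integral_eq[OF q] by simp
  have from_law: "has_bochner_integral \<mu> (\<lambda>\<omega>. Y \<omega> ^ k) I" if "has_bochner_integral (law q) (\<lambda>x. x ^ k) I" for k I
    using that unfolding pairing_law[OF Y q, symmetric]
    by (simp add: has_bochner_integral_iff integrable_distr_eq integral_distr)
  show "has_bochner_integral \<mu> (\<lambda>\<omega>. Y \<omega> ^ (2 * n))
      (1 / K * gamma_quot A B (real n + 1) * (fact (2 * n) / (fact n * 2 ^ n)) * q ^ n)"
    and "has_bochner_integral \<mu> (\<lambda>\<omega>. Y \<omega> ^ (2 * n + 1)) 0"
    by (intro from_law law_moments q0)+
qed

end

section \<open>Finite-dimensional distributions\<close>

context foxH_mixture
begin

definition vec_law :: "real^'n^'n \<Rightarrow> (real^'n) measure" where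
  "vec_law Q = distr (R \<Otimes>\<^sub>M density lborel (\<lambda>x. ennreal (gauss_density Q x))) borel (\<lambda>(\<tau>, x). sqrt \<tau> *\<^sub>R x)"

text \<open>Given \<tau> the vector is Gaussian with covariance \<tau> Q, as moving the factor sqrt
  \<tau> from x to v shows; averaging the Gaussian characteristic functions over \<open>R\<close>
  gives \<open>L\<close>.\<close>

lemma char_vec_law:
  fixes Q :: "real^'n^'n"
  assumes sym: "transpose Q = Q" and pos: "\<And>v. v \<noteq> 0 \<Longrightarrow> 0 < v \<bullet> (Q *v v)"
  shows "prob_space (vec_law Q)"
    and "(CLINT x|vec_law Q. iexp (v \<bullet> x)) = of_real (L (v \<bullet> (Q *v v) / 2))"
proof -
  let ?N = "density lborel (\<lambda>x. ennreal (gauss_density Q x))"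
  interpret N: prob_space ?N by (rule gauss_density_char[OF sym]) (rule pos)
  interpret P: pair_prob_space R ?N ..
  show "prob_space (vec_law Q)" unfolding vec_law_def by (rule P.prob_space_distr) measurable
  let ?f = "\<lambda>(\<tau>, x). iexp (v \<bullet> (sqrt \<tau> *\<^sub>R x))"
  have int: "integrable (R \<Otimes>\<^sub>M ?N) ?f"
    by (rule P.integrable_const_bound[where B = 1]) (auto simp: split_beta')
  have "(CLINT x|vec_law Q. iexp (v \<bullet> x)) = integral\<^sup>L (R \<Otimes>\<^sub>M ?N) ?f"
    unfolding vec_law_def by (subst integral_distr) (auto simp: split_beta')
  also have "\<dots> = (CLINT \<tau>|R. CLINT x|?N. iexp (v \<bullet> (sqrt \<tau> *\<^sub>R x)))"
    using P.integral_fst'[OF int] by simp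
  also have "\<dots> = (CLINT \<tau>|R. of_real (exp (- (v \<bullet> (Q *v v) / 2) * \<tau>)))"
  proof (rule integral_cong_AE)
    have inner: "(CLINT x|?N. iexp (v \<bullet> (sqrt \<tau> *\<^sub>R x))) =
        of_real (exp (- ((sqrt \<tau> *\<^sub>R v) \<bullet> (Q *v (sqrt \<tau> *\<^sub>R v))) / 2))" for \<tau>
    proof -
      have "v \<bullet> (sqrt \<tau> *\<^sub>R x) = (sqrt \<tau> *\<^sub>R v) \<bullet> x" for x by simp
      then show ?thesis
        by (simp only:) (rule gauss_density_char(2)[OF sym], rule pos)
    qed
    show "AE \<tau> in R. (CLINT x|?N. iexp (v \<bullet> (sqrt \<tau> *\<^sub>R x))) = of_real (exp (- (v \<bullet> (Q *v v) / 2) * \<tau>))"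
      using AE_R_pos
    proof eventually_elim
      case (elim \<tau>)
      have "- ((sqrt \<tau> *\<^sub>R v) \<bullet> (Q *v (sqrt \<tau> *\<^sub>R v))) / 2 = - (v \<bullet> (Q *v v) / 2) * \<tau>"
        using elim by (simp add: matrix_vector_mult_scaleR mult.assoc[symmetric])
      then show ?case by (simp only: inner)
    qed
    show "(\<lambda>\<tau>. CLINT x|?N. iexp (v \<bullet> (sqrt \<tau> *\<^sub>R x))) \<in> borel_measurable R"
      unfolding inner by measurable
  qed measurable
  also have "\<dots> = of_real (L (v \<bullet> (Q *v v) / 2))"
    unfolding L_def by (rule integral_complex_of_real)
  finally show "(CLINT x|vec_law Q. iexp (v \<bullet> x)) = of_real (L (v \<bullet> (Q *v v) / 2))" .
qed

lemma foxH_process_density_eq: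
  "foxH_process_density A B \<gamma> H t x =
     (\<integral>\<^sup>+\<tau>. ennreal (\<rho> \<tau> * (1 / \<tau> powr (real CARD('n) / 2) * gauss_density (fbm_cov H t) (x /\<^sub>R sqrt \<tau>))) \<partial>lborel)"
  for t :: "'n::finite \<Rightarrow> real"
proof -
  let ?g = "\<lambda>\<tau>. 1 / \<tau> powr (real CARD('n) / 2) * gauss_density (fbm_cov H t) (x /\<^sub>R sqrt \<tau>)"
  have dens: "fbm_density H t y = gauss_density (fbm_cov H t) y" for y
    by (simp add: fbm_density_def gauss_density_def)
  have "(\<integral>\<^sup>+\<tau>\<in>{0<..}. ennreal (1 / \<tau> powr (real CARD('n) / 2) * fbm_density H t (x /\<^sub>R sqrt \<tau>) * Re (foxH A B \<gamma> \<tau>)) \<partial>lborel) =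
      (\<integral>\<^sup>+\<tau>. ennreal K * ennreal (\<rho> \<tau> * ?g \<tau>) \<partial>lborel)"
  proof (intro nn_integral_cong)
    fix \<tau> :: real
    show "ennreal (1 / \<tau> powr (real CARD('n) / 2) * fbm_density H t (x /\<^sub>R sqrt \<tau>) * Re (foxH A B \<gamma> \<tau>)) * indicator {0<..} \<tau> =
        ennreal K * ennreal (\<rho> \<tau> * ?g \<tau>)"
      using K_pos by (cases "0 < \<tau>") (simp_all add: dens \<rho>_def ennreal_mult'[symmetric] mult_ac)
  qed
  also have "\<dots> = ennreal K * (\<integral>\<^sup>+\<tau>. ennreal (\<rho> \<tau> * ?g \<tau>) \<partial>lborel)"
    by (rule nn_integral_cmult) measurable
  finally have "foxH_process_density A B \<gamma> H t x = ennreal (1 / K) * (ennreal K * (\<integral>\<^sup>+\<tau>. ennreal (\<rho> \<tau> * ?g \<tau>) \<partial>lborel))"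
    by (simp add: foxH_process_density_def)
  also have "\<dots> = ennreal (1 / K * K) * (\<integral>\<^sup>+\<tau>. ennreal (\<rho> \<tau> * ?g \<tau>) \<partial>lborel)"
    using K_pos by (subst ennreal_mult') (auto simp: mult.assoc)
  finally show ?thesis using K_pos by simp
qed

lemma foxH_process_density_measurable [measurable]:
  "foxH_process_density A B \<gamma> H t \<in> borel_measurable borel"
  unfolding foxH_process_density_eq[abs_def] by measurable

lemma vec_law_density:
  fixes t :: "'n::finite \<Rightarrow> real"
  shows "vec_law (fbm_cov H t) = density lborel (foxH_process_density A B \<gamma> H t)"
proof (rule measure_eqI)
  let ?d = "gauss_density (fbm_cov H t)"
  let ?N = "density lborel (\<lambda>x. ennreal (?d x))"
  show "sets (vec_law (fbm_cov H t)) = sets (density lborel (foxH_process_density A B \<gamma> H t))"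
    by (simp add: vec_law_def)
  fix S assume "S \<in> sets (vec_law (fbm_cov H t))"
  then have [measurable]: "S \<in> sets borel" by (simp add: vec_law_def)
  interpret N: sigma_finite_measure ?N
    by (subst sigma_finite_measure.sigma_finite_iff_density_finite[OF sigma_finite_lborel]) auto
  have inner: "ennreal (\<rho> \<tau>) * (\<integral>\<^sup>+x. indicator S (sqrt \<tau> *\<^sub>R x) \<partial>?N) =
      (\<integral>\<^sup>+x. ennreal (\<rho> \<tau> * (1 / \<tau> powr (real CARD('n) / 2) * ?d (x /\<^sub>R sqrt \<tau>))) * indicator S x \<partial>lborel)" for \<tau>
  proof (cases "0 < \<tau>")
    case True
    let ?c = "1 / sqrt \<tau>"
    have pow: "?c ^ CARD('n) = 1 / \<tau> powr (real CARD('n) / 2)"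
      using True by (simp add: power_divide powr_half_sqrt[symmetric] powr_power)
    have "(\<integral>\<^sup>+x. indicator S (sqrt \<tau> *\<^sub>R x) \<partial>?N) = (\<integral>\<^sup>+x. ennreal (?d x) * indicator S (sqrt \<tau> *\<^sub>R x) \<partial>lborel)"
      by (subst nn_integral_density) auto
    \<comment> \<open>Substitution of x / sqrt \<tau> for x; the Jacobian is the factor
      \<tau>^(-n/2) of the density.\<close>
    also have "\<dots> = (\<integral>\<^sup>+x. ennreal (\<bar>?c\<bar> ^ DIM(real^'n)) * (ennreal (?d (0 + ?c *\<^sub>R x)) * indicator S (sqrt \<tau> *\<^sub>R (0 + ?c *\<^sub>R x))) \<partial>lborel)"
      using True by (subst lborel_affine[of ?c 0]) (auto simp: nn_integral_density nn_integral_distr)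
    also have "\<dots> = (\<integral>\<^sup>+x. ennreal (1 / \<tau> powr (real CARD('n) / 2) * ?d (x /\<^sub>R sqrt \<tau>)) * indicator S x \<partial>lborel)"
    proof (intro nn_integral_cong)
      fix x :: "real^'n"
      have "\<bar>?c\<bar> ^ DIM(real^'n) = 1 / \<tau> powr (real CARD('n) / 2)" using True pow by simp
      moreover have "0 + ?c *\<^sub>R x = x /\<^sub>R sqrt \<tau>" "sqrt \<tau> *\<^sub>R (0 + ?c *\<^sub>R x) = x"
        using True by (simp_all add: divide_inverse)
      ultimately show "ennreal (\<bar>?c\<bar> ^ DIM(real^'n)) * (ennreal (?d (0 + ?c *\<^sub>R x)) * indicator S (sqrt \<tau> *\<^sub>R (0 + ?c *\<^sub>R x))) =
          ennreal (1 / \<tau> powr (real CARD('n) / 2) * ?d (x /\<^sub>R sqrt \<tau>)) * indicator S x"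
        by (simp only: ennreal_mult''[OF gauss_density_nonneg] mult.assoc)
    qed
    finally have "ennreal (\<rho> \<tau>) * (\<integral>\<^sup>+x. indicator S (sqrt \<tau> *\<^sub>R x) \<partial>?N) =
        ennreal (\<rho> \<tau>) * (\<integral>\<^sup>+x. ennreal (1 / \<tau> powr (real CARD('n) / 2) * ?d (x /\<^sub>R sqrt \<tau>)) * indicator S x \<partial>lborel)"
      by simp
    also have "\<dots> = (\<integral>\<^sup>+x. ennreal (\<rho> \<tau>) * (ennreal (1 / \<tau> powr (real CARD('n) / 2) * ?d (x /\<^sub>R sqrt \<tau>)) * indicator S x) \<partial>lborel)"
      by (rule nn_integral_cmult[symmetric]) measurable
    finally show ?thesis
      by (simp only: ennreal_mult'[OF rho_nonneg] mult.assoc)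
  qed (simp add: \<rho>_def)
  have "emeasure (vec_law (fbm_cov H t)) S = (\<integral>\<^sup>+p. indicator S (case p of (\<tau>, x) \<Rightarrow> sqrt \<tau> *\<^sub>R x) \<partial>(R \<Otimes>\<^sub>M ?N))"
    unfolding vec_law_def by (simp add: nn_integral_distr flip: nn_integral_indicator)
  also have "\<dots> = (\<integral>\<^sup>+\<tau>. \<integral>\<^sup>+x. indicator S (sqrt \<tau> *\<^sub>R x) \<partial>?N \<partial>R)"
    by (subst N.nn_integral_fst[symmetric]) auto
  also have "\<dots> = (\<integral>\<^sup>+\<tau>. ennreal (\<rho> \<tau>) * (\<integral>\<^sup>+x. indicator S (sqrt \<tau> *\<^sub>R x) \<partial>?N) \<partial>lborel)"
    unfolding R_def by (rule nn_integral_density) auto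
  also have "\<dots> = (\<integral>\<^sup>+\<tau>. \<integral>\<^sup>+x. ennreal (\<rho> \<tau> * (1 / \<tau> powr (real CARD('n) / 2) * ?d (x /\<^sub>R sqrt \<tau>))) * indicator S x \<partial>lborel \<partial>lborel)"
    by (simp only: inner)
  \<comment> \<open>Tonelli, valid in [0,\<infinity>] although the inner integral may diverge at x =
    0.\<close>
  also have "\<dots> = (\<integral>\<^sup>+x. \<integral>\<^sup>+\<tau>. ennreal (\<rho> \<tau> * (1 / \<tau> powr (real CARD('n) / 2) * ?d (x /\<^sub>R sqrt \<tau>))) * indicator S x \<partial>lborel \<partial>lborel)"
    by (rule lborel_pair.Fubini'[symmetric]) measurable
  also have "\<dots> = (\<integral>\<^sup>+x. foxH_process_density A B \<gamma> H t x * indicator S x \<partial>lborel)"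
    unfolding foxH_process_density_eq by (intro nn_integral_cong nn_integral_multc) measurable
  also have "\<dots> = emeasure (density lborel (foxH_process_density A B \<gamma> H t)) S"
    by (simp add: emeasure_density)
  finally show "emeasure (vec_law (fbm_cov H t)) S = emeasure (density lborel (foxH_process_density A B \<gamma> H t)) S" .
qed

end

lemma transpose_fbm_cov: "transpose (fbm_cov H t) = fbm_cov H t"
  by (simp add: vec_eq_iff transpose_def fbm_cov_def abs_minus_commute add.commute)

text \<open>The quadratic form is the squared norm of the combination of kernels with coefficients
  v, which can vanish only for v = 0.\<close>

lemma fbm_cov_posdef:
  fixes t :: "'n::{finite,linorder} \<Rightarrow> real"
  assumes H: "0 < H" "H < 1" and t: "strict_mono t" "\<And>i. 0 < t i" and v: "v \<noteq> 0"
  shows "0 < v \<bullet> (fbm_cov H t *v v)"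
proof -
  let ?f = "\<lambda>x. \<Sum>i\<in>UNIV. v $ i * fbm_kernel H (t i) x"
  have int: "has_bochner_integral lborel (\<lambda>x. (?f x)\<^sup>2) (v \<bullet> (fbm_cov H t *v v))"
    using has_bochner_integral_fbm_kernel_sum[OF H, of "($) v" t] by simp
  have "(LINT x|lborel. (?f x)\<^sup>2) \<noteq> 0"
  proof
    assume "(LINT x|lborel. (?f x)\<^sup>2) = 0"
    then have "AE x in lborel. (?f x)\<^sup>2 = 0"
      using int by (subst (asm) integral_nonneg_eq_0_iff_AE) (auto simp: has_bochner_integral_iff)
    then have "AE x in lborel. ?f x = 0" by simp
    from fbm_kernel_independent[OF H t this] have "v $ i = 0" for i .
    then show False using v by (simp add: vec_eq_iff)
  qed
  moreover have "0 \<le> (LINT x|lborel. (?f x)\<^sup>2)" by simp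
  ultimately show ?thesis using has_bochner_integral_integral_eq[OF int] by simp
qed

section \<open>The generalized Fox H-process\<close>

locale foxH_process = foxH_measure +
  fixes H :: real and X :: "real \<Rightarrow> ((real \<Rightarrow> real) \<Rightarrow> real) \<Rightarrow> real"
  assumes H: "0 < H" "H < 1" and X: "is_foxH_process \<mu> H X"
begin

lemma pairing_X:
  assumes "0 \<le> t"
  shows "is_pairing \<mu> (fbm_kernel H t) (X t)"
proof (rule is_pairing_cong_AE)
  show "is_pairing \<mu> (M_minus H (indicator {0..<t})) (X t)"
    using X assms by (simp add: is_foxH_process_def)
  show "AE x in lborel. M_minus H (indicator {0..<t}) x = fbm_kernel H t x"
    by (rule M_minus_indicator[OF H assms])
  show "fbm_kernel H t \<in> borel_measurable borel"
    by (rule fbm_kernel_measurable[OF H])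
qed

lemma X_measurable: "0 \<le> t \<Longrightarrow> X t \<in> borel_measurable \<mu>"
  by (rule pairing_measurable[OF pairing_X])

text \<open>A linear combination of the values of the process is itself a pairing, with the same
  combination of kernels, whose squared norm is the quadratic form of the covariance.\<close>

lemma char_X:
  fixes t :: "'n::finite \<Rightarrow> real" and v :: "real^'n"
  assumes t: "\<And>i. 0 \<le> t i"
  shows "(CLINT \<omega>|\<mu>. iexp (v \<bullet> (\<chi> i. X (t i) \<omega>))) = of_real (L (v \<bullet> (fbm_cov H t *v v) / 2))"
proof -
  have "is_pairing \<mu> (\<lambda>x. \<Sum>i\<in>UNIV. v $ i * fbm_kernel H (t i) x) (\<lambda>\<omega>. \<Sum>i\<in>UNIV. v $ i * X (t i) \<omega>)"
    by (intro is_pairing_sum[OF space_mu] pairing_X t) auto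
  from pairing_char[OF this] show ?thesis
    using has_bochner_integral_integral_eq[OF has_bochner_integral_fbm_kernel_sum[OF H, of "($) v" t]]
    by (simp add: inner_vec_def)
qed

lemma vec_X_measurable:
  fixes t :: "'n::finite \<Rightarrow> real"
  assumes "\<And>i. 0 \<le> t i"
  shows "(\<lambda>\<omega>. \<chi> i. X (t i) \<omega>) \<in> borel_measurable \<mu>"
  using X_measurable assms
  by (subst borel_measurable_euclidean_space) (auto simp: Basis_vec_def inner_axis)

lemma characteristic_function:
  fixes t :: "'n::finite \<Rightarrow> real" and v :: "real^'n"
  assumes t: "\<And>i. 0 \<le> t i"
  shows "has_bochner_integral \<mu> (\<lambda>\<omega>. iexp (v \<bullet> (\<chi> i. X (t i) \<omega>)))
    (1 / of_real K * gen_wright A B c (- (v \<bullet> (fbm_cov H t *v v)) / 2))"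
proof -
  have [measurable]: "(\<lambda>\<omega>. \<chi> i. X (t i) \<omega>) \<in> borel_measurable \<mu>"
    by (rule vec_X_measurable[OF t])
  \<comment> \<open>Being a squared norm, the quadratic form is non-negative, so
    \<open>gen_wright_eq_L\<close> applies to its half.\<close>
  have "0 \<le> (LINT x|lborel. (\<Sum>i\<in>UNIV. v $ i * fbm_kernel H (t i) x)\<^sup>2)" by simp
  then have "0 \<le> v \<bullet> (fbm_cov H t *v v) / 2"
    using has_bochner_integral_integral_eq[OF has_bochner_integral_fbm_kernel_sum[OF H, of "($) v" t]] by simp
  from gen_wright_eq_L[OF this] char_X[OF t, of v] have
    "(CLINT \<omega>|\<mu>. iexp (v \<bullet> (\<chi> i. X (t i) \<omega>))) = 1 / of_real K * gen_wright A B c (- (v \<bullet> (fbm_cov H t *v v)) / 2)"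
    by simp
  moreover have "integrable \<mu> (\<lambda>\<omega>. iexp (v \<bullet> (\<chi> i. X (t i) \<omega>)))"
    by (rule integrable_const_bound[where B = 1]) auto
  ultimately show ?thesis by (simp add: has_bochner_integral_iff)
qed

lemma joint_density:
  fixes t :: "'n::{finite,linorder} \<Rightarrow> real"
  assumes t: "strict_mono t" "\<And>i. 0 < t i"
  shows "distributed \<mu> lborel (\<lambda>\<omega>. \<chi> i. X (t i) \<omega>) (foxH_process_density A B \<gamma> H t)"
proof -
  have t0: "0 \<le> t i" for i using t(2)[of i] by simp
  have [measurable]: "(\<lambda>\<omega>. \<chi> i. X (t i) \<omega>) \<in> borel_measurable \<mu>"
    by (rule vec_X_measurable[OF t0])
  note posdef = fbm_cov_posdef[OF H t]
  have "distr \<mu> borel (\<lambda>\<omega>. \<chi> i. X (t i) \<omega>) = vec_law (fbm_cov H t)"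
  proof (rule char_vec_uniqueness)
    show "prob_space (distr \<mu> borel (\<lambda>\<omega>. \<chi> i. X (t i) \<omega>))" by (rule prob_space_distr) measurable
    show "prob_space (vec_law (fbm_cov H t))"
      by (rule char_vec_law[OF transpose_fbm_cov]) (rule posdef)
    show "(CLINT x|distr \<mu> borel (\<lambda>\<omega>. \<chi> i. X (t i) \<omega>). iexp (v \<bullet> x)) =
        (CLINT x|vec_law (fbm_cov H t). iexp (v \<bullet> x))" for v
    proof -
      have "(CLINT x|vec_law (fbm_cov H t). iexp (v \<bullet> x)) = of_real (L (v \<bullet> (fbm_cov H t *v v) / 2))"
        by (rule char_vec_law[OF transpose_fbm_cov]) (rule posdef)
      moreover have "(CLINT x|distr \<mu> borel (\<lambda>\<omega>. \<chi> i. X (t i) \<omega>). iexp (v \<bullet> x)) =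
          (CLINT \<omega>|\<mu>. iexp (v \<bullet> (\<chi> i. X (t i) \<omega>)))"
        by (rule integral_distr) measurable
      ultimately show ?thesis by (simp only: char_X[OF t0])
    qed
  qed (simp_all add: vec_law_def)
  moreover have "distr \<mu> lborel (\<lambda>\<omega>. \<chi> i. X (t i) \<omega>) = distr \<mu> borel (\<lambda>\<omega>. \<chi> i. X (t i) \<omega>)"
    by (rule distr_cong) auto
  ultimately show ?thesis
    by (simp add: distributed_def vec_law_density)
qed

text \<open>The power \<open>(t powr (2 * H)) ^ n\<close> is the form that remains right at t = 0
  and n = 0: it equals 1, as the zeroth moment does, whereas \<open>0 powr 0\<close> is 0.\<close>

lemma moments:
  assumes t: "0 \<le> t"
  shows "has_bochner_integral \<mu> (\<lambda>\<omega>. X t \<omega> ^ (2 * n + 1)) 0"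
    and "has_bochner_integral \<mu> (\<lambda>\<omega>. X t \<omega> ^ (2 * n))
      (1 / K * gamma_quot A B (real n + 1) * (fact (2 * n) / (fact n * 2 ^ n)) * (t powr (2 * H)) ^ n)"
proof -
  have "has_bochner_integral lborel (\<lambda>x. (fbm_kernel H t x)\<^sup>2) (t powr (2 * H))"
    using has_bochner_integral_fbm_kernel_diff[OF H, of t 0] t by (simp add: fbm_kernel_def)
  from pairing_moments[OF pairing_X[OF t] this]
  show "has_bochner_integral \<mu> (\<lambda>\<omega>. X t \<omega> ^ (2 * n + 1)) 0"
    and "has_bochner_integral \<mu> (\<lambda>\<omega>. X t \<omega> ^ (2 * n))
      (1 / K * gamma_quot A B (real n + 1) * (fact (2 * n) / (fact n * 2 ^ n)) * (t powr (2 * H)) ^ n)"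
    by blast+
qed

text \<open>Polarization of second moments: the increment is a pairing with squared norm |t -
  s|^(2H), and for n = 1 the Gaussian factor 2! / (1! 2) is 1.\<close>

lemma covariance:
  assumes t: "0 \<le> t" and s: "0 \<le> s"
  shows "has_bochner_integral \<mu> (\<lambda>\<omega>. X t \<omega> * X s \<omega>)
    (1 / (2 * K) * gamma_quot A B 2 * (t powr (2 * H) + s powr (2 * H) - \<bar>t - s\<bar> powr (2 * H)))"
proof -
  let ?C = "1 / K * gamma_quot A B 2"
  have sq: "has_bochner_integral \<mu> (\<lambda>\<omega>. (X t \<omega>)\<^sup>2) (?C * t powr (2 * H))" if "0 \<le> t" for t
    using moments(2)[OF that, of 1] by simp
  have "is_pairing \<mu> (\<lambda>x. fbm_kernel H t x - fbm_kernel H s x) (\<lambda>\<omega>. X t \<omega> - X s \<omega>)"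
    using is_pairing_lincomb[OF space_mu pairing_X[OF t] pairing_X[OF s], of 1 "-1"] by simp
  from pairing_moments(1)[OF this has_bochner_integral_fbm_kernel_diff[OF H], of 1]
  have diff: "has_bochner_integral \<mu> (\<lambda>\<omega>. (X t \<omega> - X s \<omega>)\<^sup>2) (?C * \<bar>t - s\<bar> powr (2 * H))"
    by simp
  have "has_bochner_integral \<mu> (\<lambda>\<omega>. 1 / 2 * ((X t \<omega>)\<^sup>2 + (X s \<omega>)\<^sup>2 - (X t \<omega> - X s \<omega>)\<^sup>2))
      (1 / 2 * (?C * t powr (2 * H) + ?C * s powr (2 * H) - ?C * \<bar>t - s\<bar> powr (2 * H)))"
    by (intro has_bochner_integral_mult_right has_bochner_integral_diff has_bochner_integral_add sq diff t s)
  moreover have "1 / 2 * ((X t \<omega>)\<^sup>2 + (X s \<omega>)\<^sup>2 - (X t \<omega> - X s \<omega>)\<^sup>2) = X t \<omega> * X s \<omega>" for \<omega>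
    by (simp add: power2_diff)
  moreover have "1 / 2 * (?C * t powr (2 * H) + ?C * s powr (2 * H) - ?C * \<bar>t - s\<bar> powr (2 * H)) =
      1 / (2 * K) * gamma_quot A B 2 * (t powr (2 * H) + s powr (2 * H) - \<bar>t - s\<bar> powr (2 * H))"
    by (simp add: algebra_simps diff_divide_distrib add_divide_distrib)
  ultimately show ?thesis by (simp only:)
qed

end

theorem proposition3p5:
  fixes A B :: "(real \<times> real) list"
    and \<gamma> c H :: real
    and \<mu> :: "((real \<Rightarrow> real) \<Rightarrow> real) measure"
    and X :: "real \<Rightarrow> ((real \<Rightarrow> real) \<Rightarrow> real) \<Rightarrow> real"
  assumes "foxH_contour B \<gamma>"
    and "wright_contour B c"
    and "foxH_parameters A B \<gamma>"
    and "0 < H" and "H < 1"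
    and "is_foxH_measure A B c \<mu>"
    and "is_foxH_process \<mu> H X"
  shows
    "(\<forall>(t :: 'n::{finite,linorder} \<Rightarrow> real) (v :: real^'n::{finite,linorder}). strict_mono t \<and> (\<forall>i. 0 < t i) \<longrightarrow>
        has_bochner_integral \<mu> (\<lambda>\<omega>. exp (\<i> * of_real (v \<bullet> (\<chi> i. X (t i) \<omega>))))
          (1 / of_real (K_const A B) * gen_wright A B c (- (v \<bullet> (fbm_cov H t *v v)) / 2)))
   \<and> (\<forall>t :: 'n::{finite,linorder} \<Rightarrow> real. strict_mono t \<and> (\<forall>i. 0 < t i) \<longrightarrow>
        distributed \<mu> lborel (\<lambda>\<omega>. \<chi> i. X (t i) \<omega>) (foxH_process_density A B \<gamma> H t))
   \<and> (\<forall>t\<ge>0. \<forall>n::nat.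
        has_bochner_integral \<mu> (\<lambda>\<omega>. X t \<omega> ^ (2 * n + 1)) 0 \<and>
        has_bochner_integral \<mu> (\<lambda>\<omega>. X t \<omega> ^ (2 * n))
          (1 / K_const A B * gamma_quot A B (real n + 1) * (fact (2 * n) / (fact n * 2 ^ n)) *
           (t powr (2 * H)) ^ n))
   \<and> (\<forall>t\<ge>0. \<forall>s\<ge>0.
        has_bochner_integral \<mu> (\<lambda>\<omega>. X t \<omega> * X s \<omega>)
          (1 / (2 * K_const A B) * gamma_quot A B 2 *
           (t powr (2 * H) + s powr (2 * H) - \<bar>t - s\<bar> powr (2 * H))))"
proof -
  interpret foxH_process A B \<gamma> c \<mu> H X
    using assms by unfold_locales (auto simp: foxH_parameters_def)
  show ?thesis
  proof (intro conjI allI impI)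
    fix t :: "'n \<Rightarrow> real" and v :: "(real, 'n) vec"
    assume "strict_mono t \<and> (\<forall>i. 0 < t i)"
    then show "has_bochner_integral \<mu> (\<lambda>\<omega>. exp (\<i> * of_real (v \<bullet> (\<chi> i. X (t i) \<omega>))))
        (1 / of_real (K_const A B) * gen_wright A B c (- (v \<bullet> (fbm_cov H t *v v)) / 2))"
      by (intro characteristic_function) (simp add: less_imp_le)
  next
    fix t :: "'n \<Rightarrow> real"
    assume "strict_mono t \<and> (\<forall>i. 0 < t i)"
    then show "distributed \<mu> lborel (\<lambda>\<omega>. \<chi> i. X (t i) \<omega>) (foxH_process_density A B \<gamma> H t)"
      by (intro joint_density) simp_all
  qed (rule moments covariance; assumption)+
qed

end
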